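(* Let $A$ be a regular weak multiplier Hopf algebra with a faithful left cointegral $h\in A$, and let $\int_L$ be the set of left integrals on $A$. Then $\int_L$ is right faithful, in the sense that if $a\in A$ and $\varphi(ab)=0$ for all $b\in A$ and all $\varphi\in\int_L$, then $a=0$. Moreover, $\int_L$ is left faithful, in the sense that if $a\in A$ and $\varphi(ba)=0$ for all $b\in A$ and all $\varphi\in\int_L$ then $a=0$, if and only if the map $S_1':A\to M(A)$ is injective.
   Context: All algebras are over $\mathbb{C}$, associative, possibly non-unital, with non-degenerate product. $A$ is idempotent if $A^2=A$; $M(A)$ is the multiplier algebra (identity $1$); $A'$ is the space of all linear functionals on $A$. A coproduct is a homomorphism $\Delta:A\to M(A\otimes A)$ with $\Delta(a)(1\otimes b),(a\otimes 1)\Delta(b)\in A\otimes A$, coassociative: $(a\otimes1\otimes1)(\Delta\otimes id)(\Delta(b)(1\otimes c))=(id\otimes\Delta)((a\otimes1)\Delta(b))(1\otimes1\otimes c)$. Put $T_1(a\otimes b)=\Delta(a)(1\otimes b)$, $T_2(a\otimes b)=(a\otimes1)\Delta(b)$. $\Delta$ is full if the smallest subspaces $V,W\subset A$ with $\Delta(A)(1\otimes A)\subset V\otimes A$ and $(A\otimes1)\Delta(A)\subset A\otimes W$ both equal $A$. A counit is a linear functional $\varepsilon$ with $(\varepsilon\otimes id)(\Delta(a)(1\otimes b))=ab$, $(id\otimes\varepsilon)((c\otimes1)\Delta(a))=ca$. A weak multiplier Hopf algebra is a non-degenerate idempotent algebra $A$ with a full coproduct $\Delta$ and a counit such that: (i)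 there is an idempotent $E\in M(A\otimes A)$ with $T_1(A\otimes A)=E(A\otimes A)$, $T_2(A\otimes A)=(A\otimes A)E$; (ii) $(id\otimes\Delta)E=(E\otimes1)(1\otimes E)=(1\otimes E)(E\otimes1)$; (iii) $\mathrm{Ker}(T_i)=(1-G_i)(A\otimes A)$, $i=1,2$, where $G_1,G_2$ are the linear maps on $A\otimes A$ given by $(G_1\otimes id)(\Delta_{13}(a)(1\otimes b\otimes c))=\Delta_{13}(a)(1\otimes E)(1\otimes b\otimes c)$ and $(id\otimes G_2)((a\otimes b\otimes1)\Delta_{13}(c))=(a\otimes b\otimes1)(E\otimes1)\Delta_{13}(c)$. Here $\Delta$ (and likewise $id\otimes\Delta$) is uniquely extended to multipliers, with $\Delta(1)=E$. With Sweedler notation $\Delta(a)=\sum a_{(1)}\otimes a_{(2)}$, the antipode $S$ is the non-degenerate anti-homomorphism $A\to M(A)$ with $E(a\otimes b)=\sum a_{(1)}\otimes a_{(2)}S(a_{(3)})b$, $(a\otimes b)E=\sum aS(b_{(1)})b_{(2)}\otimes b_{(3)}$, $G_1(a\otimes b)=\sum a_{(1)}\otimes S(a_{(2)})a_{(3)}b$, $G_2(a\otimes b)=\sum ab_{(1)}S(b_{(2)})\otimes b_{(3)}$, $\sum S(a_{(1)})a_{(2)}S(a_{(3)})=S(a)$; it extends to $M(A)$. $A$ is regular if $S$ is bijective from $A$ to $A$; then also $\Delta(a)(b\otimes1),(1\otimes a)\Delta(b)\in A\otimes A$. Put $\varepsilon_t(a)=\sum a_{(1)}S(a_{(2)})$,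 $A_t=\{x\in M(A):\Delta(x)=(x\otimes1)E\}$. For $f\in A'$, $(id\otimes f)\Delta(a)$ and $(f\otimes id)\Delta(a)$ are the elements of $M(A)$ defined by slicing after multiplying, on either side, by $b\otimes1$, resp. $1\otimes b$, $b\in A$. A left cointegral is a non-zero $h\in M(A)$ with $ah=\varepsilon_t(a)h$ for all $a\in A$. It is faithful if for $f\in A'$, $(id\otimes f)\Delta(h)=0$ or $(f\otimes id)\Delta(h)=0$ implies $f=0$. A left integral is a non-zero $\varphi\in A'$ with $(id\otimes\varphi)\Delta(a)\in A_t$ for all $a\in A$. If $h\in A$ is a faithful left cointegral, then $ha\in hA_t$ for each $a\in A$ and a map $\gamma_t:A\to A_t$ is determined by $ha=h\gamma_t(a)$. Put $S_1'(a)=\sum\gamma_t(a_{(2)})S^{-1}(a_{(1)})\in M(A)$. *)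

theory Defs
  imports Complex_Main
begin

section \<open>Complex vector spaces and possibly non-unital complex algebras\<close>

class complex_vector = ab_group_add +
  fixes scaleC :: "complex \<Rightarrow> 'a \<Rightarrow> 'a" (infixr \<open>*\<^sub>C\<close> 75)
  assumes scaleC_add_right: "a *\<^sub>C (x + y) = a *\<^sub>C x + a *\<^sub>C y"
    and scaleC_add_left: "(a + b) *\<^sub>C x = a *\<^sub>C x + b *\<^sub>C x"
    and scaleC_scaleC: "a *\<^sub>C b *\<^sub>C x = (a * b) *\<^sub>C x"
    and scaleC_one: "1 *\<^sub>C x = x"

class complex_algebra = complex_vector + ring +
  assumes mult_scaleC_left: "a *\<^sub>C x * y = a *\<^sub>C (x * y)"
    and mult_scaleC_right: "x * a *\<^sub>C y = a *\<^sub>C (x * y)"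

instantiation complex :: complex_algebra
begin

definition scaleC_complex_def: "scaleC a x = a * (x::complex)"

instance
  by standard (simp_all add: scaleC_complex_def algebra_simps)

end

global_interpretation complex_vector:
  vector_space "scaleC :: complex \<Rightarrow> 'a \<Rightarrow> 'a :: complex_vector"
  by standard (rule scaleC_add_right scaleC_add_left scaleC_scaleC scaleC_one)+

global_interpretation complex_vector:
  vector_space_pair "scaleC :: complex \<Rightarrow> 'a \<Rightarrow> 'a :: complex_vector"
    "scaleC :: complex \<Rightarrow> 'b \<Rightarrow> 'b :: complex_vector"
  by standard

abbreviation clinear :: "('a::complex_vector \<Rightarrow> 'b::complex_vector) \<Rightarrow> bool"
  where "clinear \<equiv> Vector_Spaces.linear scaleC scaleC"

abbreviation csubspace :: "'a::complex_vector set \<Rightarrow> bool"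
  where "csubspace \<equiv> module.subspace scaleC"

abbreviation cspan :: "'a::complex_vector set \<Rightarrow> 'a set"
  where "cspan \<equiv> module.span scaleC"

definition cbilinear :: "('a::complex_vector \<Rightarrow> 'b::complex_vector \<Rightarrow> 'c::complex_vector) \<Rightarrow> bool"
  where "cbilinear f \<longleftrightarrow> (\<forall>y. clinear (\<lambda>x. f x y)) \<and> (\<forall>x. clinear (f x))"

lemma clinear_iff:
  "clinear f \<longleftrightarrow> (\<forall>x y. f (x + y) = f x + f y) \<and> (\<forall>c x. f (c *\<^sub>C x) = c *\<^sub>C f x)"
  by (simp add: Vector_Spaces.linear_def module_hom_def module_hom_axioms_def
      complex_vector.vector_space_axioms complex_vector.module_axioms)

lemma clinear_add: "clinear f \<Longrightarrow> f (x + y) = f x + f y"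
  and clinear_scaleC: "clinear f \<Longrightarrow> f (c *\<^sub>C x) = c *\<^sub>C f x"
  by (simp_all add: clinear_iff)

lemma clinear_zero: "clinear f \<Longrightarrow> f 0 = 0"
  and clinear_minus: "clinear f \<Longrightarrow> f (- x) = - f x"
  and clinear_diff: "clinear f \<Longrightarrow> f (x - y) = f x - f y"
  by (simp_all add: complex_vector.linear_0 complex_vector.linear_neg complex_vector.linear_diff)

lemma clinear_sum_list: "clinear f \<Longrightarrow> f (sum_list xs) = sum_list (map f xs)"
  by (induction xs) (simp_all add: clinear_add clinear_zero)

lemma clinear_id [simp]: "clinear id" "clinear (\<lambda>x. x)"
  by (simp_all add: clinear_iff)

lemma clinear_compose: "clinear f \<Longrightarrow> clinear g \<Longrightarrow> clinear (\<lambda>x. g (f x))"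
  by (simp add: clinear_iff)

lemma cbilinear_iff:
  "cbilinear f \<longleftrightarrow> (\<forall>x y z. f (x + y) z = f x z + f y z) \<and> (\<forall>c x z. f (c *\<^sub>C x) z = c *\<^sub>C f x z)
    \<and> (\<forall>x y z. f x (y + z) = f x y + f x z) \<and> (\<forall>c x z. f x (c *\<^sub>C z) = c *\<^sub>C f x z)"
  by (auto simp: cbilinear_def clinear_iff)

lemma clinear_separates:
  fixes v :: "'a::complex_vector"
  assumes "v \<noteq> 0"
  shows "\<exists>f :: 'a \<Rightarrow> complex. clinear f \<and> f v \<noteq> 0"
proof -
  have "module.independent scaleC {v}"
    using assms by (simp add: complex_vector.dependent_single)
  from complex_vector.linear_independent_extend[OF this, of "\<lambda>_. 1::complex"]
  show ?thesis by auto
qed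


section \<open>The algebraic tensor product\<close>

text \<open>
  Elements are formal sums of pairs, two of which are identified iff no bilinear form separates
  them.  The lemmas \<open>tensor_induct\<close>, \<open>cbilinear_tensor\<close>, \<open>tlift_tensor\<close> and \<open>clinear_tlift\<close> below
  give the universal property for bilinear maps into arbitrary complex vector spaces.
\<close>

definition tensor_sum :: "('a \<Rightarrow> 'b \<Rightarrow> 'c::monoid_add) \<Rightarrow> ('a \<times> 'b) list \<Rightarrow> 'c"
  where "tensor_sum f xs = (\<Sum>(a, b)\<leftarrow>xs. f a b)"

definition tensor_eq ::
    "('a::complex_vector \<times> 'b::complex_vector) list \<Rightarrow> ('a \<times> 'b) list \<Rightarrow> bool"
  where "tensor_eq xs ys \<longleftrightarrow>
    (\<forall>f :: 'a \<Rightarrow> 'b \<Rightarrow> complex. cbilinear f \<longrightarrow> tensor_sum f xs = tensor_sum f ys)"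

quotient_type (overloaded) ('a, 'b) tensor =
    "('a::complex_vector \<times> 'b::complex_vector) list" / tensor_eq
  by (auto intro!: equivpI reflpI sympI transpI simp: tensor_eq_def)

type_synonym 'a tensor2 = "('a, 'a) tensor"
type_synonym 'a tensor3 = "('a, ('a, 'a) tensor) tensor"

lemma tensor_sum_simps [simp]:
  "tensor_sum f [] = 0"
  "tensor_sum f (x # xs) = f (fst x) (snd x) + tensor_sum f xs"
  "tensor_sum f (xs @ ys) = tensor_sum f xs + tensor_sum f ys"
  by (simp_all add: tensor_sum_def case_prod_beta)

lemma tensor_sum_scale:
  fixes f :: "'a::complex_vector \<Rightarrow> 'b::complex_vector \<Rightarrow> 'c::complex_vector"
  assumes "cbilinear f"
  shows "tensor_sum f (map (\<lambda>(a, b). (c *\<^sub>C a, b)) xs) = c *\<^sub>C tensor_sum f xs"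
  using assms by (induction xs) (auto simp: cbilinear_iff scaleC_add_right)

lemma tensor_sum_uminus:
  fixes f :: "'a::complex_vector \<Rightarrow> 'b::complex_vector \<Rightarrow> 'c::complex_vector"
  assumes "cbilinear f"
  shows "tensor_sum f (map (\<lambda>(a, b). (- a, b)) xs) = - tensor_sum f xs"
  using tensor_sum_scale[OF assms, of "- 1" xs] by (simp add: scaleC_one)

instantiation tensor :: (complex_vector, complex_vector) complex_vector
begin

lift_definition zero_tensor :: "('a, 'b) tensor" is "[]" .

lift_definition plus_tensor :: "('a, 'b) tensor \<Rightarrow> ('a, 'b) tensor \<Rightarrow> ('a, 'b) tensor"
  is "(@)" by (simp add: tensor_eq_def)

lift_definition scaleC_tensor :: "complex \<Rightarrow> ('a, 'b) tensor \<Rightarrow> ('a, 'b) tensor"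
  is "\<lambda>c. map (\<lambda>(a, b). (c *\<^sub>C a, b))"
  by (simp add: tensor_eq_def tensor_sum_scale)

lift_definition uminus_tensor :: "('a, 'b) tensor \<Rightarrow> ('a, 'b) tensor"
  is "map (\<lambda>(a, b). (- a, b))"
  by (simp add: tensor_eq_def tensor_sum_uminus)

definition minus_tensor :: "('a, 'b) tensor \<Rightarrow> ('a, 'b) tensor \<Rightarrow> ('a, 'b) tensor"
  where "minus_tensor s t = s + - t"

instance
proof
  fix a b c :: "('a, 'b) tensor" and x y :: complex
  show "a + b + c = a + (b + c)" by transfer (simp add: tensor_eq_def add.assoc)
  show "a + b = b + a" by transfer (simp add: tensor_eq_def add.commute)
  show "0 + a = a" by transfer (simp add: tensor_eq_def)
  show "- a + a = 0"
    by transfer (simp add: tensor_eq_def tensor_sum_uminus)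
  show "a - b = a + - b" by (rule minus_tensor_def)
  show "x *\<^sub>C (a + b) = x *\<^sub>C a + x *\<^sub>C b" by transfer (simp add: tensor_eq_def)
  show "(x + y) *\<^sub>C a = x *\<^sub>C a + y *\<^sub>C a"
    by transfer (simp add: tensor_eq_def tensor_sum_scale, simp add: scaleC_add_left)
  show "x *\<^sub>C y *\<^sub>C a = (x * y) *\<^sub>C a"
    by transfer (simp add: tensor_eq_def tensor_sum_scale scaleC_scaleC del: map_map)
  show "1 *\<^sub>C a = a" by transfer (simp add: tensor_eq_def tensor_sum_scale scaleC_one)
qed

end

lift_definition tensor :: "'a::complex_vector \<Rightarrow> 'b::complex_vector \<Rightarrow> ('a, 'b) tensor"
    (infixr \<open>\<otimes>\<close> 76)
  is "\<lambda>a b. [(a, b)]" .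

definition tlift ::
    "('a::complex_vector \<Rightarrow> 'b::complex_vector \<Rightarrow> 'c::complex_vector) \<Rightarrow> ('a, 'b) tensor \<Rightarrow> 'c"
  where "tlift f t = tensor_sum f (rep_tensor t)"

lemma cbilinear_tensor: "cbilinear (\<otimes>)"
  unfolding cbilinear_iff by (intro conjI allI; transfer) (simp_all add: tensor_eq_def cbilinear_iff)

lemma tensor_induct [case_names add tensor, induct type: tensor]:
  assumes "\<And>s t. P s \<Longrightarrow> P t \<Longrightarrow> P (s + t)" and "\<And>a b. P (a \<otimes> b)"
  shows "P t"
proof -
  have z: "P 0"
  proof -
    have "(0 *\<^sub>C 0) \<otimes> 0 = (0 :: ('a, 'b) tensor)"
      using cbilinear_tensor unfolding cbilinear_iff
      by (metis complex_vector.scale_zero_left)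
    then show ?thesis using assms(2) by metis
  qed
  have *: "P (abs_tensor xs)" for xs
  proof (induction xs)
    case Nil
    then show ?case using z by (simp add: zero_tensor_def)
  next
    case (Cons x xs)
    have "abs_tensor (x # xs) = (fst x \<otimes> snd x) + abs_tensor xs"
      by (simp add: tensor.abs_eq plus_tensor.abs_eq)
    then show ?case using Cons assms by simp
  qed
  show ?thesis using *[of "rep_tensor t"] Quotient_abs_rep[OF Quotient_tensor] by metis
qed

lemma tensor_sum_cong_eq:
  fixes f :: "'a::complex_vector \<Rightarrow> 'b::complex_vector \<Rightarrow> 'c::complex_vector"
  assumes f: "cbilinear f" and eq: "tensor_eq xs ys"
  shows "tensor_sum f xs = tensor_sum f ys"
proof (rule ccontr)
  assume "tensor_sum f xs \<noteq> tensor_sum f ys"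
  then obtain g :: "'c \<Rightarrow> complex"
    where g: "clinear g" "g (tensor_sum f xs - tensor_sum f ys) \<noteq> 0"
    using clinear_separates by (metis right_minus_eq)
  have "cbilinear (\<lambda>a b. g (f a b))"
    using f g(1) by (simp add: cbilinear_iff clinear_iff)
  moreover have "g (tensor_sum f zs) = tensor_sum (\<lambda>a b. g (f a b)) zs" for zs
    using g(1) by (induction zs) (simp_all add: clinear_add clinear_zero)
  ultimately show False
    using g eq by (simp add: tensor_eq_def clinear_diff)
qed

lemma tlift_abs: "cbilinear f \<Longrightarrow> tlift f (abs_tensor xs) = tensor_sum f xs"
  unfolding tlift_def
  by (rule tensor_sum_cong_eq, assumption, rule Quotient_rep_abs[OF Quotient_tensor])
     (simp add: tensor_eq_def)

lemma tlift_tensor: "cbilinear f \<Longrightarrow> tlift f (a \<otimes> b) = f a b"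
  by (simp add: tensor.abs_eq tlift_abs)

lemma clinear_tlift: "cbilinear f \<Longrightarrow> clinear (tlift f)"
proof -
  assume f: "cbilinear f"
  have "tlift f (s + t) = tlift f s + tlift f t" for s t
  proof -
    obtain xs ys where "s = abs_tensor xs" "t = abs_tensor ys"
      using Quotient_abs_rep[OF Quotient_tensor] by metis
    then show ?thesis using f by (simp add: plus_tensor.abs_eq tlift_abs)
  qed
  moreover have "tlift f (c *\<^sub>C s) = c *\<^sub>C tlift f s" for c s
  proof -
    obtain xs where "s = abs_tensor xs"
      using Quotient_abs_rep[OF Quotient_tensor] by metis
    then show ?thesis using f by (simp add: scaleC_tensor.abs_eq tlift_abs tensor_sum_scale)
  qed
  ultimately show ?thesis by (simp add: clinear_iff)
qed

lemma clinear_eqI_tensor: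
  assumes "clinear f" "clinear g" "\<And>a b. f (a \<otimes> b) = g (a \<otimes> b)"
  shows "f t = g t"
  by (induction t) (simp_all add: assms clinear_add)

lemma tensor_add_left: "(a + b) \<otimes> c = a \<otimes> c + b \<otimes> c"
  using cbilinear_tensor unfolding cbilinear_iff by blast

lemma tensor_add_right: "a \<otimes> (b + c) = a \<otimes> b + a \<otimes> c"
  using cbilinear_tensor unfolding cbilinear_iff by blast

lemma tensor_scaleC_left: "(x *\<^sub>C a) \<otimes> b = x *\<^sub>C (a \<otimes> b)"
  using cbilinear_tensor unfolding cbilinear_iff by blast

lemma tensor_scaleC_right: "a \<otimes> (x *\<^sub>C b) = x *\<^sub>C (a \<otimes> b)"
  using cbilinear_tensor unfolding cbilinear_iff by blast

definition tmap ::
    "('a::complex_vector \<Rightarrow> 'c::complex_vector) \<Rightarrow> ('b::complex_vector \<Rightarrow> 'd::complex_vector)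
      \<Rightarrow> ('a, 'b) tensor \<Rightarrow> ('c, 'd) tensor"
  where "tmap f g = tlift (\<lambda>a b. f a \<otimes> g b)"

lemma cbilinear_tmap: "clinear f \<Longrightarrow> clinear g \<Longrightarrow> cbilinear (\<lambda>a b. f a \<otimes> g b)"
  by (simp add: cbilinear_iff clinear_iff tensor_add_left tensor_add_right
      tensor_scaleC_left tensor_scaleC_right)

lemma tmap_tensor [simp]: "clinear f \<Longrightarrow> clinear g \<Longrightarrow> tmap f g (a \<otimes> b) = f a \<otimes> g b"
  by (simp add: tmap_def tlift_tensor cbilinear_tmap)

lemma clinear_tmap [simp]: "clinear f \<Longrightarrow> clinear g \<Longrightarrow> clinear (tmap f g)"
  by (simp add: tmap_def clinear_tlift cbilinear_tmap)

definition tflip :: "('a::complex_vector, 'b::complex_vector) tensor \<Rightarrow> ('b, 'a) tensor"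
  where "tflip = tlift (\<lambda>a b. b \<otimes> a)"

definition tassoc ::
    "(('a::complex_vector, 'b::complex_vector) tensor, 'c::complex_vector) tensor
      \<Rightarrow> ('a, ('b, 'c) tensor) tensor"
  where "tassoc = tlift (\<lambda>t c. tlift (\<lambda>a b. a \<otimes> (b \<otimes> c)) t)"

definition tunassoc ::
    "('a::complex_vector, ('b::complex_vector, 'c::complex_vector) tensor) tensor
      \<Rightarrow> (('a, 'b) tensor, 'c) tensor"
  where "tunassoc = tlift (\<lambda>a. tlift (\<lambda>b c. (a \<otimes> b) \<otimes> c))"

lemma tflip [simp]:
  fixes a :: "'a::complex_vector" and b :: "'b::complex_vector"
  shows "clinear (tflip :: ('a, 'b) tensor \<Rightarrow> _)" "tflip (a \<otimes> b) = b \<otimes> a"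
proof -
  have "cbilinear (\<lambda>(a::'a) (b::'b). b \<otimes> a)"
    by (simp add: cbilinear_iff tensor_add_left tensor_add_right
        tensor_scaleC_left tensor_scaleC_right)
  then show "clinear (tflip :: ('a, 'b) tensor \<Rightarrow> _)" "tflip (a \<otimes> b) = b \<otimes> a"
    by (simp_all add: tflip_def clinear_tlift tlift_tensor)
qed

lemma tassoc [simp]:
  fixes a :: "'a::complex_vector" and b :: "'b::complex_vector" and c :: "'c::complex_vector"
  shows "clinear (tassoc :: (('a, 'b) tensor, 'c) tensor \<Rightarrow> _)"
    "tassoc ((a \<otimes> b) \<otimes> c) = a \<otimes> (b \<otimes> c)"
proof -
  have 1: "cbilinear (\<lambda>(a::'a) (b::'b). a \<otimes> (b \<otimes> c))" for c :: 'c
    by (simp add: cbilinear_iff tensor_add_left tensor_add_right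
        tensor_scaleC_left tensor_scaleC_right)
  note lin = clinear_tlift[OF 1] and lt = tlift_tensor[OF 1]
  have "tlift (\<lambda>a b. a \<otimes> (b \<otimes> (c + d))) t
      = tlift (\<lambda>a b. a \<otimes> (b \<otimes> c)) t + tlift (\<lambda>a b. a \<otimes> (b \<otimes> d)) t" for c d :: 'c and t :: "('a, 'b) tensor"
  proof (induction t)
    case (tensor a b)
    show ?case unfolding lt by (simp only: tensor_add_left tensor_add_right)
  qed (simp only: clinear_add[OF lin] add.assoc add.left_commute)
  moreover have "tlift (\<lambda>a b. a \<otimes> (b \<otimes> (x *\<^sub>C c))) t
      = x *\<^sub>C tlift (\<lambda>a b. a \<otimes> (b \<otimes> c)) t" for c :: 'c and x and t :: "('a, 'b) tensor"
  proof (induction t)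
    case (tensor a b)
    show ?case unfolding lt by (simp only: tensor_scaleC_left tensor_scaleC_right)
  qed (simp only: clinear_add[OF lin] scaleC_add_right)
  ultimately have "cbilinear (\<lambda>t (c::'c). tlift (\<lambda>(a::'a) (b::'b). a \<otimes> (b \<otimes> c)) t)"
    using lin by (simp add: cbilinear_iff clinear_add clinear_scaleC)
  then show "clinear (tassoc :: (('a, 'b) tensor, 'c) tensor \<Rightarrow> _)"
    "tassoc ((a \<otimes> b) \<otimes> c) = a \<otimes> (b \<otimes> c)"
    by (simp_all add: tassoc_def clinear_tlift tlift_tensor lt)
qed

lemma tunassoc [simp]:
  fixes a :: "'a::complex_vector" and b :: "'b::complex_vector" and c :: "'c::complex_vector"
  shows "clinear (tunassoc :: ('a, ('b, 'c) tensor) tensor \<Rightarrow> _)"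
    "tunassoc (a \<otimes> (b \<otimes> c)) = (a \<otimes> b) \<otimes> c"
proof -
  have 1: "cbilinear (\<lambda>(b::'b) (c::'c). (a \<otimes> b) \<otimes> c)" for a :: 'a
    by (simp add: cbilinear_iff tensor_add_left tensor_add_right
        tensor_scaleC_left tensor_scaleC_right)
  note lin = clinear_tlift[OF 1] and lt = tlift_tensor[OF 1]
  have "tlift (\<lambda>b c. ((a + d) \<otimes> b) \<otimes> c) t
      = tlift (\<lambda>b c. (a \<otimes> b) \<otimes> c) t + tlift (\<lambda>b c. (d \<otimes> b) \<otimes> c) t" for a d :: 'a and t :: "('b, 'c) tensor"
  proof (induction t)
    case (tensor a b)
    show ?case unfolding lt by (simp only: tensor_add_left tensor_add_right)
  qed (simp only: clinear_add[OF lin] add.assoc add.left_commute)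
  moreover have "tlift (\<lambda>b c. ((x *\<^sub>C a) \<otimes> b) \<otimes> c) t
      = x *\<^sub>C tlift (\<lambda>b c. (a \<otimes> b) \<otimes> c) t" for a :: 'a and x and t :: "('b, 'c) tensor"
  proof (induction t)
    case (tensor a b)
    show ?case unfolding lt by (simp only: tensor_scaleC_left tensor_scaleC_right)
  qed (simp only: clinear_add[OF lin] scaleC_add_right)
  ultimately have "cbilinear (\<lambda>a::'a. tlift (\<lambda>(b::'b) (c::'c). (a \<otimes> b) \<otimes> c))"
    using lin by (simp add: cbilinear_iff clinear_add clinear_scaleC)
  then show "clinear (tunassoc :: ('a, ('b, 'c) tensor) tensor \<Rightarrow> _)"
    "tunassoc (a \<otimes> (b \<otimes> c)) = (a \<otimes> b) \<otimes> c"
    by (simp_all add: tunassoc_def clinear_tlift tlift_tensor lt)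
qed

lemma clinear_tensor: "clinear (\<lambda>t. a \<otimes> t)" "clinear (\<lambda>t. t \<otimes> b)"
  by (simp_all add: clinear_iff tensor_add_left tensor_add_right
      tensor_scaleC_left tensor_scaleC_right)

lemma tflip_tflip [simp]: "tflip (tflip t) = t"
  by (induction t) (simp_all add: clinear_add)

lemma tunassoc_tassoc [simp]: "tunassoc (tassoc t) = t"
proof (induction t)
  case (tensor s c)
  show ?case by (induction s) (simp_all add: clinear_add tensor_add_left)
qed (simp add: clinear_add)

lemma tassoc_tunassoc [simp]: "tassoc (tunassoc t) = t"
proof (induction t)
  case (tensor a s)
  show ?case by (induction s) (simp_all add: clinear_add tensor_add_right)
qed (simp add: clinear_add)

instantiation tensor :: (complex_algebra, complex_algebra) complex_algebra
begin

definition times_tensor :: "('a, 'b) tensor \<Rightarrow> ('a, 'b) tensor \<Rightarrow> ('a, 'b) tensor"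
  where "s * t = tlift (\<lambda>a b. tmap ((*) a) ((*) b) t) s"

lemma clinear_times [simp]: "clinear ((*) a)" "clinear (\<lambda>b. b * a)" for a :: "'c::complex_algebra"
  by (simp_all add: clinear_iff distrib_left distrib_right mult_scaleC_left mult_scaleC_right)

lemma cbilinear_times_aux:
  fixes t :: "('a, 'b) tensor"
  shows "cbilinear (\<lambda>a b. tmap ((*) a) ((*) b) t)"
proof -
  note act = tmap_tensor[OF clinear_times(1) clinear_times(1)]
    and add = clinear_add[OF clinear_tmap[OF clinear_times(1) clinear_times(1)]]
  have "tmap ((*) (a + a')) ((*) b) t
      = tmap ((*) a) ((*) b) t + tmap ((*) a') ((*) b) t" for a a' b
  proof (induction t)
    case (tensor c d)
    show ?case unfolding act by (simp only: distrib_right tensor_add_left)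
  qed (simp only: add add.assoc add.left_commute)
  moreover have "tmap ((*) (x *\<^sub>C a)) ((*) b) t
      = x *\<^sub>C tmap ((*) a) ((*) b) t" for a b x
  proof (induction t)
    case (tensor c d)
    show ?case unfolding act by (simp only: mult_scaleC_left tensor_scaleC_left)
  qed (simp only: add scaleC_add_right)
  moreover have "tmap ((*) a) ((*) (b + b')) t
      = tmap ((*) a) ((*) b) t + tmap ((*) a) ((*) b') t" for a b b'
  proof (induction t)
    case (tensor c d)
    show ?case unfolding act by (simp only: distrib_right tensor_add_right)
  qed (simp only: add add.assoc add.left_commute)
  moreover have "tmap ((*) a) ((*) (x *\<^sub>C b)) t
      = x *\<^sub>C tmap ((*) a) ((*) b) t" for a b x
  proof (induction t)
    case (tensor c d)
    show ?case unfolding act by (simp only: mult_scaleC_left tensor_scaleC_right)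
  qed (simp only: add scaleC_add_right)
  ultimately show ?thesis by (simp add: cbilinear_iff)
qed

lemma tensor_times: "(a \<otimes> b) * t = tmap ((*) a) ((*) b) t" for t :: "('a, 'b) tensor"
  unfolding times_tensor_def by (rule tlift_tensor[OF cbilinear_times_aux])

lemma times_tensor_tensor: "(a \<otimes> b) * (c \<otimes> d) = (a * c) \<otimes> (b * d :: 'b)" for a c :: 'a
  by (simp add: tensor_times)

lemma clinear_times_tensor: "clinear (\<lambda>s :: ('a, 'b) tensor. s * t)"
  unfolding times_tensor_def by (simp add: clinear_tlift cbilinear_times_aux)

lemma clinear_times_tensor': "clinear (\<lambda>t :: ('a, 'b) tensor. s * t)"
proof -
  note [simp] = clinear_add[OF clinear_times_tensor]
  have "s * (t + u) = s * t + s * u" for t u :: "('a, 'b) tensor"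
    by (induction s) (simp_all add: tensor_times clinear_add add.assoc add.left_commute)
  moreover have "s * (x *\<^sub>C t) = x *\<^sub>C (s * t)" for x and t :: "('a, 'b) tensor"
    by (induction s) (simp_all add: tensor_times clinear_scaleC scaleC_add_right)
  ultimately show ?thesis by (simp add: clinear_iff)
qed

instance
proof
  fix a b c :: "('a, 'b) tensor" and x :: complex
  show dr: "(a + b) * c = a * c + b * c" for a b c :: "('a, 'b) tensor"
    by (rule clinear_add[OF clinear_times_tensor])
  show dl: "a * (b + c) = a * b + a * c" for a b c :: "('a, 'b) tensor"
    by (rule clinear_add[OF clinear_times_tensor'])
  show "x *\<^sub>C a * b = x *\<^sub>C (a * b)"
    by (rule clinear_scaleC[OF clinear_times_tensor])
  show "a * x *\<^sub>C b = x *\<^sub>C (a * b)"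
    by (rule clinear_scaleC[OF clinear_times_tensor'])
  show "a * b * c = a * (b * c)"
  proof (induction a)
    case (tensor a1 a2)
    show ?case
    proof (induction b)
      case (tensor b1 b2)
      show ?case
        by (induction c) (simp_all add: dl times_tensor_tensor mult.assoc)
    qed (simp add: dl dr)
  qed (simp add: dr)
qed

end


section \<open>Multiplier algebras\<close>

definition nondegenerate :: "'a::complex_algebra itself \<Rightarrow> bool"
  where "nondegenerate _ \<longleftrightarrow>
    (\<forall>a::'a. (\<forall>b. a * b = 0) \<longrightarrow> a = 0) \<and> (\<forall>a::'a. (\<forall>b. b * a = 0) \<longrightarrow> a = 0)"

definition idempotent_algebra :: "'a::complex_algebra itself \<Rightarrow> bool"
  where "idempotent_algebra _ \<longleftrightarrow> cspan {a * b |a b :: 'a. True} = UNIV"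

text \<open>
  A multiplier is a pair consisting of its left action \<open>a \<mapsto> m a\<close> and its right action \<open>a \<mapsto> a m\<close>.
\<close>

typedef (overloaded) 'a multiplier =
  "{(l, r). clinear l \<and> clinear r \<and> (\<forall>a b. l (a * b) = l a * b) \<and> (\<forall>a b. r (a * b) = a * r b)
      \<and> (\<forall>a b. a * l b = r a * b)} :: (('a::complex_algebra \<Rightarrow> 'a) \<times> ('a \<Rightarrow> 'a)) set"
  by (rule exI[of _ "(id, id)"]) simp

setup_lifting type_definition_multiplier

lift_definition lact :: "'a::complex_algebra multiplier \<Rightarrow> 'a \<Rightarrow> 'a" (infixr \<open>\<triangleright>\<close> 73) is fst .

lift_definition ract :: "'a::complex_algebra \<Rightarrow> 'a multiplier \<Rightarrow> 'a" (infixl \<open>\<triangleleft>\<close> 73)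
  is "\<lambda>a m. snd m a" .

definition Multiplier :: "('a::complex_algebra \<Rightarrow> 'a) \<Rightarrow> ('a \<Rightarrow> 'a) \<Rightarrow> 'a multiplier"
  where "Multiplier l r = Abs_multiplier (l, r)"

lemma multiplier_eqI:
  "(\<And>a. m \<triangleright> a = n \<triangleright> a) \<Longrightarrow> (\<And>a. a \<triangleleft> m = a \<triangleleft> n) \<Longrightarrow> m = n"
  by transfer (auto simp: prod_eq_iff)

lemma clinear_lact [simp]: "clinear ((\<triangleright>) m)"
  and clinear_ract [simp]: "clinear (\<lambda>a. a \<triangleleft> m)"
  and lact_times: "m \<triangleright> (a * b) = (m \<triangleright> a) * b"
  and ract_times: "(a * b) \<triangleleft> m = a * (b \<triangleleft> m)"
  and times_lact: "a * (m \<triangleright> b) = (a \<triangleleft> m) * b"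
  by (transfer; auto)+

instantiation multiplier :: (complex_algebra) complex_algebra
begin

lift_definition zero_multiplier :: "'a multiplier" is "(\<lambda>_. 0, \<lambda>_. 0)"
  by (simp add: clinear_iff)

lift_definition plus_multiplier :: "'a multiplier \<Rightarrow> 'a multiplier \<Rightarrow> 'a multiplier"
  is "\<lambda>(l, r) (l', r'). (\<lambda>a. l a + l' a, \<lambda>a. r a + r' a)"
  by (auto simp: clinear_iff scaleC_add_right algebra_simps)

lift_definition uminus_multiplier :: "'a multiplier \<Rightarrow> 'a multiplier"
  is "\<lambda>(l, r). (\<lambda>a. - l a, \<lambda>a. - r a)"
  by (auto simp: clinear_iff complex_vector.scale_minus_right algebra_simps)

definition minus_multiplier :: "'a multiplier \<Rightarrow> 'a multiplier \<Rightarrow> 'a multiplier"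
  where "minus_multiplier m n = m + - n"

lift_definition scaleC_multiplier :: "complex \<Rightarrow> 'a multiplier \<Rightarrow> 'a multiplier"
  is "\<lambda>c (l, r). (\<lambda>a. c *\<^sub>C l a, \<lambda>a. c *\<^sub>C r a)"
  by (auto simp: clinear_iff scaleC_add_right scaleC_scaleC mult_scaleC_left mult_scaleC_right
      mult.commute)

lift_definition times_multiplier :: "'a multiplier \<Rightarrow> 'a multiplier \<Rightarrow> 'a multiplier"
  is "\<lambda>(l, r) (l', r'). (\<lambda>a. l (l' a), \<lambda>a. r' (r a))"
  by (auto simp: clinear_iff)

instance
  by standard
    (unfold minus_multiplier_def, (transfer; auto simp: fun_eq_iff clinear_iff scaleC_add_right
        scaleC_add_left scaleC_scaleC scaleC_one add.assoc add.commute)+)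

end

instantiation multiplier :: (complex_algebra) monoid_mult
begin

lift_definition one_multiplier :: "'a multiplier" is "(\<lambda>a. a, \<lambda>a. a)" by simp

instance by standard (transfer; auto)+

end

text \<open>The canonical map \<open>A \<rightarrow> M(A)\<close>; it is injective if the product of \<open>A\<close> is non-degenerate.\<close>

lift_definition emb :: "'a::complex_algebra \<Rightarrow> 'a multiplier" is "\<lambda>a. ((*) a, \<lambda>b. b * a)"
  by (simp add: mult.assoc)

definition unemb :: "'a::complex_algebra multiplier \<Rightarrow> 'a"
  where "unemb m = (THE a. emb a = m)"

lemma lact_simps [simp]:
  "0 \<triangleright> a = 0" "(m + n) \<triangleright> a = m \<triangleright> a + n \<triangleright> a" "(c *\<^sub>C m) \<triangleright> a = c *\<^sub>C (m \<triangleright> a)"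
  "(m * n) \<triangleright> a = m \<triangleright> n \<triangleright> a" "1 \<triangleright> a = a" "emb b \<triangleright> a = b * a"
  by (transfer; auto)+

lemma ract_simps [simp]:
  "a \<triangleleft> 0 = 0" "a \<triangleleft> (m + n) = a \<triangleleft> m + a \<triangleleft> n" "a \<triangleleft> (c *\<^sub>C m) = c *\<^sub>C (a \<triangleleft> m)"
  "a \<triangleleft> (m * n) = a \<triangleleft> m \<triangleleft> n" "a \<triangleleft> 1 = a" "a \<triangleleft> emb b = a * b"
  by (transfer; auto)+

lemma inj_emb: "nondegenerate TYPE('a) \<Longrightarrow> inj (emb :: 'a::complex_algebra \<Rightarrow> _)"
proof (rule injI)
  fix x y :: 'a
  assume nd: "nondegenerate TYPE('a)" and eq: "emb x = emb y"
  have "(x - y) * b = 0" for b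
    using arg_cong[OF eq, of "\<lambda>m. m \<triangleright> b"] by (simp add: left_diff_distrib)
  then have "x - y = 0" using nd unfolding nondegenerate_def by blast
  then show "x = y" by simp
qed

lemma unemb_emb: "nondegenerate TYPE('a) \<Longrightarrow> unemb (emb a) = (a :: 'a::complex_algebra)"
  unfolding unemb_def using inj_emb by (blast dest: injD)

lift_definition mtensor ::
    "'a::complex_algebra multiplier \<Rightarrow> 'b::complex_algebra multiplier \<Rightarrow> ('a, 'b) tensor multiplier"
    (infixr \<open>\<otimes>\<^sub>m\<close> 76)
  is "\<lambda>(l, r) (l', r'). (tmap l l', tmap r r')"
proof (clarify, intro conjI allI)
  fix l r :: "'a \<Rightarrow> 'a" and l' r' :: "'b \<Rightarrow> 'b" and s t :: "('a, 'b) tensor"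
  assume [simp]: "clinear l" "clinear r" "clinear l'" "clinear r'"
    and h: "\<forall>a b. l (a * b) = l a * b" "\<forall>a b. r (a * b) = a * r b" "\<forall>a b. a * l b = r a * b"
      "\<forall>a b. l' (a * b) = l' a * b" "\<forall>a b. r' (a * b) = a * r' b" "\<forall>a b. a * l' b = r' a * b"
  show "clinear (tmap l l')" "clinear (tmap r r')" by simp_all
  note [simp] = clinear_add[OF clinear_tmap] distrib_left distrib_right times_tensor_tensor
  show "tmap l l' (s * t) = tmap l l' s * t"
  proof (induction s)
    case (tensor a b)
    show ?case by (induction t) (simp_all add: h)
  qed simp
  show "tmap r r' (s * t) = s * tmap r r' t"
  proof (induction s)
    case (tensor a b)
    show ?case by (induction t) (simp_all add: h)
  qed simp
  show "s * tmap l l' t = tmap r r' s * t"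
  proof (induction s)
    case (tensor a b)
    show ?case by (induction t) (simp_all add: h)
  qed simp
qed

lemma mtensor_lact: "(m \<otimes>\<^sub>m n) \<triangleright> t = tmap ((\<triangleright>) m) ((\<triangleright>) n) t"
  and mtensor_ract: "t \<triangleleft> (m \<otimes>\<^sub>m n) = tmap (\<lambda>a. a \<triangleleft> m) (\<lambda>a. a \<triangleleft> n) t"
  by (transfer; auto simp: case_prod_beta)+

text \<open>The isomorphism of multiplier algebras induced by an isomorphism of algebras \<open>\<alpha>\<close>.\<close>

definition mtransport ::
    "('a::complex_algebra \<Rightarrow> 'b::complex_algebra) \<Rightarrow> 'a multiplier \<Rightarrow> 'b multiplier"
  where "mtransport \<alpha> m = Multiplier (\<lambda>b. \<alpha> (m \<triangleright> inv \<alpha> b)) (\<lambda>b. \<alpha> (inv \<alpha> b \<triangleleft> m))"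

lemma mtransport_act:
  assumes lin: "clinear \<alpha>" and mult: "\<And>a b. \<alpha> (a * b) = \<alpha> a * \<alpha> b" and bij: "bij \<alpha>"
  shows "mtransport \<alpha> m \<triangleright> \<alpha> a = \<alpha> (m \<triangleright> a)" "\<alpha> a \<triangleleft> mtransport \<alpha> m = \<alpha> (a \<triangleleft> m)"
proof -
  have [simp]: "inv \<alpha> (\<alpha> a) = a" "\<alpha> (inv \<alpha> b) = b" for a b
    using bij by (simp_all add: bij_def surj_f_inv_f)
  have add: "inv \<alpha> (x + y) = inv \<alpha> x + inv \<alpha> y" and scale: "inv \<alpha> (c *\<^sub>C x) = c *\<^sub>C inv \<alpha> x"
    and times: "inv \<alpha> (x * y) = inv \<alpha> x * inv \<alpha> y" for x y c
    by (rule injD[OF bij_is_inj[OF bij]];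
        simp add: clinear_add[OF lin] clinear_scaleC[OF lin] mult)+
  have "clinear (\<lambda>b. \<alpha> (m \<triangleright> inv \<alpha> b))" "clinear (\<lambda>b. \<alpha> (inv \<alpha> b \<triangleleft> m))"
    by (simp_all add: clinear_iff add scale clinear_add[OF lin] clinear_scaleC[OF lin]
        clinear_add[OF clinear_lact] clinear_scaleC[OF clinear_lact]
        clinear_add[OF clinear_ract] clinear_scaleC[OF clinear_ract])
  moreover have "x * \<alpha> (m \<triangleright> inv \<alpha> y) = \<alpha> (inv \<alpha> x \<triangleleft> m) * y" for x y
    using mult[of "inv \<alpha> x" "m \<triangleright> inv \<alpha> y"] mult[of "inv \<alpha> x \<triangleleft> m" "inv \<alpha> y"]
    by (simp add: times_lact)
  ultimately have "Rep_multiplier (mtransport \<alpha> m)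
      = (\<lambda>b. \<alpha> (m \<triangleright> inv \<alpha> b), \<lambda>b. \<alpha> (inv \<alpha> b \<triangleleft> m))"
    unfolding mtransport_def Multiplier_def
    by (intro Abs_multiplier_inverse) (simp add: times lact_times ract_times mult)
  then show "mtransport \<alpha> m \<triangleright> \<alpha> a = \<alpha> (m \<triangleright> a)" "\<alpha> a \<triangleleft> mtransport \<alpha> m = \<alpha> (a \<triangleleft> m)"
    by (simp_all add: lact.rep_eq ract.rep_eq)
qed

lemma tassoc_iso: "tassoc (s * t) = tassoc s * tassoc t" "bij tassoc"
proof -
  have *: "tassoc ((x \<otimes> c) * (y \<otimes> d)) = tassoc (x \<otimes> c) * tassoc (y \<otimes> d)"
    for x y :: "('a::complex_algebra, 'b::complex_algebra) tensor" and c d :: "'c::complex_algebra"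
  proof (induction x)
    case (tensor a b)
    show ?case
      by (induction y)
         (simp_all add: times_tensor_tensor tensor_add_left clinear_add[OF tassoc(1)] distrib_left)
  qed (simp add: times_tensor_tensor tensor_add_left clinear_add[OF tassoc(1)] distrib_right)
  show "tassoc (s * t) = tassoc s * tassoc t"
  proof (induction s)
    case (tensor x c)
    show ?case by (induction t) (simp_all add: * distrib_left clinear_add[OF tassoc(1)])
  qed (simp add: distrib_right clinear_add[OF tassoc(1)])
  show "bij (tassoc :: (('d::complex_vector, 'e::complex_vector) tensor, 'f::complex_vector) tensor \<Rightarrow> _)"
    by (rule o_bij[of tunassoc]) auto
qed

abbreviation massoc ::
    "(('a::complex_algebra, 'b::complex_algebra) tensor, 'c::complex_algebra) tensor multiplier
      \<Rightarrow> ('a, ('b, 'c) tensor) tensor multiplier"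
  where "massoc \<equiv> mtransport tassoc"

text \<open>
  For a homomorphism \<open>\<gamma> : A \<rightarrow> M(B)\<close> and an idempotent \<open>e\<close> with \<open>\<gamma>(A)B = eB\<close> and \<open>B\<gamma>(A) = Be\<close>,
  this is the unique extension of \<open>\<gamma>\<close> to a homomorphism \<open>M(A) \<rightarrow> M(B)\<close> mapping \<open>1\<close> to \<open>e\<close>.
\<close>

definition mult_ext ::
    "('a::complex_algebra \<Rightarrow> 'b::complex_algebra multiplier) \<Rightarrow> 'b multiplier
      \<Rightarrow> 'a multiplier \<Rightarrow> 'b multiplier"
  where "mult_ext \<gamma> e = (THE g. clinear g \<and> (\<forall>x y. g (x * y) = g x * g y)
    \<and> (\<forall>a. g (emb a) = \<gamma> a) \<and> g 1 = e)"


section \<open>Coproducts\<close>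

type_synonym 'a coprod = "'a \<Rightarrow> 'a tensor2 multiplier"

definition T1 :: "'a::complex_algebra coprod \<Rightarrow> 'a tensor2 \<Rightarrow> 'a tensor2"
  where "T1 \<Delta> = tlift (\<lambda>a b. unemb (\<Delta> a * (1 \<otimes>\<^sub>m emb b)))"

definition T2 :: "'a::complex_algebra coprod \<Rightarrow> 'a tensor2 \<Rightarrow> 'a tensor2"
  where "T2 \<Delta> = tlift (\<lambda>a b. unemb ((emb a \<otimes>\<^sub>m 1) * \<Delta> b))"

definition id_tensor_coprod :: "'a::complex_algebra coprod \<Rightarrow> 'a tensor2 \<Rightarrow> 'a tensor3 multiplier"
  where "id_tensor_coprod \<Delta> = tlift (\<lambda>a b. emb a \<otimes>\<^sub>m \<Delta> b)"

definition coprod_tensor_id :: "'a::complex_algebra coprod \<Rightarrow> 'a tensor2 \<Rightarrow> 'a tensor3 multiplier"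
  where "coprod_tensor_id \<Delta> = tlift (\<lambda>a b. massoc (\<Delta> a \<otimes>\<^sub>m emb b))"

definition coproduct :: "'a::complex_algebra coprod \<Rightarrow> bool"
  where "coproduct \<Delta> \<longleftrightarrow>
    clinear \<Delta> \<and> (\<forall>a b. \<Delta> (a * b) = \<Delta> a * \<Delta> b)
    \<and> (\<forall>a b. \<Delta> a * (1 \<otimes>\<^sub>m emb b) \<in> range emb)
    \<and> (\<forall>a b. (emb a \<otimes>\<^sub>m 1) * \<Delta> b \<in> range emb)
    \<and> (\<forall>a b c. (emb a \<otimes>\<^sub>m 1) * coprod_tensor_id \<Delta> (T1 \<Delta> (b \<otimes> c))
          = id_tensor_coprod \<Delta> (T2 \<Delta> (a \<otimes> b)) * (1 \<otimes>\<^sub>m 1 \<otimes>\<^sub>m emb c))"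

definition full_coproduct :: "'a::complex_algebra coprod \<Rightarrow> bool"
  where "full_coproduct \<Delta> \<longleftrightarrow>
    \<Inter> {V. csubspace V \<and> (\<forall>a b. T1 \<Delta> (a \<otimes> b) \<in> cspan {v \<otimes> c |v c. v \<in> V})} = UNIV
    \<and> \<Inter> {W. csubspace W \<and> (\<forall>a b. T2 \<Delta> (a \<otimes> b) \<in> cspan {c \<otimes> w |c w. w \<in> W})} = UNIV"

definition counit :: "'a::complex_algebra coprod \<Rightarrow> ('a \<Rightarrow> complex) \<Rightarrow> bool"
  where "counit \<Delta> \<epsilon> \<longleftrightarrow> clinear \<epsilon>
    \<and> (\<forall>a b. tlift (\<lambda>p q. \<epsilon> p *\<^sub>C q) (T1 \<Delta> (a \<otimes> b)) = a * b)
    \<and> (\<forall>a c. tlift (\<lambda>p q. \<epsilon> q *\<^sub>C p) (T2 \<Delta> (c \<otimes> a)) = c * a)"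


section \<open>Weak multiplier Hopf algebras\<close>

definition coprod13 :: "'a::complex_algebra coprod \<Rightarrow> 'a \<Rightarrow> 'a tensor3 multiplier"
  where "coprod13 \<Delta> a = mtransport (tmap id tflip) (massoc (\<Delta> a \<otimes>\<^sub>m 1))"

text \<open>
  The three-fold tensor product is bracketed to the right, so \<open>G \<otimes> id\<close> needs rebracketing.
\<close>

definition tensor_id12 :: "('a::complex_vector tensor2 \<Rightarrow> 'a tensor2) \<Rightarrow> 'a tensor3 \<Rightarrow> 'a tensor3"
  where "tensor_id12 G t = tassoc (tmap G id (tunassoc t))"

definition is_G1 ::
    "'a::complex_algebra coprod \<Rightarrow> 'a tensor2 multiplier \<Rightarrow> ('a tensor2 \<Rightarrow> 'a tensor2) \<Rightarrow> bool"
  where "is_G1 \<Delta> E G \<longleftrightarrow> clinear G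
    \<and> (\<forall>a b c. emb (tensor_id12 G (unemb (coprod13 \<Delta> a * (1 \<otimes>\<^sub>m emb b \<otimes>\<^sub>m emb c))))
          = coprod13 \<Delta> a * (1 \<otimes>\<^sub>m E) * (1 \<otimes>\<^sub>m emb b \<otimes>\<^sub>m emb c))"

definition is_G2 ::
    "'a::complex_algebra coprod \<Rightarrow> 'a tensor2 multiplier \<Rightarrow> ('a tensor2 \<Rightarrow> 'a tensor2) \<Rightarrow> bool"
  where "is_G2 \<Delta> E G \<longleftrightarrow> clinear G
    \<and> (\<forall>a b c. emb (tmap id G (unemb ((emb a \<otimes>\<^sub>m emb b \<otimes>\<^sub>m 1) * coprod13 \<Delta> c)))
          = (emb a \<otimes>\<^sub>m emb b \<otimes>\<^sub>m 1) * massoc (E \<otimes>\<^sub>m 1) * coprod13 \<Delta> c)"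

text \<open>
  The data \<open>\<epsilon>\<close>, \<open>E\<close>, \<open>G1\<close>, \<open>G2\<close> are uniquely determined by the coproduct.
\<close>

locale weak_multiplier_hopf_algebra =
  fixes \<Delta> :: "'a::complex_algebra coprod"
    and \<epsilon> :: "'a \<Rightarrow> complex"
    and E :: "'a tensor2 multiplier"
    and G1 G2 :: "'a tensor2 \<Rightarrow> 'a tensor2"
  assumes nondegenerate: "nondegenerate TYPE('a)"
    and idempotent: "idempotent_algebra TYPE('a)"
    and coproduct: "coproduct \<Delta>"
    and full: "full_coproduct \<Delta>"
    and counit: "counit \<Delta> \<epsilon>"
    and E_idempotent: "E * E = E"
    and range_T1: "range (T1 \<Delta>) = range (\<lambda>t. E \<triangleright> t)"
    and range_T2: "range (T2 \<Delta>) = range (\<lambda>t. t \<triangleleft> E)"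
    and coprod_E: "mult_ext (id_tensor_coprod \<Delta>) (1 \<otimes>\<^sub>m E) E = massoc (E \<otimes>\<^sub>m 1) * (1 \<otimes>\<^sub>m E)"
    and E_commute: "massoc (E \<otimes>\<^sub>m 1) * (1 \<otimes>\<^sub>m E) = (1 \<otimes>\<^sub>m E) * massoc (E \<otimes>\<^sub>m 1)"
    and G1: "is_G1 \<Delta> E G1"
    and G2: "is_G2 \<Delta> E G2"
    and kernel_T1: "{t. T1 \<Delta> t = 0} = range (\<lambda>t. t - G1 t)"
    and kernel_T2: "{t. T2 \<Delta> t = 0} = range (\<lambda>t. t - G2 t)"

text \<open>
  The Sweedler formulas characterizing the antipode, covered by further elements of \<open>A\<close> where
  necessary, read
  \<^item> \<open>(c \<otimes> d) E(a \<otimes> b) = \<Sum> c a\<^sub>1 \<otimes> d a\<^sub>2 S(a\<^sub>3) b\<close>,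
  \<^item> \<open>(a \<otimes> b)E (c \<otimes> d) = \<Sum> a S(b\<^sub>1) b\<^sub>2 c \<otimes> b\<^sub>3 d\<close>,
  \<^item> \<open>(c \<otimes> 1) G1(a \<otimes> b) = \<Sum> c a\<^sub>1 \<otimes> S(a\<^sub>2) a\<^sub>3 b\<close>,
  \<^item> \<open>G2(a \<otimes> b) (1 \<otimes> c) = \<Sum> a b\<^sub>1 S(b\<^sub>2) \<otimes> b\<^sub>3 c\<close>,
  \<^item> \<open>\<Sum> S(a\<^sub>1) a\<^sub>2 S(a\<^sub>3) b = S(a) b\<close>, where \<open>\<Sum> a\<^sub>1 \<otimes> a\<^sub>2 S(a\<^sub>3) b\<close> is the element \<open>E(a \<otimes> b)\<close>
    of \<open>A \<otimes> A\<close> by the first formula.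
\<close>

definition antipode ::
    "'a::complex_algebra coprod \<Rightarrow> 'a tensor2 multiplier
      \<Rightarrow> ('a tensor2 \<Rightarrow> 'a tensor2) \<Rightarrow> ('a tensor2 \<Rightarrow> 'a tensor2) \<Rightarrow> ('a \<Rightarrow> 'a multiplier) \<Rightarrow> bool"
  where "antipode \<Delta> E G1 G2 S \<longleftrightarrow>
    clinear S \<and> (\<forall>a b. S (a * b) = S b * S a)
    \<and> cspan {S a \<triangleright> b |a b. True} = UNIV \<and> cspan {b \<triangleleft> S a |a b. True} = UNIV
    \<and> (\<forall>a b c d. (c \<otimes> d) * (E \<triangleright> (a \<otimes> b))
          = tmap id (\<lambda>q. tlift (\<lambda>u v. u * (S v \<triangleright> b)) (T2 \<Delta> (d \<otimes> q))) (T2 \<Delta> (c \<otimes> a)))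
    \<and> (\<forall>a b c d. ((a \<otimes> b) \<triangleleft> E) * (c \<otimes> d)
          = tmap (\<lambda>p. tlift (\<lambda>u v. (a \<triangleleft> S u) * v) (T1 \<Delta> (p \<otimes> c))) id (T1 \<Delta> (b \<otimes> d)))
    \<and> (\<forall>a b c. (emb c \<otimes>\<^sub>m 1) \<triangleright> G1 (a \<otimes> b)
          = tmap id (\<lambda>q. tlift (\<lambda>u v. S u \<triangleright> v) (T1 \<Delta> (q \<otimes> b))) (T2 \<Delta> (c \<otimes> a)))
    \<and> (\<forall>a b c. G2 (a \<otimes> b) \<triangleleft> (1 \<otimes>\<^sub>m emb c)
          = tmap (\<lambda>p. tlift (\<lambda>u v. u \<triangleleft> S v) (T2 \<Delta> (a \<otimes> p))) id (T1 \<Delta> (b \<otimes> c)))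
    \<and> (\<forall>a b. tlift (\<lambda>p q. S p \<triangleright> q) (E \<triangleright> (a \<otimes> b)) = S a \<triangleright> b)"

locale regular_weak_multiplier_hopf_algebra = weak_multiplier_hopf_algebra \<Delta> \<epsilon> E G1 G2
  for \<Delta> :: "'a::complex_algebra coprod" and \<epsilon> E G1 G2 +
  fixes S :: "'a \<Rightarrow> 'a multiplier"
  assumes antipode: "antipode \<Delta> E G1 G2 S"
    and bij_antipode: "bij_betw S UNIV (range emb)"

definition inv_antipode :: "('a::complex_algebra \<Rightarrow> 'a multiplier) \<Rightarrow> 'a \<Rightarrow> 'a"
  where "inv_antipode S a = inv S (emb a)"

text \<open>\<open>\<epsilon>\<^sub>t(a)\<close> is determined by \<open>c \<epsilon>\<^sub>t(a) b = \<Sum> c a\<^sub>1 S(a\<^sub>2) b\<close>.\<close>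

definition eps_t ::
    "'a::complex_algebra coprod \<Rightarrow> ('a \<Rightarrow> 'a multiplier) \<Rightarrow> 'a \<Rightarrow> 'a multiplier"
  where "eps_t \<Delta> S a =
    (THE m. \<forall>b c. c * (m \<triangleright> b) = tlift (\<lambda>p q. p * (S q \<triangleright> b)) (T2 \<Delta> (c \<otimes> a)))"

definition A_t :: "'a::complex_algebra coprod \<Rightarrow> 'a tensor2 multiplier \<Rightarrow> 'a multiplier set"
  where "A_t \<Delta> E = {x. mult_ext \<Delta> E x = (x \<otimes>\<^sub>m 1) * E}"


section \<open>Cointegrals and integrals\<close>

text \<open>
  Slices of \<open>m \<in> M(A \<otimes> A)\<close> by a functional \<open>f\<close>.  They are meaningful if \<open>m(b \<otimes> 1)\<close> and
  \<open>(b \<otimes> 1)m\<close>, respectively \<open>m(1 \<otimes> b)\<close> and \<open>(1 \<otimes> b)m\<close>, are in \<open>A \<otimes> A\<close> for all \<open>b \<in> A\<close>.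
\<close>

definition slice_right ::
    "('a::complex_algebra \<Rightarrow> complex) \<Rightarrow> 'a tensor2 multiplier \<Rightarrow> 'a multiplier"
  where "slice_right f m = Multiplier
    (\<lambda>b. tlift (\<lambda>p q. f q *\<^sub>C p) (unemb (m * (emb b \<otimes>\<^sub>m 1))))
    (\<lambda>b. tlift (\<lambda>p q. f q *\<^sub>C p) (unemb ((emb b \<otimes>\<^sub>m 1) * m)))"

definition slice_left ::
    "('a::complex_algebra \<Rightarrow> complex) \<Rightarrow> 'a tensor2 multiplier \<Rightarrow> 'a multiplier"
  where "slice_left f m = Multiplier
    (\<lambda>b. tlift (\<lambda>p q. f p *\<^sub>C q) (unemb (m * (1 \<otimes>\<^sub>m emb b))))
    (\<lambda>b. tlift (\<lambda>p q. f p *\<^sub>C q) (unemb ((1 \<otimes>\<^sub>m emb b) * m)))"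

definition left_cointegral ::
    "'a::complex_algebra coprod \<Rightarrow> ('a \<Rightarrow> 'a multiplier) \<Rightarrow> 'a multiplier \<Rightarrow> bool"
  where "left_cointegral \<Delta> S h \<longleftrightarrow> h \<noteq> 0 \<and> (\<forall>a. emb a * h = eps_t \<Delta> S a * h)"

definition faithful_cointegral :: "'a::complex_algebra coprod \<Rightarrow> 'a \<Rightarrow> bool"
  where "faithful_cointegral \<Delta> h \<longleftrightarrow>
    (\<forall>f. clinear f \<longrightarrow> slice_right f (\<Delta> h) = 0 \<or> slice_left f (\<Delta> h) = 0 \<longrightarrow> f = (\<lambda>_. 0))"

definition left_integrals ::
    "'a::complex_algebra coprod \<Rightarrow> 'a tensor2 multiplier \<Rightarrow> ('a \<Rightarrow> complex) set"
  where "left_integrals \<Delta> E =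
    {\<phi>. clinear \<phi> \<and> \<phi> \<noteq> (\<lambda>_. 0) \<and> (\<forall>a. slice_right \<phi> (\<Delta> a) \<in> A_t \<Delta> E)}"

definition gamma_t ::
    "'a::complex_algebra coprod \<Rightarrow> 'a tensor2 multiplier \<Rightarrow> 'a \<Rightarrow> 'a \<Rightarrow> 'a multiplier"
  where "gamma_t \<Delta> E h a = (THE x. x \<in> A_t \<Delta> E \<and> emb (h * a) = emb h * x)"

text \<open>
  \<open>S\<^sub>1'(a) = \<Sum> \<gamma>\<^sub>t(a\<^sub>2) S\<inverse>(a\<^sub>1)\<close> is covered by multiplying with \<open>S\<inverse>(c)\<close> from the right, using
  \<open>S\<inverse>(a\<^sub>1) S\<inverse>(c) = S\<inverse>(c a\<^sub>1)\<close> and \<open>\<Sum> c a\<^sub>1 \<otimes> a\<^sub>2 \<in> A \<otimes> A\<close>.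
\<close>

definition S1' ::
    "'a::complex_algebra coprod \<Rightarrow> 'a tensor2 multiplier \<Rightarrow> ('a \<Rightarrow> 'a multiplier) \<Rightarrow> 'a
      \<Rightarrow> 'a \<Rightarrow> 'a multiplier"
  where "S1' \<Delta> E S h a = (THE m. \<forall>c. m \<triangleright> inv_antipode S c
    = tlift (\<lambda>p q. gamma_t \<Delta> E h q \<triangleright> inv_antipode S p) (T2 \<Delta> (c \<otimes> a)))"

end

theory Submission
  imports Defs
begin

text \<open>
  Let \<open>h\<close> be a faithful left cointegral.  From \<open>ah = \<epsilon>\<^sub>t(a)h\<close> one gets
  \<open>(1 \<otimes> a)\<Delta>(h) = (S(a) \<otimes> 1)\<Delta>(h)\<close> (lemma \<open>cointegral_coproduct\<close>), and faithfulness says that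
  a functional \<open>f\<close> is determined by the multiplier \<open>(id \<otimes> f)\<Delta>(h)\<close>.  The proposition follows
  from the existence of a single integral \<open>\<phi>\<close>, the one with \<open>(id \<otimes> \<phi>)\<Delta>(h) = 1\<close>.

  \<^item> Existence.  Every element of \<open>A\<close> is a sum of elements \<open>(\<omega> \<otimes> id)(\<Delta>(h)(c \<otimes> 1))\<close>, and \<open>\<phi>\<close> has to
    take the value \<open>\<omega>(c)\<close> there.  If \<open>\<Sum> (\<omega>\<^sub>i \<otimes> id)(\<Delta>(h)(c\<^sub>i \<otimes> 1)) = 0\<close>, then \<open>\<Sum> \<omega>\<^sub>i(xc\<^sub>i) = 0\<close> for all
    \<open>x\<close> by faithfulness, and a local unit \<open>x\<close> for the \<open>c\<^sub>i\<close> yields \<open>\<Sum> \<omega>\<^sub>i(c\<^sub>i) = 0\<close>.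
  \<^item> Invariance.  For \<open>a = (\<omega> \<otimes> id)(\<Delta>(h)(c \<otimes> 1))\<close>, coassociativity gives
    \<open>(id \<otimes> \<phi>)\<Delta>(a) = (\<omega> \<otimes> id)(E(c \<otimes> 1))\<close> since \<open>\<Delta>(1) = E\<close>, and the right leg of \<open>E\<close> lies in \<open>A\<^sub>t\<close>.
  \<^item> Right faithfulness.  If \<open>\<phi>(ab) = 0\<close> for all \<open>b\<close>, then \<open>0 = (id \<otimes> \<phi>(a\<cdot>))\<Delta>(h) = S(a)\<close>.
  \<^item> Left faithfulness.  \<open>m = (id \<otimes> \<phi>)(\<Delta>(h)(1 \<otimes> a))\<close> is in \<open>A\<close>, so \<open>m = S(a')\<close> for some \<open>a'\<close>.  The
    functionals \<open>\<phi>(\<cdot>a)\<close> and \<open>\<phi>(a'\<cdot>)\<close> have the same slice \<open>m\<close> of \<open>\<Delta>(h)\<close>, so they agree.  Therefore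
    \<open>\<phi>(Aa) = 0\<close> implies \<open>\<phi>(aA) = 0\<close>, and \<open>a = 0\<close> by right faithfulness.
  \<^item> Injectivity of \<open>S\<^sub>1'\<close>.  One finds \<open>\<gamma>\<^sub>t(a) = (id \<otimes> \<phi>)\<Delta>(ha)\<close> and then \<open>S\<^sub>1'(a) = m\<close> with the same \<open>m\<close>
    as before, so \<open>\<phi>(xa) = \<phi>(S\<inverse>(S\<^sub>1'(a))x)\<close> and \<open>S\<^sub>1'\<close> is injective by left faithfulness.

  Hence both sides of the asserted equivalence hold.  The last point and the local units depend on
  the formula \<open>E(1 \<otimes> a) = \<Sum> a\<^sub>2S\<inverse>(a\<^sub>1) \<otimes> a\<^sub>3\<close> (lemmas \<open>E_right_T1\<close> and \<open>E_right_T2\<close>), which describes \<open>E\<close>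
  by the opposite coproduct, whereas the definition of the antipode describes it by \<open>\<Delta>\<close>.  It comes
  from the Casimir property \<open>E(w \<otimes> 1) = E(1 \<otimes> S(w))\<close> for \<open>w\<close> in the left leg of \<open>E\<close>, together with
  \<open>\<epsilon>\<^sub>t(S(q)) = S(\<epsilon>\<^sub>s(q))\<close>, by which \<open>S(w)\<close> runs through all of \<open>\<epsilon>\<^sub>t(A)\<close>.

  Sweedler's notation appears in comments only.  In formal statements an expression such as
  \<open>\<Sum> f(ca\<^sub>1, a\<^sub>2)\<close> is \<open>tlift f (T2 \<Delta> (c \<otimes> a))\<close>, so that every sum is finite.
\<close>

section \<open>Linear algebra of the algebraic tensor product\<close>

named_theorems lin

text \<open>
  The facts \<open>lin\<close> are introduction rules that decompose a term built from linear operations; they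
  discharge the linearity conditions of the universal property.
\<close>

lemma cbilinearI [lin]:
  "(\<And>y. clinear (\<lambda>x. f x y)) \<Longrightarrow> (\<And>x. clinear (\<lambda>y. f x y)) \<Longrightarrow> cbilinear f"
  by (simp add: cbilinear_def)

lemma cbilinearD: "cbilinear f \<Longrightarrow> clinear (\<lambda>x. f x y)" "cbilinear f \<Longrightarrow> clinear (\<lambda>y. f x y)"
  by (simp_all add: cbilinear_def)

lemma clinear_tlift_arg:
  fixes t :: "('b::complex_vector, 'c::complex_vector) tensor"
  assumes "\<And>p q. clinear (\<lambda>x. F x p q)" and "\<And>x. cbilinear (F x)"
  shows "clinear (\<lambda>x. tlift (F x) t)"
proof -
  have "(\<forall>x y. tlift (F (x + y)) t = tlift (F x) t + tlift (F y) t)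
    \<and> (\<forall>c x. tlift (F (c *\<^sub>C x)) t = c *\<^sub>C tlift (F x) t)"
  proof (induction t)
    case (add s t)
    then show ?case
      by (simp add: clinear_add[OF clinear_tlift[OF assms(2)]] scaleC_add_right algebra_simps)
  next
    case (tensor a b)
    show ?case
      unfolding tlift_tensor[OF assms(2)] using assms(1) by (simp add: clinear_iff)
  qed
  then show ?thesis by (simp add: clinear_iff)
qed

lemma lin_vector [lin]:
  "clinear (\<lambda>x. x)" "clinear id"
  "clinear l \<Longrightarrow> clinear (\<lambda>x. l x *\<^sub>C w)"
  "clinear g \<Longrightarrow> clinear (\<lambda>x. r *\<^sub>C g x)"
  "clinear g1 \<Longrightarrow> clinear g2 \<Longrightarrow> clinear (\<lambda>x. g1 x + g2 x)"
  "clinear g1 \<Longrightarrow> clinear g2 \<Longrightarrow> clinear (\<lambda>x. g1 x - g2 x)"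
  by (simp_all add: clinear_iff scaleC_add_left scaleC_add_right scaleC_scaleC scaleC_complex_def
      mult.commute[of r] complex_vector.scale_right_diff_distrib)

lemma lin_pure_tensor [lin]:
  "clinear g \<Longrightarrow> clinear (\<lambda>x. g x \<otimes> v)"
  "clinear g' \<Longrightarrow> clinear (\<lambda>x. v' \<otimes> g' x)"
  by (simp_all add: clinear_iff
      tensor_add_left tensor_add_right tensor_scaleC_left tensor_scaleC_right)

lemma lin_times [lin]:
  fixes c :: "'c::complex_algebra"
  shows "clinear f \<Longrightarrow> clinear (\<lambda>x. f x * c)" "clinear f \<Longrightarrow> clinear (\<lambda>x. c * f x)"
  by (simp_all add: clinear_iff distrib_left distrib_right mult_scaleC_left mult_scaleC_right)

lemma lin_multiplier [lin]:
  "clinear k \<Longrightarrow> clinear (\<lambda>x. m \<triangleright> k x)"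
  "clinear k \<Longrightarrow> clinear (\<lambda>x. k x \<triangleleft> m)"
  "clinear n \<Longrightarrow> clinear (\<lambda>x. n x \<triangleright> b)"
  "clinear n \<Longrightarrow> clinear (\<lambda>x. b \<triangleleft> n x)"
  by (simp_all add: clinear_iff
      clinear_add[OF clinear_lact] clinear_scaleC[OF clinear_lact]
      clinear_add[OF clinear_ract] clinear_scaleC[OF clinear_ract])

lemma lin_emb [lin]: "clinear k \<Longrightarrow> clinear (\<lambda>x. emb (k x))"
  by (simp add: clinear_iff distrib_left distrib_right mult_scaleC_left mult_scaleC_right
      multiplier_eqI)

lemma lin_eta [lin]:
  "clinear ((*\<^sub>C) r)" "clinear ((*) (c::'c::complex_algebra))" "clinear ((\<otimes>) a)"
  "clinear ((\<triangleright>) m)" "clinear emb"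
  by (intro lin | simp)+

lemma mtensor_act [simp]:
  "(m \<otimes>\<^sub>m n) \<triangleright> (a \<otimes> b) = (m \<triangleright> a) \<otimes> (n \<triangleright> b)"
  "(a \<otimes> b) \<triangleleft> (m \<otimes>\<^sub>m n) = (a \<triangleleft> m) \<otimes> (b \<triangleleft> n)"
  by (simp_all add: mtensor_lact mtensor_ract)

lemma multiplier_eqI_tensor:
  assumes "\<And>a b. m \<triangleright> (a \<otimes> b) = n \<triangleright> (a \<otimes> b)" "\<And>a b. (a \<otimes> b) \<triangleleft> m = (a \<otimes> b) \<triangleleft> n"
  shows "m = n"
  by (rule multiplier_eqI)
     (rule clinear_eqI_tensor[OF clinear_lact clinear_lact assms(1)]
        clinear_eqI_tensor[OF clinear_ract clinear_ract assms(2)])+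

lemma lin_mtensor [lin]:
  "clinear h \<Longrightarrow> clinear (\<lambda>x. h x \<otimes>\<^sub>m n)"
  "clinear h' \<Longrightarrow> clinear (\<lambda>x. n' \<otimes>\<^sub>m h' x)"
  by (auto simp: clinear_iff tensor_add_left tensor_add_right tensor_scaleC_left
      tensor_scaleC_right intro!: multiplier_eqI_tensor)

lemma lin_tlift [lin]:
  "cbilinear B \<Longrightarrow> clinear f \<Longrightarrow> clinear (\<lambda>x. tlift B (f x))"
  "(\<And>p q. clinear (\<lambda>x. F x p q)) \<Longrightarrow> (\<And>x. cbilinear (F x)) \<Longrightarrow> clinear (\<lambda>x. tlift (F x) t)"
  by (blast intro: clinear_compose[OF _ clinear_tlift]) (rule clinear_tlift_arg)

lemma lin_tmap [lin]:
  "clinear g \<Longrightarrow> clinear g' \<Longrightarrow> clinear f \<Longrightarrow> clinear (\<lambda>x. tmap g g' (f x))"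
  by (rule clinear_compose[OF _ clinear_tmap])

lemma lin_tassoc [lin]:
  "clinear f \<Longrightarrow> clinear (\<lambda>x. tassoc (f x))"
  "clinear f' \<Longrightarrow> clinear (\<lambda>x. tunassoc (f' x))"
  by (simp_all add: clinear_compose[OF _ tassoc(1)] clinear_compose[OF _ tunassoc(1)])

lemma lin_tmap_arg_right [lin]:
  "clinear f \<Longrightarrow> (\<And>p. clinear (\<lambda>x. G x p)) \<Longrightarrow> (\<And>x. clinear (G x))
    \<Longrightarrow> clinear (\<lambda>x. tmap f (G x) t)"
  unfolding tmap_def by (rule lin_tlift(2); (intro lin; assumption))

lemma lin_tmap_arg_left [lin]:
  "clinear f \<Longrightarrow> (\<And>p. clinear (\<lambda>x. G x p)) \<Longrightarrow> (\<And>x. clinear (G x))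
    \<Longrightarrow> clinear (\<lambda>x. tmap (G x) f t)"
  unfolding tmap_def by (rule lin_tlift(2); (intro lin; assumption))

lemma tmap_tmap:
  "clinear f \<Longrightarrow> clinear g \<Longrightarrow> clinear f' \<Longrightarrow> clinear g' \<Longrightarrow>
    tmap f g (tmap f' g' t) = tmap (\<lambda>x. f (f' x)) (\<lambda>x. g (g' x)) t"
  by (rule clinear_eqI_tensor[of "\<lambda>t. tmap f g (tmap f' g' t)"])
     (simp_all add: clinear_compose lin)

lemma tlift_tmap:
  assumes "cbilinear B" "clinear f" "clinear g"
  shows "tlift B (tmap f g t) = tlift (\<lambda>p q. B (f p) (g q)) t"
proof -
  have *: "cbilinear (\<lambda>p q. B (f p) (g q))"
    using assms by (simp add: cbilinear_iff clinear_iff)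
  show ?thesis
    by (rule clinear_eqI_tensor[of "\<lambda>t. tlift B (tmap f g t)"])
       (use assms * in \<open>simp_all add: lin tlift_tensor\<close>)
qed

lemma clinear_out_tlift:
  assumes "clinear L" "cbilinear B"
  shows "L (tlift B t) = tlift (\<lambda>p q. L (B p q)) t"
proof -
  have *: "cbilinear (\<lambda>p q. L (B p q))"
    using assms by (simp add: cbilinear_iff clinear_iff)
  show ?thesis
    by (rule clinear_eqI_tensor[of "\<lambda>t. L (tlift B t)"])
       (use assms * in \<open>simp_all add: clinear_compose[OF clinear_tlift] lin tlift_tensor\<close>)
qed

lemma tlift_cong_bilinear:
  "(\<And>p q. B p q = B' p q) \<Longrightarrow> tlift B t = tlift B' t"
  by (metis ext)

definition sl_r :: "('b::complex_vector \<Rightarrow> complex) \<Rightarrow> ('a::complex_vector, 'b) tensor \<Rightarrow> 'a"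
  where "sl_r f = tlift (\<lambda>p q. f q *\<^sub>C p)"

definition sl_l :: "('a::complex_vector \<Rightarrow> complex) \<Rightarrow> ('a, 'b::complex_vector) tensor \<Rightarrow> 'b"
  where "sl_l f = tlift (\<lambda>p q. f p *\<^sub>C q)"

lemma sl_tensor [simp]:
  "clinear f \<Longrightarrow> sl_r f (a \<otimes> b) = f b *\<^sub>C a"
  "clinear g \<Longrightarrow> sl_l g (a \<otimes> b) = g a *\<^sub>C b"
  unfolding sl_r_def sl_l_def by (rule tlift_tensor; intro lin; assumption)+

lemma lin_sl [lin]:
  "clinear f \<Longrightarrow> clinear k \<Longrightarrow> clinear (\<lambda>x. sl_r f (k x))"
  "clinear f' \<Longrightarrow> clinear k' \<Longrightarrow> clinear (\<lambda>x. sl_l f' (k' x))"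
  unfolding sl_r_def sl_l_def by (intro lin; assumption)+

lemma sl_tmap:
  "clinear f \<Longrightarrow> clinear g \<Longrightarrow> clinear k \<Longrightarrow> sl_r k (tmap f g t) = f (sl_r (\<lambda>x. k (g x)) t)"
  "clinear f' \<Longrightarrow> clinear g' \<Longrightarrow> clinear k' \<Longrightarrow> sl_l k' (tmap f' g' t') = g' (sl_l (\<lambda>x. k' (f' x)) t')"
  subgoal
    by (rule clinear_eqI_tensor[of "\<lambda>t. sl_r k (tmap f g t)"])
       (simp_all add: lin clinear_compose clinear_scaleC clinear_compose[OF lin_sl(1)])
  subgoal
    by (rule clinear_eqI_tensor[of "\<lambda>t. sl_l k' (tmap f' g' t)"])
       (simp_all add: lin clinear_compose clinear_scaleC clinear_compose[OF lin_sl(2)])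
  done

text \<open>
  The coordinate functionals of a basis of the span of a finite set give a finite-rank projection
  that fixes the set.
\<close>

lemma finite_dual_basis:
  fixes F :: "'v::complex_vector set"
  assumes "finite F"
  shows "\<exists>gs :: (('v \<Rightarrow> complex) \<times> 'v) list.
    (\<forall>(g, v)\<in>set gs. clinear g) \<and> (\<forall>x\<in>F. (\<Sum>(g, v)\<leftarrow>gs. g x *\<^sub>C v) = x)"
proof -
  obtain B where B: "B \<subseteq> F" "module.independent scaleC B" "F \<subseteq> cspan B"
    by (rule complex_vector.maximal_independent_subset[of F])
  obtain bs where bs: "set bs = B" "distinct bs"
    using finite_distinct_list[OF finite_subset[OF B(1) assms]] by blast
  have "\<exists>g. clinear g \<and> (\<forall>x\<in>B. g x = (if x = b then 1 else 0 :: complex))" for b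
    by (rule complex_vector.linear_independent_extend[OF B(2)])
  then obtain g :: "'v \<Rightarrow> 'v \<Rightarrow> complex"
    where g: "\<And>b. clinear (g b)" "\<And>b x. x \<in> B \<Longrightarrow> g b x = (if x = b then 1 else 0)"
    by metis
  define P where "P = (\<lambda>x. \<Sum>b\<in>B. g b x *\<^sub>C b)"
  have P: "clinear P"
    unfolding P_def using g(1)
    by (auto simp: clinear_iff scaleC_add_left sum.distrib complex_vector.scale_sum_right
        scaleC_scaleC scaleC_complex_def)
  have "P x = x" if "x \<in> B" for x
  proof -
    have "P x = (\<Sum>b\<in>B. if b = x then b else 0)"
      unfolding P_def using that g(2) by (intro sum.cong) (auto simp: scaleC_one)
    then show ?thesis using that finite_subset[OF B(1) assms] by simp
  qed
  then have "P x = x" if "x \<in> cspan B" for x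
    using complex_vector.linear_eq_on[OF P clinear_id(2) that] by simp
  then have "\<forall>x\<in>F. (\<Sum>b\<leftarrow>bs. g b x *\<^sub>C b) = x"
    using B(3) bs by (auto simp: P_def sum_list_distinct_conv_sum_set)
  then show ?thesis
    by (intro exI[of _ "map (\<lambda>b. (g b, b)) bs"]) (auto simp: g(1) o_def)
qed

lemma tmap_finite_support:
  fixes t :: "('a::complex_vector, 'b::complex_vector) tensor"
  shows "\<exists>F. finite F \<and> (\<forall>P. clinear P \<longrightarrow> (\<forall>x\<in>F. P x = x) \<longrightarrow> tmap (\<lambda>x. x) P t = t)"
proof (induction t)
  case (add s t)
  then obtain F F' where "finite F" "\<forall>P. clinear P \<longrightarrow> (\<forall>x\<in>F. P x = x) \<longrightarrow> tmap (\<lambda>x. x) P s = s"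
    and "finite F'" "\<forall>P. clinear P \<longrightarrow> (\<forall>x\<in>F'. P x = x) \<longrightarrow> tmap (\<lambda>x. x) P t = t"
    by blast
  then show ?case
    by (intro exI[of _ "F \<union> F'"]) (auto simp: clinear_add[OF clinear_tmap])
next
  case (tensor a b)
  then show ?case by (intro exI[of _ "{b}"]) auto
qed

lemma tmap_finite_rank:
  fixes t :: "('a::complex_vector, 'b::complex_vector) tensor"
    and gs :: "(('b \<Rightarrow> complex) \<times> 'b) list"
  assumes "\<forall>(g, v)\<in>set gs. clinear g"
  shows "clinear (\<lambda>x. \<Sum>(g, v)\<leftarrow>gs. g x *\<^sub>C v)
    \<and> tmap (\<lambda>x. x) (\<lambda>x. \<Sum>(g, v)\<leftarrow>gs. g x *\<^sub>C v) t = (\<Sum>(g, v)\<leftarrow>gs. sl_r g t \<otimes> v)"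
  using assms
proof (induction gs)
  case Nil
  have 0: "clinear (\<lambda>x::'b. 0::'b)" by (simp add: clinear_iff)
  have "tmap (\<lambda>x. x) (\<lambda>x. 0 :: 'b) t = 0"
  proof (induction t)
    case (tensor a b)
    show ?case
      using complex_vector.linear_0[OF clinear_tensor(1)] by (simp add: tmap_tensor[OF clinear_id(2) 0])
  qed (simp add: clinear_add[OF clinear_tmap[OF clinear_id(2) 0]])
  then show ?case using 0 by simp
next
  case (Cons gv gs)
  obtain g v where gv: "gv = (g, v)" by force
  have g: "clinear g" using Cons.prems gv by auto
  let ?P = "\<lambda>x. \<Sum>(g, v)\<leftarrow>gs. g x *\<^sub>C v"
  have IH: "clinear ?P" "tmap (\<lambda>x. x) ?P t = (\<Sum>(g, v)\<leftarrow>gs. sl_r g t \<otimes> v)"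
    using Cons by auto
  have lP: "clinear (\<lambda>x. g x *\<^sub>C v + ?P x)" by (intro lin g IH(1))
  have "tmap (\<lambda>x. x) (\<lambda>x. g x *\<^sub>C v + ?P x) t = sl_r g t \<otimes> v + tmap (\<lambda>x. x) ?P t"
  proof (rule clinear_eqI_tensor[where g = "\<lambda>t. sl_r g t \<otimes> v + tmap (\<lambda>x. x) ?P t"])
    show "clinear (tmap (\<lambda>x. x) (\<lambda>x. g x *\<^sub>C v + ?P x))"
      by (rule clinear_tmap[OF clinear_id(2) lP])
    show "clinear (\<lambda>t. sl_r g t \<otimes> v + tmap (\<lambda>x. x) ?P t)" by (intro lin g IH(1))
    show "tmap (\<lambda>x. x) (\<lambda>x. g x *\<^sub>C v + ?P x) (a \<otimes> b) = sl_r g (a \<otimes> b) \<otimes> v + tmap (\<lambda>x. x) ?P (a \<otimes> b)"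
      for a :: 'a and b
      using g unfolding tmap_tensor[OF clinear_id(2) lP] tmap_tensor[OF clinear_id(2) IH(1)]
      by (simp add: tensor_add_right tensor_scaleC_left tensor_scaleC_right)
  qed
  then show ?case using lP IH gv by simp
qed

text \<open>
  Two tensors can be expanded over the same finite family in the second factor; this replaces the
  choice of a basis when tensors with different first factors are compared.
\<close>

lemma tensor_slice_decomp:
  fixes t :: "('a::complex_vector, 'b::complex_vector) tensor"
    and u :: "('c::complex_vector, 'b) tensor"
  obtains gs :: "(('b \<Rightarrow> complex) \<times> 'b) list" where "\<And>g v. (g, v) \<in> set gs \<Longrightarrow> clinear g"
    and "t = (\<Sum>(g, v)\<leftarrow>gs. sl_r g t \<otimes> v)" and "u = (\<Sum>(g, v)\<leftarrow>gs. sl_r g u \<otimes> v)"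
proof -
  obtain F where F: "finite F"
    "\<And>P. clinear P \<Longrightarrow> (\<forall>x\<in>F. P x = x) \<Longrightarrow> tmap (\<lambda>x. x) P t = t"
    using tmap_finite_support by blast
  obtain F' where F': "finite F'"
    "\<And>P. clinear P \<Longrightarrow> (\<forall>x\<in>F'. P x = x) \<Longrightarrow> tmap (\<lambda>x. x) P u = u"
    using tmap_finite_support by blast
  obtain gs :: "(('b \<Rightarrow> complex) \<times> 'b) list" where gs: "\<forall>(g, v)\<in>set gs. clinear g"
    "\<forall>x\<in>F \<union> F'. (\<Sum>(g, v)\<leftarrow>gs. g x *\<^sub>C v) = x"
    using finite_dual_basis[of "F \<union> F'"] F(1) F'(1) by blast
  show ?thesis
  proof (rule that)
    show "clinear g" if "(g, v) \<in> set gs" for g v using gs(1) that by blast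
    show "t = (\<Sum>(g, v)\<leftarrow>gs. sl_r g t \<otimes> v)"
      using F(2)[OF conjunct1[OF tmap_finite_rank[OF gs(1)]]] tmap_finite_rank[OF gs(1)] gs(2)
      by (metis UnCI)
    show "u = (\<Sum>(g, v)\<leftarrow>gs. sl_r g u \<otimes> v)"
      using F'(2)[OF conjunct1[OF tmap_finite_rank[OF gs(1)]]] tmap_finite_rank[OF gs(1)] gs(2)
      by (metis UnCI)
  qed
qed

lemma tensor_eqI_slices:
  fixes t u :: "('a::complex_vector, 'b::complex_vector) tensor"
  assumes "\<And>g. clinear g \<Longrightarrow> sl_r g t = sl_r g u"
  shows "t = u"
proof -
  obtain gs :: "(('b \<Rightarrow> complex) \<times> 'b) list" where gs: "\<And>g v. (g, v) \<in> set gs \<Longrightarrow> clinear g"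
    "t = (\<Sum>(g, v)\<leftarrow>gs. sl_r g t \<otimes> v)" "u = (\<Sum>(g, v)\<leftarrow>gs. sl_r g u \<otimes> v)"
    using tensor_slice_decomp by blast
  have "(\<Sum>(g, v)\<leftarrow>gs. sl_r g t \<otimes> v) = (\<Sum>(g, v)\<leftarrow>gs. sl_r g u \<otimes> v)"
    using assms gs(1) by (intro arg_cong[where f = sum_list] map_cong) auto
  then show ?thesis using gs by metis
qed

lemma sl_r_tflip: "clinear g \<Longrightarrow> sl_r g (tflip t) = sl_l g t"
  by (rule clinear_eqI_tensor[of "\<lambda>t. sl_r g (tflip t)"])
     (simp_all add: lin clinear_compose[OF tflip(1) lin_sl(1)])

lemma tensor_eqI_slices_left:
  assumes "\<And>g. clinear g \<Longrightarrow> sl_l g t = sl_l g u"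
  shows "t = u"
  using tensor_eqI_slices[of "tflip t" "tflip u"] assms by (metis sl_r_tflip tflip_tflip)

text \<open>
  Tensor products of injective maps are injective; here the injective map is the family \<open>L\<close>.
  The lemma removes the coverings that make Sweedler expressions finite.
\<close>

lemma tensor_strip_left:
  fixes L :: "'i \<Rightarrow> 'a::complex_vector \<Rightarrow> 'c::complex_vector"
    and t :: "('a, 'b::complex_vector) tensor"
  assumes lin: "\<And>c. clinear (L c)" and sep: "\<And>a b. (\<And>c. L c a = L c b) \<Longrightarrow> a = b"
    and eq: "\<And>c. tmap (L c) (\<lambda>x. x) t = tmap (L c) (\<lambda>x. x) u"
  shows "t = u"
proof (rule tensor_eqI_slices, rule sep)
  fix g :: "'b \<Rightarrow> complex" and c
  assume "clinear g"
  then show "L c (sl_r g t) = L c (sl_r g u)"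
    using arg_cong[OF eq[of c], of "sl_r g"] by (simp add: sl_tmap lin)
qed

lemma tensor_strip_right:
  fixes L :: "'i \<Rightarrow> 'b::complex_vector \<Rightarrow> 'c::complex_vector"
    and t :: "('a::complex_vector, 'b) tensor"
  assumes lin: "\<And>c. clinear (L c)" and sep: "\<And>a b. (\<And>c. L c a = L c b) \<Longrightarrow> a = b"
    and eq: "\<And>c. tmap (\<lambda>x. x) (L c) t = tmap (\<lambda>x. x) (L c) u"
  shows "t = u"
proof (rule tensor_eqI_slices_left, rule sep)
  fix g :: "'a \<Rightarrow> complex" and c
  assume "clinear g"
  then show "L c (sl_l g t) = L c (sl_l g u)"
    using arg_cong[OF eq[of c], of "sl_l g"] by (simp add: sl_tmap lin)
qed

text \<open>
  If \<open>\<Sum> B(x\<^sub>i, c) \<otimes> v\<^sub>i\<close> is known for all \<open>c\<close>, then \<open>\<Sum> B(x\<^sub>i, v\<^sub>i)\<close> is known: after a change of basis the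
  same independent \<open>v\<^sub>i\<close> occur in both sums, and coefficients can be compared.
\<close>

lemma tlift_diagonal:
  fixes t :: "('a::complex_vector, 'b::complex_vector) tensor"
    and u :: "('c::complex_vector, 'b) tensor"
    and B :: "'a \<Rightarrow> 'b \<Rightarrow> 'd::complex_vector"
  assumes B: "cbilinear B" "cbilinear B'"
    and eq: "\<And>c. tmap (\<lambda>x. B x c) (\<lambda>x. x) t = tmap (\<lambda>x. B' x c) (\<lambda>x. x) u"
  shows "tlift B t = tlift B' u"
proof -
  obtain gs :: "(('b \<Rightarrow> complex) \<times> 'b) list" where gs: "\<And>g v. (g, v) \<in> set gs \<Longrightarrow> clinear g"
    "t = (\<Sum>(g, v)\<leftarrow>gs. sl_r g t \<otimes> v)" "u = (\<Sum>(g, v)\<leftarrow>gs. sl_r g u \<otimes> v)"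
    using tensor_slice_decomp by blast
  have "B (sl_r g t) v = B' (sl_r g u) v" if "(g, v) \<in> set gs" for g v
    using arg_cong[OF eq[of v], of "sl_r g"] gs(1)[OF that]
    by (simp add: sl_tmap cbilinearD(1)[OF B(1)] cbilinearD(1)[OF B(2)])
  then have "(\<Sum>(g, v)\<leftarrow>gs. B (sl_r g t) v) = (\<Sum>(g, v)\<leftarrow>gs. B' (sl_r g u) v)"
    by (intro arg_cong[where f = sum_list] map_cong) auto
  moreover have "tlift B t = (\<Sum>(g, v)\<leftarrow>gs. B (sl_r g t) v)"
    by (subst gs(2)) (simp add: clinear_sum_list[OF clinear_tlift] B tlift_tensor o_def case_prod_beta')
  moreover have "tlift B' u = (\<Sum>(g, v)\<leftarrow>gs. B' (sl_r g u) v)"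
    by (subst gs(3)) (simp add: clinear_sum_list[OF clinear_tlift] B tlift_tensor o_def case_prod_beta')
  ultimately show ?thesis by simp
qed

lemma subspace_projection:
  fixes V :: "'a::complex_vector set"
  assumes "csubspace V"
  obtains p where "clinear p" "\<And>v. v \<in> V \<Longrightarrow> p v = v" "\<And>x. p x \<in> V"
  using complex_vector.linear_exists_left_inverse_on[OF clinear_id(2) assms] by auto

lemma sl_l_tassoc:
  assumes f: "clinear f"
  shows "sl_l f (tassoc (y \<otimes> q)) = sl_l f y \<otimes> q"
  by (rule clinear_eqI_tensor[of "\<lambda>y. sl_l f (tassoc (y \<otimes> q))"])
     (intro lin f | simp add: f tensor_scaleC_left)+

lemma sl_l_tassoc_tmap:
  assumes f: "clinear f" and g: "clinear g"
  shows "sl_l f (tassoc (tmap g (\<lambda>x. x) t)) = tmap (\<lambda>p. sl_l f (g p)) (\<lambda>x. x) t"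
  by (rule clinear_eqI_tensor[of "\<lambda>t. sl_l f (tassoc (tmap g (\<lambda>x. x) t))"])
     (intro lin f g | simp add: f g sl_l_tassoc lin)+

lemma sl_r_tassoc_tmap:
  assumes f: "clinear f" and g: "clinear g"
  shows "tmap (\<lambda>x. x) (sl_r f) (tassoc (tmap g (\<lambda>x. x) t)) = g (sl_r f t)"
proof -
  have l: "clinear (sl_r f)"
    using lin_sl(1)[OF f clinear_id(2)] by simp
  have *: "tmap (\<lambda>x. x) (sl_r f) (tassoc (u \<otimes> r)) = f r *\<^sub>C u" for u r
    by (rule clinear_eqI_tensor[of "\<lambda>u. tmap (\<lambda>x. x) (sl_r f) (tassoc (u \<otimes> r))"])
       (intro lin f l | simp add: f l tensor_scaleC_right)+
  show ?thesis
    by (rule clinear_eqI_tensor[of "\<lambda>t. tmap (\<lambda>x. x) (sl_r f) (tassoc (tmap g (\<lambda>x. x) t))"])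
       (intro lin f g l clinear_compose[OF _ g] | simp add: f g * clinear_scaleC)+
qed

lemma sl_r_zero:
  fixes t :: "('a::complex_vector, 'b::complex_vector) tensor"
  shows "sl_r (\<lambda>x. 0) t = 0"
proof -
  have 0: "clinear (\<lambda>x::'b. 0::complex)" by (simp add: clinear_iff)
  show ?thesis
    by (induction t) (simp_all add: clinear_add[OF lin_sl(1)[OF 0 clinear_id(2)]] 0)
qed

lemma slice_exchange:
  assumes "clinear f" "clinear g"
  shows "f (sl_r g t) = g (sl_l f t)"
  by (rule clinear_eqI_tensor[of "\<lambda>t. f (sl_r g t)"])
     (simp_all add: assms clinear_scaleC[OF assms(1)] clinear_scaleC[OF assms(2)] scaleC_complex_def
       clinear_compose[OF lin_sl(1)[OF assms(2) clinear_id(2)] assms(1)]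
       clinear_compose[OF lin_sl(2)[OF assms(1) clinear_id(2)] assms(2)])

lemma sl_l_combination:
  fixes t :: "('a::complex_vector, 'b::complex_vector) tensor"
  assumes "\<And>i. clinear (g i)"
  shows "clinear (\<lambda>x. \<Sum>(r, i)\<leftarrow>xs. r * g i x)"
    and "sl_l (\<lambda>x. \<Sum>(r, i)\<leftarrow>xs. r * g i x) t = (\<Sum>(r, i)\<leftarrow>xs. r *\<^sub>C sl_l (g i) t)"
proof -
  show l: "clinear (\<lambda>x. \<Sum>(r, i)\<leftarrow>xs. r * g i x)" for xs
    using assms by (induction xs) (auto simp: clinear_iff scaleC_complex_def algebra_simps)
  have m: "clinear (\<lambda>t. \<Sum>(r, i)\<leftarrow>xs. r *\<^sub>C sl_l (g i) t)"
  proof (induction xs)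
    case (Cons x xs)
    obtain r i where "x = (r, i)" by force
    then show ?case using Cons by (simp, intro lin assms)
  qed (simp add: clinear_iff)
  show "sl_l (\<lambda>x. \<Sum>(r, i)\<leftarrow>xs. r * g i x) t = (\<Sum>(r, i)\<leftarrow>xs. r *\<^sub>C sl_l (g i) t)"
  proof (rule clinear_eqI_tensor[OF lin_sl(2)[OF l clinear_id(2)] m])
    fix a :: 'a and b :: 'b
    have "(\<Sum>(r, i)\<leftarrow>xs. r * g i a) *\<^sub>C b = (\<Sum>(r, i)\<leftarrow>xs. r *\<^sub>C g i a *\<^sub>C b)"
      by (induction xs) (auto simp: scaleC_add_left scaleC_scaleC)
    then show "sl_l (\<lambda>x. \<Sum>(r, i)\<leftarrow>xs. r * g i x) (a \<otimes> b) = (\<Sum>(r, i)\<leftarrow>xs. r *\<^sub>C sl_l (g i) (a \<otimes> b))"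
      by (simp add: l assms)
  qed
qed

lemma tmap_tunassoc_left:
  fixes f :: "'a::complex_vector \<Rightarrow> ('b::complex_vector, 'c::complex_vector) tensor"
    and w :: "('d::complex_vector, 'a) tensor" and B :: "'d \<Rightarrow> 'b \<Rightarrow> 'e::complex_vector"
  assumes "clinear f" "cbilinear B"
  shows "tmap (tlift B) (\<lambda>x. x) (tunassoc (tmap (\<lambda>x. x) f w))
    = tlift (\<lambda>p q. tmap (\<lambda>u. B p u) (\<lambda>x. x) (f q)) w"
proof -
  note lB = clinear_tlift[OF assms(2)] and Bl = cbilinearD(1)[OF assms(2)] cbilinearD(2)[OF assms(2)]
  have *: "tmap (tlift B) (\<lambda>x. x) (tunassoc (p \<otimes> y)) = tmap (\<lambda>u. B p u) (\<lambda>x. x) y" for y p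
    by (rule clinear_eqI_tensor[of "\<lambda>y. tmap (tlift B) (\<lambda>x. x) (tunassoc (p \<otimes> y))"])
       (intro lin lB Bl | simp add: lB Bl tlift_tensor[OF assms(2)])+
  have cb: "cbilinear (\<lambda>p q. tmap (\<lambda>u. B p u) (\<lambda>x. x) (f q))"
    by (intro lin assms Bl)
  show ?thesis
    by (rule clinear_eqI_tensor[of "\<lambda>w. tmap (tlift B) (\<lambda>x. x) (tunassoc (tmap (\<lambda>x. x) f w))"])
       (intro lin lB assms clinear_tlift[OF cb] | simp add: * assms tlift_tensor[OF cb])+
qed

lemma span_tensor:
  assumes "a \<in> cspan X" "b \<in> cspan Y"
  shows "a \<otimes> b \<in> cspan {x \<otimes> y |x y. x \<in> X \<and> y \<in> Y}"
proof -
  have *: "x \<otimes> b \<in> cspan {x \<otimes> y |x y. x \<in> X \<and> y \<in> Y}" if "x \<in> X" for x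
    using assms(2)
  proof (induction rule: complex_vector.span_induct_alt)
    case base
    show ?case by (simp add: clinear_zero[OF clinear_tensor(1)] complex_vector.span_zero)
  next
    case (step c y z)
    have "x \<otimes> y \<in> cspan {x \<otimes> y |x y. x \<in> X \<and> y \<in> Y}"
      using step that by (blast intro: complex_vector.span_base)
    then show ?case
      using step by (simp add: tensor_add_right tensor_scaleC_right complex_vector.span_add
          complex_vector.span_scale)
  qed
  show ?thesis using assms(1)
  proof (induction rule: complex_vector.span_induct_alt)
    case base
    show ?case by (simp add: clinear_zero[OF clinear_tensor(2)] complex_vector.span_zero)
  next
    case (step c x z)
    then show ?case
      using * by (simp add: tensor_add_left tensor_scaleC_left complex_vector.span_add
          complex_vector.span_scale)
  qed
qed

lemma clinear_image_span:
  assumes "clinear f" "x \<in> cspan X" "\<And>x. x \<in> X \<Longrightarrow> f x \<in> cspan Y"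
  shows "f x \<in> cspan Y"
  using assms(2)
proof (induction rule: complex_vector.span_induct_alt)
  case base
  show ?case by (simp add: clinear_zero[OF assms(1)] complex_vector.span_zero)
next
  case (step c x z)
  then show ?case
    using assms by (simp add: clinear_add clinear_scaleC complex_vector.span_add
        complex_vector.span_scale)
qed

text \<open>
  A functional with prescribed values exists as soon as the prescription respects all linear
  relations.
\<close>

lemma functional_interpolation:
  fixes u :: "'i \<Rightarrow> 'a::complex_vector" and e :: "'i \<Rightarrow> complex"
  assumes "\<And>xs. (\<Sum>(r, i)\<leftarrow>xs. r *\<^sub>C u i) = 0 \<Longrightarrow> (\<Sum>(r, i)\<leftarrow>xs. r * e i) = 0"
  obtains \<phi> :: "'a \<Rightarrow> complex" where "clinear \<phi>" "\<And>i. \<phi> (u i) = e i"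
proof -
  obtain B where B: "B \<subseteq> range u" "module.independent scaleC B" "range u \<subseteq> cspan B"
    by (rule complex_vector.maximal_independent_subset[of "range u"])
  define idx where "idx b = (SOME i. u i = b)" for b
  have idx: "u (idx b) = b" if "b \<in> B" for b
    using that B(1) unfolding idx_def by (metis (mono_tags) imageE someI_ex subsetD)
  obtain \<phi> where \<phi>: "clinear \<phi>" "\<forall>b\<in>B. \<phi> b = e (idx b)"
    using complex_vector.linear_independent_extend[OF B(2), of "\<lambda>b. e (idx b)"] by blast
  have span: "\<exists>xs. (\<Sum>(r, i)\<leftarrow>xs. r *\<^sub>C u i) = x \<and> (\<Sum>(r, i)\<leftarrow>xs. r * e i) = \<phi> x"
    if "x \<in> cspan B" for x
    using that
  proof (induction rule: complex_vector.span_induct_alt)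
    case base
    show ?case by (intro exI[of _ "[]"]) (simp add: clinear_zero[OF \<phi>(1)])
  next
    case (step c b z)
    then obtain xs where "(\<Sum>(r, i)\<leftarrow>xs. r *\<^sub>C u i) = z" "(\<Sum>(r, i)\<leftarrow>xs. r * e i) = \<phi> z" by blast
    then show ?case
      using step(1) \<phi> idx
      by (intro exI[of _ "(c, idx b) # xs"])
         (simp add: clinear_add[OF \<phi>(1)] clinear_scaleC[OF \<phi>(1)] scaleC_complex_def)
  qed
  have "\<phi> (u i) = e i" for i
  proof -
    obtain xs where xs: "(\<Sum>(r, i)\<leftarrow>xs. r *\<^sub>C u i) = u i" "(\<Sum>(r, i)\<leftarrow>xs. r * e i) = \<phi> (u i)"
      using span[of "u i"] B(3) by blast
    then have "(\<Sum>(r, i)\<leftarrow>(- 1, i) # xs. r *\<^sub>C u i) = 0"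
      by (simp add: complex_vector.scale_minus_left scaleC_one)
    from assms[OF this] show ?thesis using xs by simp
  qed
  then show thesis using that \<phi>(1) by blast
qed

section \<open>Multipliers of non-degenerate algebras\<close>

lemma nondegenerateD:
  fixes a b :: "'a::complex_algebra"
  assumes "nondegenerate TYPE('a)"
  shows "(\<And>x. a * x = b * x) \<Longrightarrow> a = b" and "(\<And>x. x * a = x * b) \<Longrightarrow> a = b"
proof -
  have "(\<forall>x. (a - b) * x = 0) \<longrightarrow> a - b = 0" "(\<forall>x. x * (a - b) = 0) \<longrightarrow> a - b = 0"
    using assms unfolding nondegenerate_def by blast+
  then show "(\<And>x. a * x = b * x) \<Longrightarrow> a = b" "(\<And>x. x * a = x * b) \<Longrightarrow> a = b"
    by (simp_all add: left_diff_distrib right_diff_distrib)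
qed

lemma tensor_times_pure: "t * (c \<otimes> d) = tmap (\<lambda>x. x * c) (\<lambda>x. x * d) t"
  by (rule clinear_eqI_tensor[of "\<lambda>t. t * (c \<otimes> d)"])
     (simp_all add: times_tensor_tensor)

lemma nondegenerate_tensor:
  assumes a: "nondegenerate TYPE('a::complex_algebra)" and b: "nondegenerate TYPE('b::complex_algebra)"
  shows "nondegenerate TYPE(('a, 'b) tensor)"
proof -
  have r: "t = 0" if t: "\<And>u. t * u = 0" for t :: "('a, 'b) tensor"
  proof (rule tensor_strip_left[where L = "\<lambda>c x. x * c"])
    fix c :: 'a
    show "tmap (\<lambda>x. x * c) (\<lambda>x. x) t = tmap (\<lambda>x. x * c) (\<lambda>x. x) 0"
    proof (rule tensor_strip_right[where L = "\<lambda>d x. x * d"])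
      show "tmap (\<lambda>x. x) (\<lambda>x. x * d) (tmap (\<lambda>x. x * c) (\<lambda>x. x) t) =
        tmap (\<lambda>x. x) (\<lambda>x. x * d) (tmap (\<lambda>x. x * c) (\<lambda>x. x) 0)" for d :: 'b
        using t[of "c \<otimes> d"] by (simp add: tmap_tmap tensor_times_pure clinear_zero)
    qed (simp, rule nondegenerateD(1)[OF b], assumption)
  qed (simp, rule nondegenerateD(1)[OF a], assumption)
  have l: "t = 0" if t: "\<And>u. u * t = 0" for t :: "('a, 'b) tensor"
  proof (rule tensor_strip_left[where L = "\<lambda>c x. c * x"])
    fix c :: 'a
    show "tmap (\<lambda>x. c * x) (\<lambda>x. x) t = tmap (\<lambda>x. c * x) (\<lambda>x. x) 0"
    proof (rule tensor_strip_right[where L = "\<lambda>d x. d * x"])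
      show "tmap (\<lambda>x. x) (\<lambda>x. d * x) (tmap (\<lambda>x. c * x) (\<lambda>x. x) t) =
        tmap (\<lambda>x. x) (\<lambda>x. d * x) (tmap (\<lambda>x. c * x) (\<lambda>x. x) 0)" for d :: 'b
        using t[of "c \<otimes> d"] by (simp add: tmap_tmap tensor_times clinear_zero)
    qed (simp, rule nondegenerateD(2)[OF b], assumption)
  qed (simp, rule nondegenerateD(2)[OF a], assumption)
  show ?thesis using r l unfolding nondegenerate_def by blast
qed

lemma Multiplier_act:
  fixes l r :: "'a::complex_algebra \<Rightarrow> 'a"
  assumes nd: "nondegenerate TYPE('a)" and "clinear l" "clinear r"
    and lr: "\<And>a b. a * l b = r a * b"
  shows "Multiplier l r \<triangleright> a = l a" "a \<triangleleft> Multiplier l r = r a"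
proof -
  have "l (a * b) = l a * b" for a b
    by (rule nondegenerateD(2)[OF nd]) (simp add: lr flip: mult.assoc)
  moreover have "r (a * b) = a * r b" for a b
    by (rule nondegenerateD(1)[OF nd]) (simp add: mult.assoc flip: lr)
  ultimately have "Rep_multiplier (Multiplier l r) = (l, r)"
    unfolding Multiplier_def using assms by (intro Abs_multiplier_inverse) simp
  then show "Multiplier l r \<triangleright> a = l a" "a \<triangleleft> Multiplier l r = r a"
    by (simp_all add: lact.rep_eq ract.rep_eq)
qed

lemma multiplier_eqI_left:
  assumes nd: "nondegenerate TYPE('a::complex_algebra)" and "\<And>a::'a. m \<triangleright> a = n \<triangleright> a"
  shows "m = n"
proof (rule multiplier_eqI[OF assms(2)])
  show "a \<triangleleft> m = a \<triangleleft> n" for a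
    by (rule nondegenerateD(1)[OF nd]) (simp add: assms(2) flip: times_lact)
qed

lemma multiplier_eqI_right:
  assumes nd: "nondegenerate TYPE('a::complex_algebra)" and "\<And>a::'a. a \<triangleleft> m = a \<triangleleft> n"
  shows "m = n"
proof (rule multiplier_eqI[OF _ assms(2)])
  show "m \<triangleright> a = n \<triangleright> a" for a
    by (rule nondegenerateD(2)[OF nd]) (simp add: assms(2) times_lact)
qed

lemma emb_simps:
  "emb (a * b) = emb a * emb b" "m * emb a = emb (m \<triangleright> a)" "emb a * m = emb (a \<triangleleft> m)"
  by (rule multiplier_eqI; simp add: mult.assoc lact_times ract_times times_lact)+

lemma emb_tensor: "emb (a \<otimes> b) = emb a \<otimes>\<^sub>m emb b"
  by (rule multiplier_eqI_tensor) (simp_all add: times_tensor_tensor)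

lemma mtensor_mult: "(m \<otimes>\<^sub>m n) * (m' \<otimes>\<^sub>m n') = (m * m') \<otimes>\<^sub>m (n * n')"
  by (rule multiplier_eqI_tensor) simp_all

lemma mtensor_one: "1 \<otimes>\<^sub>m 1 = 1"
  by (rule multiplier_eqI_tensor) simp_all

lemma lact_fun: "(\<triangleright>) (emb x) = (*) x" "(\<triangleright>) 1 = (\<lambda>y. y)"
  by (rule ext; simp)+

lemma mtensor_emb_act:
  "(emb c \<otimes>\<^sub>m 1) \<triangleright> t = tmap ((*) c) (\<lambda>x. x) t" "(1 \<otimes>\<^sub>m emb d) \<triangleright> t' = tmap (\<lambda>x. x) ((*) d) t'"
  "u \<triangleleft> (emb c \<otimes>\<^sub>m 1) = tmap (\<lambda>x. x * c) (\<lambda>x. x) u" "u' \<triangleleft> (1 \<otimes>\<^sub>m emb d) = tmap (\<lambda>x. x) (\<lambda>x. x * d) u'"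
  by (simp_all add: mtensor_lact mtensor_ract lact_fun del: lact_simps(6))

lemma emb_tmap:
  "emb (tmap ((*) c) (\<lambda>x. x) t) = (emb c \<otimes>\<^sub>m 1) * emb t"
  "emb (tmap (\<lambda>x. x) ((*) d) t) = (1 \<otimes>\<^sub>m emb d) * emb t"
  "emb (tmap (\<lambda>x. x * c) (\<lambda>x. x) t) = emb t * (emb c \<otimes>\<^sub>m 1)"
  "emb (tmap (\<lambda>x. x) (\<lambda>x. x * d) t) = emb t * (1 \<otimes>\<^sub>m emb d)"
  unfolding emb_simps mtensor_emb_act by (rule refl)+

lemma lin_unemb:
  assumes nd: "nondegenerate TYPE('a::complex_algebra)" and k: "clinear k"
    and range: "\<And>x. k x \<in> range (emb :: 'a \<Rightarrow> _)"
  shows "clinear (\<lambda>x. unemb (k x))"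
proof -
  have *: "emb (unemb (k x)) = k x" for x
    using range[of x] unemb_emb[OF nd] by auto
  have "unemb (k (x + y)) = unemb (k x) + unemb (k y)" for x y
    by (rule injD[OF inj_emb[OF nd]])
       (use *[of "x + y"] in \<open>simp add: * clinear_add[OF k] clinear_add[OF lin_eta(5)]\<close>)
  moreover have "unemb (k (c *\<^sub>C x)) = c *\<^sub>C unemb (k x)" for x c
    by (rule injD[OF inj_emb[OF nd]])
       (use *[of "c *\<^sub>C x"] in \<open>simp add: * clinear_scaleC[OF k] clinear_scaleC[OF lin_eta(5)]\<close>)
  ultimately show ?thesis by (simp add: clinear_iff)
qed

text \<open>
  Non-degeneracy allows a covering by one factor of \<open>A \<otimes> B\<close> to be cancelled.
\<close>

lemma multiplier_strip:
  fixes m n :: "('a::complex_algebra, 'b::complex_algebra) tensor multiplier"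
  assumes nda: "nondegenerate TYPE('a)" and ndb: "nondegenerate TYPE('b)"
  shows "(\<And>b. m * (1 \<otimes>\<^sub>m emb b) = n * (1 \<otimes>\<^sub>m emb b)) \<Longrightarrow> m = n"
    and "(\<And>a. m * (emb a \<otimes>\<^sub>m 1) = n * (emb a \<otimes>\<^sub>m 1)) \<Longrightarrow> m = n"
    and "(\<And>b. (1 \<otimes>\<^sub>m emb b) * m = (1 \<otimes>\<^sub>m emb b) * n) \<Longrightarrow> m = n"
    and "(\<And>a. (emb a \<otimes>\<^sub>m 1) * m = (emb a \<otimes>\<^sub>m 1) * n) \<Longrightarrow> m = n"
proof -
  note nd = nondegenerate_tensor[OF nda ndb]
  have left: "m = n" if *: "\<And>a b c d. m \<triangleright> ((a * c) \<otimes> (b * d)) = n \<triangleright> ((a * c) \<otimes> (b * d))"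
  proof (rule multiplier_eqI_left[OF nd])
    fix t
    have "m \<triangleright> (s * v) = n \<triangleright> (s * v)" for s v
    proof (induction s)
      case (tensor a b)
      show ?case
        by (induction v) (simp_all add: distrib_left clinear_add[OF clinear_lact] times_tensor_tensor *)
    qed (simp add: distrib_right clinear_add[OF clinear_lact])
    then have "(m \<triangleright> t) * u = (n \<triangleright> t) * u" for u by (simp add: lact_times)
    then show "m \<triangleright> t = n \<triangleright> t" by (rule nondegenerateD(1)[OF nd])
  qed
  have right: "m = n" if *: "\<And>a b c d. ((a * c) \<otimes> (b * d)) \<triangleleft> m = ((a * c) \<otimes> (b * d)) \<triangleleft> n"
  proof (rule multiplier_eqI_right[OF nd])
    fix t
    have "(s * v) \<triangleleft> m = (s * v) \<triangleleft> n" for s v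
    proof (induction s)
      case (tensor a b)
      show ?case
        by (induction v) (simp_all add: distrib_left clinear_add[OF clinear_ract] times_tensor_tensor *)
    qed (simp add: distrib_right clinear_add[OF clinear_ract])
    then have "u * (t \<triangleleft> m) = u * (t \<triangleleft> n)" for u by (simp add: ract_times)
    then show "t \<triangleleft> m = t \<triangleleft> n" by (rule nondegenerateD(2)[OF nd])
  qed
  have act: "k \<triangleright> ((a * c) \<otimes> (b * d)) = (k * (1 \<otimes>\<^sub>m emb b)) \<triangleright> ((a * c) \<otimes> d)"
    "k \<triangleright> ((a * c) \<otimes> (b * d)) = (k * (emb a \<otimes>\<^sub>m 1)) \<triangleright> (c \<otimes> (b * d))"
    "((a * c) \<otimes> (b * d)) \<triangleleft> k = ((a * c) \<otimes> b) \<triangleleft> ((1 \<otimes>\<^sub>m emb d) * k)"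
    "((a * c) \<otimes> (b * d)) \<triangleleft> k = (a \<otimes> (b * d)) \<triangleleft> ((emb c \<otimes>\<^sub>m 1) * k)"
    for k :: "('a, 'b) tensor multiplier" and a b c d
    by simp_all
  { assume *: "\<And>b. m * (1 \<otimes>\<^sub>m emb b) = n * (1 \<otimes>\<^sub>m emb b)"
    show "m = n" by (rule left) (simp only: act(1) *) }
  { assume *: "\<And>a. m * (emb a \<otimes>\<^sub>m 1) = n * (emb a \<otimes>\<^sub>m 1)"
    show "m = n" by (rule left) (simp only: act(2) *) }
  { assume *: "\<And>b. (1 \<otimes>\<^sub>m emb b) * m = (1 \<otimes>\<^sub>m emb b) * n"
    show "m = n" by (rule right) (simp only: act(3) *) }
  { assume *: "\<And>a. (emb a \<otimes>\<^sub>m 1) * m = (emb a \<otimes>\<^sub>m 1) * n"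
    show "m = n" by (rule right) (simp only: act(4) *) }
qed

lemma massoc_act:
  "massoc m \<triangleright> tassoc t = tassoc (m \<triangleright> t)" "tassoc t \<triangleleft> massoc m = tassoc (t \<triangleleft> m)"
  by (rule mtransport_act[OF tassoc(1) tassoc_iso])+

lemma massoc_eqI:
  assumes "\<And>t. m \<triangleright> tassoc t = n \<triangleright> tassoc t" "\<And>t. tassoc t \<triangleleft> m = tassoc t \<triangleleft> n"
  shows "m = n"
proof (rule multiplier_eqI)
  show "m \<triangleright> t = n \<triangleright> t" "t \<triangleleft> m = t \<triangleleft> n" for t
    using assms[of "tunassoc t"] by simp_all
qed

lemma massoc_mult: "massoc (m * n) = massoc m * massoc n"
  by (rule massoc_eqI) (simp_all add: massoc_act)

lemma massoc_add: "massoc (m + n) = massoc m + massoc n"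
  by (rule massoc_eqI) (simp_all add: massoc_act clinear_add[OF tassoc(1)])

lemma massoc_scaleC: "massoc (c *\<^sub>C m) = c *\<^sub>C massoc m"
  by (rule massoc_eqI) (simp_all add: massoc_act clinear_scaleC[OF tassoc(1)])

lemma lin_massoc [lin]: "clinear k \<Longrightarrow> clinear (\<lambda>x. massoc (k x))"
  by (simp add: clinear_iff massoc_add massoc_scaleC)

lemma massoc_emb: "massoc (emb t) = emb (tassoc t)"
  by (rule massoc_eqI) (simp_all add: massoc_act tassoc_iso)

lemma massoc_mtensor: "massoc ((k \<otimes>\<^sub>m m) \<otimes>\<^sub>m n) = k \<otimes>\<^sub>m m \<otimes>\<^sub>m n"
proof (rule massoc_eqI)
  show "massoc ((k \<otimes>\<^sub>m m) \<otimes>\<^sub>m n) \<triangleright> tassoc t = (k \<otimes>\<^sub>m m \<otimes>\<^sub>m n) \<triangleright> tassoc t" for t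
  proof (induction t)
    case (tensor s c)
    show ?case
    proof (induction s)
      case (tensor a b)
      show ?case unfolding massoc_act by simp
    qed (simp add: tensor_add_left clinear_add[OF tassoc(1)] clinear_add[OF clinear_lact])
  qed (simp add: clinear_add[OF tassoc(1)] clinear_add[OF clinear_lact])
  show "tassoc t \<triangleleft> massoc ((k \<otimes>\<^sub>m m) \<otimes>\<^sub>m n) = tassoc t \<triangleleft> (k \<otimes>\<^sub>m m \<otimes>\<^sub>m n)" for t
  proof (induction t)
    case (tensor s c)
    show ?case
    proof (induction s)
      case (tensor a b)
      show ?case unfolding massoc_act by simp
    qed (simp add: tensor_add_left clinear_add[OF tassoc(1)] clinear_add[OF clinear_ract])
  qed (simp add: clinear_add[OF tassoc(1)] clinear_add[OF clinear_ract])
qed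

section \<open>Extension of homomorphisms to multiplier algebras\<close>

text \<open>
  Let \<open>\<gamma> : A \<rightarrow> M(B)\<close> be a homomorphism and \<open>e\<close> an idempotent with \<open>\<gamma>(A)B = eB\<close> and
  \<open>B\<gamma>(A) = Be\<close>.  The extension of \<open>\<gamma>\<close> to \<open>M(A)\<close> is given by \<open>\<gamma>(m)\<gamma>(a)b = \<gamma>(ma)b\<close>.  Instead of
  checking that this is well defined, the left action is characterized by the equations
  \<open>\<gamma>(a)y = \<gamma>(am)b\<close> for all \<open>a\<close>, which have exactly one solution \<open>y \<in> eB\<close>.
\<close>

locale multiplier_extension =
  fixes \<gamma> :: "'a::complex_algebra \<Rightarrow> 'b::complex_algebra multiplier" and e :: "'b multiplier"
  assumes nd: "nondegenerate TYPE('b)"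
    and lin_gamma: "clinear \<gamma>" and mult_gamma: "\<And>a b. \<gamma> (a * b) = \<gamma> a * \<gamma> b"
    and e_idem: "e * e = e"
    and e_gamma: "\<And>a. e * \<gamma> a = \<gamma> a" and gamma_e: "\<And>a. \<gamma> a * e = \<gamma> a"
    and span_left: "\<And>b. e \<triangleright> b \<in> cspan {\<gamma> a \<triangleright> b' |a b'. True}"
    and span_right: "\<And>b. b \<triangleleft> e \<in> cspan {b' \<triangleleft> \<gamma> a |a b'. True}"
begin

lemma e_act: "e \<triangleright> \<gamma> a \<triangleright> b = \<gamma> a \<triangleright> b" "b \<triangleleft> \<gamma> a \<triangleleft> e = b \<triangleleft> \<gamma> a"
  using e_gamma[of a] gamma_e[of a] by (metis lact_simps(4)) (metis ract_simps(4) gamma_e)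

lemma left_unique:
  assumes "e \<triangleright> y = y" "e \<triangleright> y' = y'" "\<And>a. \<gamma> a \<triangleright> y = \<gamma> a \<triangleright> y'"
  shows "y = y'"
proof (rule nondegenerateD(2)[OF nd])
  fix b
  have "c * y = c * y'" if "c \<in> cspan {b' \<triangleleft> \<gamma> a |a b'. True}" for c
    using that
  proof (induction rule: complex_vector.span_induct_alt)
    case (step r x z)
    then obtain a b' where "x = b' \<triangleleft> \<gamma> a" by blast
    then have "x * y = x * y'" using assms(3)[of a] by (simp flip: times_lact)
    then show ?case using step by (simp add: distrib_right mult_scaleC_left)
  qed simp
  from this[OF span_right] have "(b \<triangleleft> e) * y = (b \<triangleleft> e) * y'" .
  then show "b * y = b * y'" using assms by (simp flip: times_lact)
qed

lemma right_unique:
  assumes "y \<triangleleft> e = y" "y' \<triangleleft> e = y'" "\<And>a. y \<triangleleft> \<gamma> a = y' \<triangleleft> \<gamma> a"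
  shows "y = y'"
proof (rule nondegenerateD(1)[OF nd])
  fix b
  have "y * c = y' * c" if "c \<in> cspan {\<gamma> a \<triangleright> b' |a b'. True}" for c
    using that
  proof (induction rule: complex_vector.span_induct_alt)
    case (step r x z)
    then obtain a b' where "x = \<gamma> a \<triangleright> b'" by blast
    then have "y * x = y' * x" using assms(3)[of a] by (simp add: times_lact)
    then show ?case using step by (simp add: distrib_left mult_scaleC_right)
  qed simp
  from this[OF span_left] have "y * (e \<triangleright> b) = y' * (e \<triangleright> b)" .
  then show "y * b = y' * b" using assms by (simp add: times_lact)
qed

lemma left_exists: "\<exists>y. e \<triangleright> y = y \<and> (\<forall>a. \<gamma> a \<triangleright> y = \<gamma> (a \<triangleleft> m) \<triangleright> b)"
proof -
  have "\<exists>y. e \<triangleright> y = y \<and> (\<forall>a. \<gamma> a \<triangleright> y = \<gamma> (a \<triangleleft> m) \<triangleright> c)"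
    if "c \<in> cspan {\<gamma> a \<triangleright> b' |a b'. True}" for c
    using that
  proof (induction rule: complex_vector.span_induct_alt)
    case base
    then show ?case by (intro exI[of _ 0]) (simp add: clinear_zero)
  next
    case (step r x z)
    then obtain a b' y where x: "x = \<gamma> a \<triangleright> b'"
      and y: "e \<triangleright> y = y" "\<And>a. \<gamma> a \<triangleright> y = \<gamma> (a \<triangleleft> m) \<triangleright> z" by blast
    show ?case
    proof (intro exI[of _ "r *\<^sub>C (\<gamma> (m \<triangleright> a) \<triangleright> b') + y"] conjI allI)
      show "e \<triangleright> (r *\<^sub>C (\<gamma> (m \<triangleright> a) \<triangleright> b') + y) = r *\<^sub>C (\<gamma> (m \<triangleright> a) \<triangleright> b') + y"
        by (simp add: clinear_add[OF clinear_lact] clinear_scaleC[OF clinear_lact] e_act y)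
      fix a'
      have "\<gamma> a' \<triangleright> \<gamma> (m \<triangleright> a) \<triangleright> b' = \<gamma> (a' \<triangleleft> m) \<triangleright> x"
        unfolding x by (simp add: mult_gamma times_lact flip: lact_simps(4))
           (simp flip: mult_gamma add: times_lact)
      then show "\<gamma> a' \<triangleright> (r *\<^sub>C (\<gamma> (m \<triangleright> a) \<triangleright> b') + y) = \<gamma> (a' \<triangleleft> m) \<triangleright> (r *\<^sub>C x + z)"
        by (simp add: clinear_add[OF clinear_lact] clinear_scaleC[OF clinear_lact] y)
    qed
  qed
  from this[OF span_left] show ?thesis
    by (metis gamma_e lact_simps(4))
qed

lemma right_exists: "\<exists>y. y \<triangleleft> e = y \<and> (\<forall>a. y \<triangleleft> \<gamma> a = b \<triangleleft> \<gamma> (m \<triangleright> a))"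
proof -
  have "\<exists>y. y \<triangleleft> e = y \<and> (\<forall>a. y \<triangleleft> \<gamma> a = c \<triangleleft> \<gamma> (m \<triangleright> a))"
    if "c \<in> cspan {b' \<triangleleft> \<gamma> a |a b'. True}" for c
    using that
  proof (induction rule: complex_vector.span_induct_alt)
    case base
    then show ?case by (intro exI[of _ 0]) (simp add: clinear_zero[OF clinear_ract])
  next
    case (step r x z)
    then obtain a b' y where x: "x = b' \<triangleleft> \<gamma> a"
      and y: "y \<triangleleft> e = y" "\<And>a. y \<triangleleft> \<gamma> a = z \<triangleleft> \<gamma> (m \<triangleright> a)" by blast
    show ?case
    proof (intro exI[of _ "r *\<^sub>C (b' \<triangleleft> \<gamma> (a \<triangleleft> m)) + y"] conjI allI)
      show "(r *\<^sub>C (b' \<triangleleft> \<gamma> (a \<triangleleft> m)) + y) \<triangleleft> e = r *\<^sub>C (b' \<triangleleft> \<gamma> (a \<triangleleft> m)) + y"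
        by (simp add: clinear_add[OF clinear_ract] clinear_scaleC[OF clinear_ract] e_act y)
      fix a'
      have "b' \<triangleleft> \<gamma> (a \<triangleleft> m) \<triangleleft> \<gamma> a' = x \<triangleleft> \<gamma> (m \<triangleright> a')"
        unfolding x by (simp flip: ract_simps(4) mult_gamma add: times_lact)
      then show "(r *\<^sub>C (b' \<triangleleft> \<gamma> (a \<triangleleft> m)) + y) \<triangleleft> \<gamma> a' = (r *\<^sub>C x + z) \<triangleleft> \<gamma> (m \<triangleright> a')"
        by (simp add: clinear_add[OF clinear_ract] clinear_scaleC[OF clinear_ract] y)
    qed
  qed
  from this[OF span_right] show ?thesis
    by (metis e_gamma ract_simps(4))
qed

definition ext_l :: "'a multiplier \<Rightarrow> 'b \<Rightarrow> 'b"
  where "ext_l m b = (SOME y. e \<triangleright> y = y \<and> (\<forall>a. \<gamma> a \<triangleright> y = \<gamma> (a \<triangleleft> m) \<triangleright> b))"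

definition ext_r :: "'a multiplier \<Rightarrow> 'b \<Rightarrow> 'b"
  where "ext_r m b = (SOME y. y \<triangleleft> e = y \<and> (\<forall>a. y \<triangleleft> \<gamma> a = b \<triangleleft> \<gamma> (m \<triangleright> a)))"

lemma ext_l: "e \<triangleright> ext_l m b = ext_l m b" "\<gamma> a \<triangleright> ext_l m b = \<gamma> (a \<triangleleft> m) \<triangleright> b"
  using someI_ex[OF left_exists[of m b]] unfolding ext_l_def by blast+

lemma ext_r: "ext_r m b \<triangleleft> e = ext_r m b" "ext_r m b \<triangleleft> \<gamma> a = b \<triangleleft> \<gamma> (m \<triangleright> a)"
  using someI_ex[OF right_exists[of b m]] unfolding ext_r_def by blast+

lemma clinear_ext: "clinear (ext_l m)" "clinear (ext_r m)"
proof -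
  note lin = clinear_add[OF clinear_lact] clinear_scaleC[OF clinear_lact]
    clinear_add[OF clinear_ract] clinear_scaleC[OF clinear_ract]
  have "ext_l m (x + y) = ext_l m x + ext_l m y" "ext_l m (c *\<^sub>C x) = c *\<^sub>C ext_l m x" for x y c
    by (rule left_unique; simp add: ext_l lin)+
  moreover have "ext_r m (x + y) = ext_r m x + ext_r m y" "ext_r m (c *\<^sub>C x) = c *\<^sub>C ext_r m x" for x y c
    by (rule right_unique; simp add: ext_r lin)+
  ultimately show "clinear (ext_l m)" "clinear (ext_r m)" by (simp_all add: clinear_iff)
qed

lemma ext_compat: "b' * ext_l m b = ext_r m b' * b"
proof -
  have "c * ext_l m b = ext_r m c * b" if "c \<in> cspan {b' \<triangleleft> \<gamma> a |a b'. True}" for c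
    using that
  proof (induction rule: complex_vector.span_induct_alt)
    case base
    show ?case by (simp add: clinear_zero[OF clinear_ext(2)])
  next
    case (step r x z)
    then obtain a b' where x: "x = b' \<triangleleft> \<gamma> a" by blast
    have "ext_r m x = b' \<triangleleft> \<gamma> (a \<triangleleft> m)"
      by (rule right_unique)
         (simp_all add: ext_r e_act x times_lact flip: ract_simps(4) mult_gamma,
          simp add: e_act)
    then have "x * ext_l m b = ext_r m x * b"
      by (simp add: x ext_l flip: times_lact)
    then show ?case
      using step by (simp add: distrib_right mult_scaleC_left clinear_add[OF clinear_ext(2)]
          clinear_scaleC[OF clinear_ext(2)])
  qed
  from this[OF span_right, of b'] have "(b' \<triangleleft> e) * ext_l m b = ext_r m (b' \<triangleleft> e) * b" .
  moreover have "ext_r m (b' \<triangleleft> e) = ext_r m b'"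
    by (rule right_unique) (simp_all add: ext_r e_gamma flip: ract_simps(4))
  ultimately show ?thesis by (simp add: ext_l flip: times_lact)
qed

definition ext :: "'a multiplier \<Rightarrow> 'b multiplier"
  where "ext m = Multiplier (ext_l m) (ext_r m)"

lemma ext_act: "ext m \<triangleright> b = ext_l m b" "b \<triangleleft> ext m = ext_r m b"
  unfolding ext_def by (rule Multiplier_act[OF nd clinear_ext ext_compat])+

lemma extension_unique:
  assumes "clinear g" "\<And>x y. g (x * y) = g x * g y" "\<And>a. g (emb a) = \<gamma> a" "g 1 = e"
  shows "g = ext"
proof (rule ext, rule multiplier_eqI_left[OF nd])
  fix m b
  have "g m = e * g m" using assms(2)[of 1 m] assms(4) by simp
  then have 1: "e \<triangleright> g m \<triangleright> b = g m \<triangleright> b" by (metis lact_simps(4))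
  have "\<gamma> a * g m = \<gamma> (a \<triangleleft> m)" for a
    by (simp add: emb_simps flip: assms(2,3))
  then have 2: "\<gamma> a \<triangleright> g m \<triangleright> b = \<gamma> (a \<triangleleft> m) \<triangleright> b" for a by (metis lact_simps(4))
  show "g m \<triangleright> b = ext m \<triangleright> b"
    unfolding ext_act by (rule left_unique) (simp_all add: ext_l 1 2)
qed

lemma extension:
  "clinear ext" "ext (x * y) = ext x * ext y" "ext (emb a) = \<gamma> a" "ext 1 = e"
proof -
  have eqI: "m = n" if "\<And>b. e \<triangleright> m \<triangleright> b = m \<triangleright> b" "\<And>b. e \<triangleright> n \<triangleright> b = n \<triangleright> b"
    "\<And>a b. \<gamma> a \<triangleright> m \<triangleright> b = \<gamma> a \<triangleright> n \<triangleright> b" for m n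
    by (rule multiplier_eqI_left[OF nd], rule left_unique) (use that in auto)
  have gamma: "\<gamma> (a + b) = \<gamma> a + \<gamma> b" "\<gamma> (r *\<^sub>C a) = r *\<^sub>C \<gamma> a" for a b r
    using lin_gamma by (simp_all add: clinear_add clinear_scaleC)
  show "clinear ext"
    unfolding clinear_iff
    by (intro conjI allI; rule eqI)
      (simp_all add: ext_act ext_l gamma clinear_add[OF clinear_lact] clinear_scaleC[OF clinear_lact])
  show "ext (x * y) = ext x * ext y"
    by (rule eqI) (simp_all add: ext_act ext_l)
  show "ext (emb a) = \<gamma> a"
    by (rule eqI) (simp_all add: ext_act ext_l e_act mult_gamma)
  show "ext 1 = e"
    by (rule eqI) (simp_all add: ext_act ext_l gamma_e e_idem flip: lact_simps(4))
qed

lemma ext_gamma: "ext m * \<gamma> a = \<gamma> (m \<triangleright> a)" "\<gamma> a * ext m = \<gamma> (a \<triangleleft> m)"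
  using extension(2)[of m "emb a"] extension(2)[of "emb a" m]
  by (simp_all add: emb_simps(2,3) extension(3))

lemma e_ext: "e * ext m = ext m" "ext m * e = ext m"
  using extension(2)[of 1 m] extension(2)[of m 1] by (simp_all add: extension(4))

lemma ext_eqI:
  assumes "e * n = n" and "\<And>a. \<gamma> a * n = \<gamma> (a \<triangleleft> m)"
  shows "ext m = n"
proof (rule multiplier_eqI_left[OF nd])
  show "ext m \<triangleright> b = n \<triangleright> b" for b
    unfolding ext_act by (rule left_unique) (simp_all add: ext_l assms flip: lact_simps(4))
qed

lemma ext_eqI_right:
  assumes "n * e = n" and "\<And>a. n * \<gamma> a = \<gamma> (m \<triangleright> a)"
  shows "ext m = n"
proof (rule multiplier_eqI_right[OF nd])
  show "b \<triangleleft> ext m = b \<triangleleft> n" for b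
    unfolding ext_act by (rule right_unique) (simp_all add: ext_r assms flip: ract_simps(4))
qed

lemma mult_ext_eq: "mult_ext \<gamma> e = ext"
  unfolding mult_ext_def
  using extension extension_unique by (intro the_equality) blast+

end

section \<open>Extensions of the coproduct\<close>

context weak_multiplier_hopf_algebra
begin

lemmas nd = nondegenerate
lemmas nd2 = nondegenerate_tensor[OF nd nd]
lemmas nd3 = nondegenerate_tensor[OF nd nd2]
lemmas emb_inject = inj_eq[OF inj_emb[OF nd]]
lemmas emb2_inject = inj_eq[OF inj_emb[OF nd2]]
lemmas emb3_inject = inj_eq[OF inj_emb[OF nd3]]
lemmas strip = multiplier_strip[OF nd nd]

lemma lin_coproduct [lin]: "clinear k \<Longrightarrow> clinear (\<lambda>x. \<Delta> (k x))"
  using coproduct clinear_compose unfolding coproduct_def by blast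

lemma coproduct_mult: "\<Delta> (a * b) = \<Delta> a * \<Delta> b"
  using coproduct unfolding coproduct_def by blast

lemma cbilinear_T:
  "cbilinear (\<lambda>a b. unemb (\<Delta> a * (1 \<otimes>\<^sub>m emb b)))"
  "cbilinear (\<lambda>a b. unemb ((emb a \<otimes>\<^sub>m 1) * \<Delta> b))"
  by (intro cbilinearI lin_unemb[OF nd2] lin; (use coproduct in \<open>simp add: coproduct_def\<close>))+

lemma emb_T1: "emb (T1 \<Delta> (a \<otimes> b)) = \<Delta> a * (1 \<otimes>\<^sub>m emb b)"
proof -
  have "\<Delta> a * (1 \<otimes>\<^sub>m emb b) \<in> range emb"
    using coproduct unfolding coproduct_def by blast
  then show ?thesis
    unfolding T1_def tlift_tensor[OF cbilinear_T(1)] using unemb_emb[OF nd2] by auto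
qed

lemma emb_T2: "emb (T2 \<Delta> (a \<otimes> b)) = (emb a \<otimes>\<^sub>m 1) * \<Delta> b"
proof -
  have "(emb a \<otimes>\<^sub>m 1) * \<Delta> b \<in> range emb"
    using coproduct unfolding coproduct_def by blast
  then show ?thesis
    unfolding T2_def tlift_tensor[OF cbilinear_T(2)] using unemb_emb[OF nd2] by auto
qed

lemma lin_T [lin]:
  "clinear k \<Longrightarrow> clinear (\<lambda>x. T1 \<Delta> (k x))" "clinear k' \<Longrightarrow> clinear (\<lambda>x. T2 \<Delta> (k' x))"
  unfolding T1_def T2_def by (intro lin_tlift(1) cbilinear_T; assumption)+

lemma clinear_T: "clinear (T1 \<Delta>)" "clinear (T2 \<Delta>)"
  by (intro lin)+

lemma E_T1: "E \<triangleright> T1 \<Delta> t = T1 \<Delta> t"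
proof -
  have "T1 \<Delta> t \<in> range (\<lambda>t. E \<triangleright> t)" using range_T1 by blast
  then show ?thesis by (auto simp: E_idempotent simp flip: lact_simps(4))
qed

lemma T2_E: "T2 \<Delta> t \<triangleleft> E = T2 \<Delta> t"
proof -
  have "T2 \<Delta> t \<in> range (\<lambda>t. t \<triangleleft> E)" using range_T2 by blast
  then show ?thesis by (auto simp: E_idempotent simp flip: ract_simps(4))
qed

lemma E_coproduct: "E * \<Delta> a = \<Delta> a" "\<Delta> a * E = \<Delta> a"
proof -
  show "E * \<Delta> a = \<Delta> a"
  proof (rule strip(1))
    show "E * \<Delta> a * (1 \<otimes>\<^sub>m emb b) = \<Delta> a * (1 \<otimes>\<^sub>m emb b)" for b
      by (simp add: mult.assoc emb_simps E_T1 flip: emb_T1)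
  qed
  show "\<Delta> a * E = \<Delta> a"
  proof (rule strip(4))
    show "(emb b \<otimes>\<^sub>m 1) * (\<Delta> a * E) = (emb b \<otimes>\<^sub>m 1) * \<Delta> a" for b
      by (simp add: emb_simps T2_E flip: emb_T2 mult.assoc)
  qed
qed

lemma E_eq_T1: obtains u where "E \<triangleright> t = T1 \<Delta> u"
  using range_T1 by (metis rangeE rangeI)

lemma E_eq_T2: obtains u where "t \<triangleleft> E = T2 \<Delta> u"
  using range_T2 by (metis rangeE rangeI)

lemma idempotent_span: "(a::'a) \<in> cspan {x * y |x y. True}"
  using idempotent unfolding idempotent_algebra_def by blast

lemma E_span: "E \<triangleright> t \<in> cspan {\<Delta> a \<triangleright> u |a u. True}" "t \<triangleleft> E \<in> cspan {u \<triangleleft> \<Delta> a |a u. True}"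
proof -
  have 1: "T1 \<Delta> (a \<otimes> b) \<in> cspan {\<Delta> a \<triangleright> u |a u. True}" for a b
  proof (rule clinear_image_span[where f = "\<lambda>a. T1 \<Delta> (a \<otimes> b)", OF _ idempotent_span])
    fix x assume "x \<in> {x * y |x y :: 'a. True}"
    then obtain y z where x: "x = y * z" by blast
    have "emb (T1 \<Delta> (x \<otimes> b)) = emb (\<Delta> y \<triangleright> T1 \<Delta> (z \<otimes> b))"
      by (simp add: emb_T1 x coproduct_mult mult.assoc flip: emb_simps)
    then have "T1 \<Delta> (x \<otimes> b) = \<Delta> y \<triangleright> T1 \<Delta> (z \<otimes> b)" by (simp only: emb2_inject)
    then show "T1 \<Delta> (x \<otimes> b) \<in> cspan {\<Delta> a \<triangleright> u |a u. True}"
      by (auto intro: complex_vector.span_base)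
  qed (intro lin)
  have "T1 \<Delta> s \<in> cspan {\<Delta> a \<triangleright> u |a u. True}" for s
  proof (induction s)
    case (add s t)
    then show ?case by (simp only: clinear_add[OF clinear_T(1)] complex_vector.span_add)
  qed (rule 1)
  then show "E \<triangleright> t \<in> cspan {\<Delta> a \<triangleright> u |a u. True}" by (metis E_eq_T1)
  have 2: "T2 \<Delta> (a \<otimes> b) \<in> cspan {u \<triangleleft> \<Delta> a |a u. True}" for a b
  proof (rule clinear_image_span[where f = "\<lambda>b. T2 \<Delta> (a \<otimes> b)", OF _ idempotent_span])
    fix x assume "x \<in> {x * y |x y :: 'a. True}"
    then obtain y z where x: "x = y * z" by blast
    have "emb (T2 \<Delta> (a \<otimes> x)) = emb (T2 \<Delta> (a \<otimes> y) \<triangleleft> \<Delta> z)"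
      by (simp add: emb_T2 x coproduct_mult mult.assoc flip: emb_simps)
    then have "T2 \<Delta> (a \<otimes> x) = T2 \<Delta> (a \<otimes> y) \<triangleleft> \<Delta> z" by (simp only: emb2_inject)
    then show "T2 \<Delta> (a \<otimes> x) \<in> cspan {u \<triangleleft> \<Delta> a |a u. True}"
      by (auto intro: complex_vector.span_base)
  qed (intro lin)
  have "T2 \<Delta> s \<in> cspan {u \<triangleleft> \<Delta> a |a u. True}" for s
  proof (induction s)
    case (add s t)
    then show ?case by (simp only: clinear_add[OF clinear_T(2)] complex_vector.span_add)
  qed (rule 2)
  then show "t \<triangleleft> E \<in> cspan {u \<triangleleft> \<Delta> a |a u. True}" by (metis E_eq_T2)
qed

sublocale Delta: multiplier_extension \<Delta> E
proof (rule multiplier_extension.intro)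
  show "clinear \<Delta>" by (intro lin)
qed (use E_span in \<open>simp_all add: nd2 coproduct_mult E_idempotent E_coproduct\<close>)

lemma id_tensor_coprod_tensor: "id_tensor_coprod \<Delta> (a \<otimes> b) = emb a \<otimes>\<^sub>m \<Delta> b"
  unfolding id_tensor_coprod_def by (rule tlift_tensor) (intro lin)

lemma coprod_tensor_id_tensor: "coprod_tensor_id \<Delta> (a \<otimes> b) = massoc (\<Delta> a \<otimes>\<^sub>m emb b)"
  unfolding coprod_tensor_id_def by (rule tlift_tensor) (intro lin)

lemma clinear_id_coprod: "clinear (id_tensor_coprod \<Delta>)" "clinear (coprod_tensor_id \<Delta>)"
  unfolding id_tensor_coprod_def coprod_tensor_id_def by (rule clinear_tlift, intro lin)+

sublocale D2: multiplier_extension "id_tensor_coprod \<Delta>" "1 \<otimes>\<^sub>m E"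
proof (rule multiplier_extension.intro)
  note tns = id_tensor_coprod_tensor and add = clinear_add[OF clinear_id_coprod(1)]
  show "nondegenerate TYPE('a tensor3)" by (rule nd3)
  show "clinear (id_tensor_coprod \<Delta>)" by (rule clinear_id_coprod)
  show "id_tensor_coprod \<Delta> (s * t) = id_tensor_coprod \<Delta> s * id_tensor_coprod \<Delta> t" for s t
  proof (induction s)
    case (tensor a b)
    show ?case
      by (induction t)
         (simp_all add: tns add distrib_left times_tensor_tensor emb_simps(1) coproduct_mult mtensor_mult)
  qed (simp add: add distrib_right)
  show "(1 \<otimes>\<^sub>m E) * (1 \<otimes>\<^sub>m E) = 1 \<otimes>\<^sub>m E"
    by (simp add: mtensor_mult E_idempotent)
  show "(1 \<otimes>\<^sub>m E) * id_tensor_coprod \<Delta> t = id_tensor_coprod \<Delta> t"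
    "id_tensor_coprod \<Delta> t * (1 \<otimes>\<^sub>m E) = id_tensor_coprod \<Delta> t" for t
    by (induction t; simp add: tns add distrib_left distrib_right mtensor_mult E_coproduct)+
  show "(1 \<otimes>\<^sub>m E) \<triangleright> t \<in> cspan {id_tensor_coprod \<Delta> s \<triangleright> u |s u. True}" for t
  proof (induction t)
    case (tensor a u)
    have "a \<otimes> (E \<triangleright> u) \<in> cspan {id_tensor_coprod \<Delta> s \<triangleright> u |s u. True}"
    proof (rule clinear_image_span[OF clinear_id(2) span_tensor[OF idempotent_span E_span(1)]])
      fix x assume "x \<in> {x \<otimes> y |x y. x \<in> {x * y :: 'a |x y. True} \<and> y \<in> {\<Delta> a \<triangleright> u |a u. True}}"
      then obtain b v c d where "x = (c * d) \<otimes> (\<Delta> b \<triangleright> v)" by blast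
      then have "x = id_tensor_coprod \<Delta> (c \<otimes> b) \<triangleright> (d \<otimes> v)" by (simp add: tns)
      then show "x \<in> cspan {id_tensor_coprod \<Delta> s \<triangleright> u |s u. True}"
        by (blast intro: complex_vector.span_base)
    qed
    then show ?case by simp
  qed (simp add: clinear_add[OF clinear_lact] complex_vector.span_add)
  show "t \<triangleleft> (1 \<otimes>\<^sub>m E) \<in> cspan {u \<triangleleft> id_tensor_coprod \<Delta> s |s u. True}" for t
  proof (induction t)
    case (tensor a u)
    have "a \<otimes> (u \<triangleleft> E) \<in> cspan {u \<triangleleft> id_tensor_coprod \<Delta> s |s u. True}"
    proof (rule clinear_image_span[OF clinear_id(2) span_tensor[OF idempotent_span E_span(2)]])
      fix x assume "x \<in> {x \<otimes> y |x y. x \<in> {x * y :: 'a |x y. True} \<and> y \<in> {u \<triangleleft> \<Delta> a |a u. True}}"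
      then obtain b v c d where "x = (c * d) \<otimes> (v \<triangleleft> \<Delta> b)" by blast
      then have "x = (c \<otimes> v) \<triangleleft> id_tensor_coprod \<Delta> (d \<otimes> b)" by (simp add: tns)
      then show "x \<in> cspan {u \<triangleleft> id_tensor_coprod \<Delta> s |s u. True}"
        by (blast intro: complex_vector.span_base)
    qed
    then show ?case by simp
  qed (simp add: clinear_add[OF clinear_ract] complex_vector.span_add)
qed

sublocale D1: multiplier_extension "coprod_tensor_id \<Delta>" "massoc (E \<otimes>\<^sub>m 1)"
proof (rule multiplier_extension.intro)
  note tns = coprod_tensor_id_tensor and add = clinear_add[OF clinear_id_coprod(2)]
  show "nondegenerate TYPE('a tensor3)" by (rule nd3)
  show "clinear (coprod_tensor_id \<Delta>)" by (rule clinear_id_coprod)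
  show "coprod_tensor_id \<Delta> (s * t) = coprod_tensor_id \<Delta> s * coprod_tensor_id \<Delta> t" for s t
  proof (induction s)
    case (tensor a b)
    show ?case
      by (induction t)
         (simp_all add: tns add distrib_left times_tensor_tensor emb_simps(1) coproduct_mult mtensor_mult
           flip: massoc_mult)
  qed (simp add: add distrib_right)
  show "massoc (E \<otimes>\<^sub>m 1) * massoc (E \<otimes>\<^sub>m 1) = massoc (E \<otimes>\<^sub>m 1)"
    by (simp add: mtensor_mult E_idempotent flip: massoc_mult)
  show "massoc (E \<otimes>\<^sub>m 1) * coprod_tensor_id \<Delta> t = coprod_tensor_id \<Delta> t"
    "coprod_tensor_id \<Delta> t * massoc (E \<otimes>\<^sub>m 1) = coprod_tensor_id \<Delta> t" for t
    by (induction t; simp add: tns add distrib_left distrib_right mtensor_mult E_coproduct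
        flip: massoc_mult)+
  have l: "massoc (E \<otimes>\<^sub>m 1) \<triangleright> tassoc t \<in> cspan {coprod_tensor_id \<Delta> s \<triangleright> u |s u. True}" for t
  proof (induction t)
    case (tensor u a)
    have "massoc (E \<otimes>\<^sub>m 1) \<triangleright> tassoc (u \<otimes> a) = tassoc ((E \<triangleright> u) \<otimes> a)"
      unfolding massoc_act by simp
    also have "\<dots> \<in> cspan {coprod_tensor_id \<Delta> s \<triangleright> u |s u. True}"
    proof (rule clinear_image_span[OF tassoc(1) span_tensor[OF E_span(1) idempotent_span]])
      fix x assume "x \<in> {x \<otimes> y |x y. x \<in> {\<Delta> a \<triangleright> u |a u. True} \<and> y \<in> {x * y :: 'a |x y. True}}"
      then obtain b v c d where "x = (\<Delta> b \<triangleright> v) \<otimes> (c * d)" by blast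
      then have "tassoc x = coprod_tensor_id \<Delta> (b \<otimes> c) \<triangleright> tassoc (v \<otimes> d)"
        unfolding tns massoc_act by simp
      then show "tassoc x \<in> cspan {coprod_tensor_id \<Delta> s \<triangleright> u |s u. True}"
        by (auto intro: complex_vector.span_base)
    qed
    finally show ?case .
  qed (simp add: clinear_add[OF clinear_lact] clinear_add[OF tassoc(1)] complex_vector.span_add)
  show "massoc (E \<otimes>\<^sub>m 1) \<triangleright> t \<in> cspan {coprod_tensor_id \<Delta> s \<triangleright> u |s u. True}" for t
    using l[of "tunassoc t"] by simp
  have r: "tassoc t \<triangleleft> massoc (E \<otimes>\<^sub>m 1) \<in> cspan {u \<triangleleft> coprod_tensor_id \<Delta> s |s u. True}" for t
  proof (induction t)
    case (tensor u a)
    have "tassoc (u \<otimes> a) \<triangleleft> massoc (E \<otimes>\<^sub>m 1) = tassoc ((u \<triangleleft> E) \<otimes> a)"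
      unfolding massoc_act by simp
    also have "\<dots> \<in> cspan {u \<triangleleft> coprod_tensor_id \<Delta> s |s u. True}"
    proof (rule clinear_image_span[OF tassoc(1) span_tensor[OF E_span(2) idempotent_span]])
      fix x assume "x \<in> {x \<otimes> y |x y. x \<in> {u \<triangleleft> \<Delta> a |a u. True} \<and> y \<in> {x * y :: 'a |x y. True}}"
      then obtain b v c d where "x = (v \<triangleleft> \<Delta> b) \<otimes> (c * d)" by blast
      then have "tassoc x = tassoc (v \<otimes> c) \<triangleleft> coprod_tensor_id \<Delta> (b \<otimes> d)"
        unfolding tns massoc_act by simp
      then show "tassoc x \<in> cspan {u \<triangleleft> coprod_tensor_id \<Delta> s |s u. True}"
        by (auto intro: complex_vector.span_base)
    qed
    finally show ?case .
  qed (simp add: clinear_add[OF clinear_ract] clinear_add[OF tassoc(1)] complex_vector.span_add)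
  show "t \<triangleleft> massoc (E \<otimes>\<^sub>m 1) \<in> cspan {u \<triangleleft> coprod_tensor_id \<Delta> s |s u. True}" for t
    using r[of "tunassoc t"] by simp
qed

lemma D2_E:
  "D2.ext E = massoc (E \<otimes>\<^sub>m 1) * (1 \<otimes>\<^sub>m E)" "D2.ext E = (1 \<otimes>\<^sub>m E) * massoc (E \<otimes>\<^sub>m 1)"
  using coprod_E E_commute unfolding D2.mult_ext_eq by simp_all

lemma D1_right: "D1.ext (1 \<otimes>\<^sub>m n) = massoc (E \<otimes>\<^sub>m n)"
proof (rule D1.ext_eqI)
  show "massoc (E \<otimes>\<^sub>m 1) * massoc (E \<otimes>\<^sub>m n) = massoc (E \<otimes>\<^sub>m n)"
    by (simp add: mtensor_mult E_idempotent flip: massoc_mult)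
  show "coprod_tensor_id \<Delta> t * massoc (E \<otimes>\<^sub>m n) = coprod_tensor_id \<Delta> (t \<triangleleft> (1 \<otimes>\<^sub>m n))" for t
    by (induction t)
      (simp_all add: coprod_tensor_id_tensor mtensor_mult E_coproduct emb_simps distrib_right
        clinear_add[OF clinear_id_coprod(2)] clinear_add[OF clinear_ract] flip: massoc_mult)
qed

lemma D2_left: "D2.ext (m \<otimes>\<^sub>m 1) = m \<otimes>\<^sub>m E"
proof (rule D2.ext_eqI)
  show "(1 \<otimes>\<^sub>m E) * (m \<otimes>\<^sub>m E) = m \<otimes>\<^sub>m E"
    by (simp add: mtensor_mult E_idempotent)
  show "id_tensor_coprod \<Delta> t * (m \<otimes>\<^sub>m E) = id_tensor_coprod \<Delta> (t \<triangleleft> (m \<otimes>\<^sub>m 1))" for t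
    by (induction t)
      (simp_all add: id_tensor_coprod_tensor mtensor_mult E_coproduct emb_simps distrib_right
        clinear_add[OF clinear_id_coprod(1)] clinear_add[OF clinear_ract])
qed

lemma massoc_one_right: "massoc (1 \<otimes>\<^sub>m n) = 1 \<otimes>\<^sub>m 1 \<otimes>\<^sub>m n"
  using massoc_mtensor[of 1 1 n] by (simp add: mtensor_one)

lemma D1_T1: "coprod_tensor_id \<Delta> (T1 \<Delta> (b \<otimes> c)) = D1.ext (\<Delta> b) * (1 \<otimes>\<^sub>m 1 \<otimes>\<^sub>m emb c)"
proof -
  have "coprod_tensor_id \<Delta> (T1 \<Delta> (b \<otimes> c)) = D1.ext (\<Delta> b) * massoc (E \<otimes>\<^sub>m emb c)"
    by (simp add: emb_T1 D1.extension(2) D1_right flip: D1.extension(3))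
  also have "massoc (E \<otimes>\<^sub>m emb c) = massoc (E \<otimes>\<^sub>m 1) * (1 \<otimes>\<^sub>m 1 \<otimes>\<^sub>m emb c)"
    by (simp add: mtensor_mult flip: massoc_one_right massoc_mult)
  finally show ?thesis by (simp add: D1.e_ext flip: mult.assoc)
qed

lemma D2_T2: "id_tensor_coprod \<Delta> (T2 \<Delta> (a \<otimes> b)) = (emb a \<otimes>\<^sub>m 1) * D2.ext (\<Delta> b)"
proof -
  have "id_tensor_coprod \<Delta> (T2 \<Delta> (a \<otimes> b)) = (emb a \<otimes>\<^sub>m E) * D2.ext (\<Delta> b)"
    by (simp add: emb_T2 D2.extension(2) D2_left flip: D2.extension(3))
  also have "emb a \<otimes>\<^sub>m E = (emb a \<otimes>\<^sub>m 1) * (1 \<otimes>\<^sub>m E)"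
    by (simp add: mtensor_mult)
  finally show ?thesis by (simp add: D2.e_ext mult.assoc)
qed

lemma strip3:
  fixes m n :: "'a tensor3 multiplier"
  assumes "\<And>c. m * (1 \<otimes>\<^sub>m 1 \<otimes>\<^sub>m emb c) = n * (1 \<otimes>\<^sub>m 1 \<otimes>\<^sub>m emb c)"
  shows "m = n"
proof (rule multiplier_strip(1)[OF nd nd2])
  show "m * (1 \<otimes>\<^sub>m emb t) = n * (1 \<otimes>\<^sub>m emb t)" for t
  proof (induction t)
    case (add s t)
    then show ?case
      by (simp add: distrib_left clinear_add[OF lin_mtensor(2)[OF clinear_id(2)]] clinear_add[OF lin_eta(5)])
  next
    case (tensor b c)
    have "1 \<otimes>\<^sub>m emb (b \<otimes> c) = (1 \<otimes>\<^sub>m 1 \<otimes>\<^sub>m emb c) * (1 \<otimes>\<^sub>m emb b \<otimes>\<^sub>m 1 :: 'a tensor3 multiplier)"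
      by (simp add: emb_tensor mtensor_mult)
    then have "k * (1 \<otimes>\<^sub>m emb (b \<otimes> c)) = k * (1 \<otimes>\<^sub>m 1 \<otimes>\<^sub>m emb c) * (1 \<otimes>\<^sub>m emb b \<otimes>\<^sub>m 1)"
      for k :: "'a tensor3 multiplier"
      by (simp only: mult.assoc)
    then show ?case by (simp only: assms)
  qed
qed

text \<open>
  The coassociativity axiom is covered by \<open>a\<close> on the left and \<open>c\<close> on the right.  Both sides are
  coverings of extended homomorphisms, and the coverings cancel.
\<close>

lemma coassociative: "D1.ext (\<Delta> b) = D2.ext (\<Delta> b)"
proof (rule multiplier_strip(4)[OF nd nd2], rule strip3)
  show "(emb a \<otimes>\<^sub>m 1) * D1.ext (\<Delta> b) * (1 \<otimes>\<^sub>m 1 \<otimes>\<^sub>m emb c)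
      = (emb a \<otimes>\<^sub>m 1) * D2.ext (\<Delta> b) * (1 \<otimes>\<^sub>m 1 \<otimes>\<^sub>m emb c)" for a c
    using coproduct unfolding coproduct_def D1_T1 D2_T2 by (simp add: mult.assoc)
qed

text \<open>
  \<open>(\<Delta> \<otimes> id)E = (id \<otimes> \<Delta>)E\<close>: these idempotents are the images of \<open>\<Delta>(1)\<close> under the two extensions.  The
  range of the first and the co-range of the second are spanned by the common values \<open>\<Delta>\<^sup>2(A)\<close>, which
  both idempotents fix.
\<close>

lemma D1_E: "D1.ext E = D2.ext E"
proof -
  let ?R = "cspan {D1.ext (\<Delta> a) \<triangleright> u |a u. True}"
  have "D1.ext E \<triangleright> t \<in> ?R" for t
  proof -
    have T: "coprod_tensor_id \<Delta> (T1 \<Delta> s) \<triangleright> u \<in> ?R" for s u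
    proof (induction s)
      case (add s t)
      then show ?case
        by (simp add: clinear_add[OF clinear_T(1)] clinear_add[OF clinear_id_coprod(2)]
            complex_vector.span_add)
    qed (auto simp: D1_T1 intro: complex_vector.span_base)
    have "D1.ext E \<triangleright> (massoc (E \<otimes>\<^sub>m 1) \<triangleright> t) \<in> ?R"
    proof (rule clinear_image_span[OF clinear_lact D1.span_left])
      fix x assume "x \<in> {coprod_tensor_id \<Delta> s \<triangleright> u |s u. True}"
      then obtain s u where x: "x = coprod_tensor_id \<Delta> s \<triangleright> u" by blast
      obtain s' where "E \<triangleright> s = T1 \<Delta> s'" by (rule E_eq_T1)
      with x have "D1.ext E \<triangleright> x = coprod_tensor_id \<Delta> (T1 \<Delta> s') \<triangleright> u"
        by (simp add: D1.ext_gamma flip: lact_simps(4))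
      then show "D1.ext E \<triangleright> x \<in> ?R" using T by simp
    qed
    then show ?thesis by (simp add: D1.e_ext flip: lact_simps(4))
  qed
  moreover have "D2.ext E \<triangleright> x = x" if "x \<in> ?R" for x
    using that
  proof (induction rule: complex_vector.span_induct_alt)
    case (step c x y)
    then show ?case
      by (auto simp: clinear_add[OF clinear_lact] clinear_scaleC[OF clinear_lact] coassociative
          E_coproduct simp flip: lact_simps(4) D2.extension(2))
  qed (simp add: clinear_zero)
  ultimately have 1: "D2.ext E * D1.ext E = D1.ext E"
    by (intro multiplier_eqI_left[OF nd3]) simp
  let ?R = "cspan {u \<triangleleft> D1.ext (\<Delta> a) |a u. True}"
  have "t \<triangleleft> D2.ext E \<in> ?R" for t
  proof -
    have T: "u \<triangleleft> id_tensor_coprod \<Delta> (T2 \<Delta> s) \<in> ?R" for s u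
    proof (induction s)
      case (add s t)
      then show ?case
        by (simp add: clinear_add[OF clinear_T(2)] clinear_add[OF clinear_id_coprod(1)]
            complex_vector.span_add)
    qed (auto simp: D2_T2 coassociative intro: complex_vector.span_base)
    have "(t \<triangleleft> (1 \<otimes>\<^sub>m E)) \<triangleleft> D2.ext E \<in> ?R"
    proof (rule clinear_image_span[OF clinear_ract D2.span_right])
      fix x assume "x \<in> {u \<triangleleft> id_tensor_coprod \<Delta> s |s u. True}"
      then obtain s u where x: "x = u \<triangleleft> id_tensor_coprod \<Delta> s" by blast
      obtain s' where "s \<triangleleft> E = T2 \<Delta> s'" by (rule E_eq_T2)
      with x have "x \<triangleleft> D2.ext E = u \<triangleleft> id_tensor_coprod \<Delta> (T2 \<Delta> s')"
        by (simp add: D2.ext_gamma flip: ract_simps(4))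
      then show "x \<triangleleft> D2.ext E \<in> ?R" using T by simp
    qed
    then show ?thesis by (simp add: D2.e_ext flip: ract_simps(4))
  qed
  moreover have "x \<triangleleft> D1.ext E = x" if "x \<in> ?R" for x
    using that
  proof (induction rule: complex_vector.span_induct_alt)
    case (step c x y)
    then show ?case
      by (auto simp: clinear_add[OF clinear_ract] clinear_scaleC[OF clinear_ract]
          E_coproduct simp flip: ract_simps(4) D1.extension(2))
  qed (simp add: clinear_zero[OF clinear_ract])
  ultimately have 2: "D2.ext E * D1.ext E = D2.ext E"
    by (intro multiplier_eqI_right[OF nd3]) simp
  show ?thesis using 1 2 by simp
qed

lemma emb_T2_left:
  "emb (tassoc (tmap (\<lambda>p. T2 \<Delta> (c \<otimes> p)) (\<lambda>x. x) t)) = (emb c \<otimes>\<^sub>m 1) * coprod_tensor_id \<Delta> t"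
proof -
  have l: "clinear (\<lambda>p. T2 \<Delta> (c \<otimes> p))" by (intro lin)
  show ?thesis
  proof (induction t)
    case (add s t)
    then show ?case
      by (simp add: clinear_add[OF clinear_tmap[OF l]] clinear_add[OF tassoc(1)]
          clinear_add[OF lin_eta(5)] clinear_add[OF clinear_id_coprod(2)] distrib_left)
  next
    case (tensor p q)
    have "(emb c \<otimes>\<^sub>m 1) * coprod_tensor_id \<Delta> (p \<otimes> q) = massoc (emb (T2 \<Delta> (c \<otimes> p)) \<otimes>\<^sub>m emb q)"
    proof -
      have "emb c \<otimes>\<^sub>m 1 = (massoc ((emb c \<otimes>\<^sub>m 1) \<otimes>\<^sub>m 1) :: 'a tensor3 multiplier)"
        unfolding massoc_mtensor mtensor_one ..
      then show ?thesis
        by (simp add: coprod_tensor_id_tensor mtensor_mult emb_T2 flip: massoc_mult)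
    qed
    then show ?case by (simp add: l massoc_emb flip: emb_tensor)
  qed
qed

lemma emb_T1_right:
  "emb (tmap (\<lambda>x. x) (\<lambda>q. T1 \<Delta> (q \<otimes> c)) t) = id_tensor_coprod \<Delta> t * (1 \<otimes>\<^sub>m 1 \<otimes>\<^sub>m emb c)"
proof -
  have l: "clinear (\<lambda>q. T1 \<Delta> (q \<otimes> c))" by (intro lin)
  show ?thesis
  proof (induction t)
    case (add s t)
    then show ?case
      by (simp add: clinear_add[OF clinear_tmap[OF clinear_id(2) l]]
          clinear_add[OF lin_eta(5)] clinear_add[OF clinear_id_coprod(1)] distrib_right)
  next
    case (tensor p q)
    show ?case by (simp add: l id_tensor_coprod_tensor mtensor_mult emb_T1 emb_tensor)
  qed
qed

lemma coassociative_T: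
  "tassoc (tmap (\<lambda>p. T2 \<Delta> (c \<otimes> p)) (\<lambda>x. x) (T1 \<Delta> (a \<otimes> b)))
    = tmap (\<lambda>x. x) (\<lambda>q. T1 \<Delta> (q \<otimes> b)) (T2 \<Delta> (c \<otimes> a))"
proof -
  have "emb (tassoc (tmap (\<lambda>p. T2 \<Delta> (c \<otimes> p)) (\<lambda>x. x) (T1 \<Delta> (a \<otimes> b))))
    = emb (tmap (\<lambda>x. x) (\<lambda>q. T1 \<Delta> (q \<otimes> b)) (T2 \<Delta> (c \<otimes> a)))"
    unfolding emb_T2_left emb_T1_right D1_T1 D2_T2 coassociative by (simp add: mult.assoc)
  then show ?thesis by (simp only: emb3_inject)
qed

lemma E_mid_left: "(1 \<otimes>\<^sub>m E) \<triangleright> tassoc (t \<otimes> b) = tmap (\<lambda>x. x) (\<lambda>q. E \<triangleright> (q \<otimes> b)) t"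
proof -
  have l: "clinear (\<lambda>q. E \<triangleright> (q \<otimes> b))" by (intro lin)
  show ?thesis
    by (induction t) (simp_all add: l tensor_add_left clinear_add[OF tassoc(1)]
        clinear_add[OF clinear_lact] clinear_add[OF clinear_tmap[OF clinear_id(2) l]])
qed

lemma E_mid_right: "tassoc (t \<otimes> b) \<triangleleft> (1 \<otimes>\<^sub>m E) = tmap (\<lambda>x. x) (\<lambda>q. (q \<otimes> b) \<triangleleft> E) t"
proof -
  have l: "clinear (\<lambda>q. (q \<otimes> b) \<triangleleft> E)" by (intro lin)
  show ?thesis
    by (induction t) (simp_all add: l tensor_add_left clinear_add[OF tassoc(1)]
        clinear_add[OF clinear_ract] clinear_add[OF clinear_tmap[OF clinear_id(2) l]])
qed

lemma massoc_E_left: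
  "massoc (E \<otimes>\<^sub>m 1) \<triangleright> (a \<otimes> t) = tassoc (tmap (\<lambda>p. E \<triangleright> (a \<otimes> p)) (\<lambda>x. x) t)"
proof -
  have l: "clinear (\<lambda>p. E \<triangleright> (a \<otimes> p))" by (intro lin)
  show ?thesis
  proof (induction t)
    case (tensor p q)
    have "massoc (E \<otimes>\<^sub>m 1) \<triangleright> tassoc ((a \<otimes> p) \<otimes> q) = tassoc ((E \<triangleright> (a \<otimes> p)) \<otimes> q)"
      unfolding massoc_act by simp
    then show ?case by (simp add: l)
  qed (simp add: tensor_add_right clinear_add[OF tassoc(1)]
        clinear_add[OF clinear_lact] clinear_add[OF clinear_tmap[OF l]])
qed

lemma massoc_E_right:
  "(a \<otimes> t) \<triangleleft> massoc (E \<otimes>\<^sub>m 1) = tassoc (tmap (\<lambda>p. (a \<otimes> p) \<triangleleft> E) (\<lambda>x. x) t)"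
proof -
  have l: "clinear (\<lambda>p. (a \<otimes> p) \<triangleleft> E)" by (intro lin)
  show ?thesis
  proof (induction t)
    case (tensor p q)
    have "tassoc ((a \<otimes> p) \<otimes> q) \<triangleleft> massoc (E \<otimes>\<^sub>m 1) = tassoc (((a \<otimes> p) \<triangleleft> E) \<otimes> q)"
      unfolding massoc_act by simp
    then show ?case by (simp add: l)
  qed (simp add: tensor_add_right clinear_add[OF tassoc(1)]
        clinear_add[OF clinear_ract] clinear_add[OF clinear_tmap[OF l]])
qed

lemma coprod_id_pure:
  "(emb c \<otimes>\<^sub>m 1) * coprod_tensor_id \<Delta> (a \<otimes> b) = emb (tassoc (T2 \<Delta> (c \<otimes> a) \<otimes> b))"
  using emb_T2_left[of c "a \<otimes> b"] by (simp add: lin)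

lemma id_coprod_pure:
  "id_tensor_coprod \<Delta> (a \<otimes> b) * (1 \<otimes>\<^sub>m 1 \<otimes>\<^sub>m emb c) = emb (a \<otimes> T1 \<Delta> (b \<otimes> c))"
  using emb_T1_right[of c "a \<otimes> b"] by (simp add: lin)

text \<open>
  In Sweedler notation \<open>c(E\<^sub>1a)\<^sub>1 \<otimes> (E\<^sub>1a)\<^sub>2 \<otimes> E\<^sub>2b = ca\<^sub>1 \<otimes> E(a\<^sub>2 \<otimes> b)\<close>.  This formula and its three mirror
  images are coverings of \<open>(\<Delta> \<otimes> id)E = (1 \<otimes> E)(E \<otimes> 1) = (id \<otimes> \<Delta>)E\<close>.
\<close>

lemma coproduct_E_left:
  "tassoc (tmap (\<lambda>p. T2 \<Delta> (c \<otimes> p)) (\<lambda>x. x) (E \<triangleright> (a \<otimes> b)))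
    = tmap (\<lambda>x. x) (\<lambda>q. E \<triangleright> (q \<otimes> b)) (T2 \<Delta> (c \<otimes> a))"
proof -
  have "emb (tassoc (tmap (\<lambda>p. T2 \<Delta> (c \<otimes> p)) (\<lambda>x. x) (E \<triangleright> (a \<otimes> b))))
      = (emb c \<otimes>\<^sub>m 1) * (D1.ext E * coprod_tensor_id \<Delta> (a \<otimes> b))"
    by (simp add: emb_T2_left D1.ext_gamma)
  also have "\<dots> = (emb c \<otimes>\<^sub>m 1) * ((1 \<otimes>\<^sub>m E) * coprod_tensor_id \<Delta> (a \<otimes> b))"
    by (simp add: D1_E D2_E(2) mult.assoc D1.e_gamma)
  also have "\<dots> = (1 \<otimes>\<^sub>m E) * ((emb c \<otimes>\<^sub>m 1) * coprod_tensor_id \<Delta> (a \<otimes> b))"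
    by (simp add: mtensor_mult flip: mult.assoc)
  finally show ?thesis
    by (simp add: coprod_id_pure emb_simps E_mid_left emb3_inject)
qed

lemma coproduct_E_left':
  "tassoc (tmap (\<lambda>p. T2 \<Delta> (c \<otimes> p)) (\<lambda>x. x) ((a \<otimes> b) \<triangleleft> E))
    = tmap (\<lambda>x. x) (\<lambda>q. (q \<otimes> b) \<triangleleft> E) (T2 \<Delta> (c \<otimes> a))"
proof -
  have "emb (tassoc (tmap (\<lambda>p. T2 \<Delta> (c \<otimes> p)) (\<lambda>x. x) ((a \<otimes> b) \<triangleleft> E)))
      = (emb c \<otimes>\<^sub>m 1) * (coprod_tensor_id \<Delta> (a \<otimes> b) * D1.ext E)"
    by (simp add: emb_T2_left D1.ext_gamma)
  also have "\<dots> = (emb c \<otimes>\<^sub>m 1) * coprod_tensor_id \<Delta> (a \<otimes> b) * (1 \<otimes>\<^sub>m E)"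
    by (simp add: D1_E D2_E(1) D1.gamma_e flip: mult.assoc)
  finally show ?thesis
    by (simp add: coprod_id_pure emb_simps E_mid_right emb3_inject)
qed

lemma coproduct_E_right:
  "tmap (\<lambda>x. x) (\<lambda>q. T1 \<Delta> (q \<otimes> c)) (E \<triangleright> (a \<otimes> b))
    = tassoc (tmap (\<lambda>p. E \<triangleright> (a \<otimes> p)) (\<lambda>x. x) (T1 \<Delta> (b \<otimes> c)))"
proof -
  have "emb (tmap (\<lambda>x. x) (\<lambda>q. T1 \<Delta> (q \<otimes> c)) (E \<triangleright> (a \<otimes> b)))
      = D2.ext E * id_tensor_coprod \<Delta> (a \<otimes> b) * (1 \<otimes>\<^sub>m 1 \<otimes>\<^sub>m emb c)"
    by (simp add: emb_T1_right D2.ext_gamma)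
  also have "\<dots> = massoc (E \<otimes>\<^sub>m 1) * (id_tensor_coprod \<Delta> (a \<otimes> b) * (1 \<otimes>\<^sub>m 1 \<otimes>\<^sub>m emb c))"
    unfolding D2_E(1) mult.assoc[of _ "1 \<otimes>\<^sub>m E"] D2.e_gamma by (simp add: mult.assoc)
  finally show ?thesis
    by (simp add: id_coprod_pure emb_simps massoc_E_left emb3_inject)
qed

lemma coproduct_E_right':
  "tmap (\<lambda>x. x) (\<lambda>q. T1 \<Delta> (q \<otimes> c)) ((a \<otimes> b) \<triangleleft> E)
    = tassoc (tmap (\<lambda>p. (a \<otimes> p) \<triangleleft> E) (\<lambda>x. x) (T1 \<Delta> (b \<otimes> c)))"
proof -
  have *: "massoc (E \<otimes>\<^sub>m 1) * (1 \<otimes>\<^sub>m 1 \<otimes>\<^sub>m emb c) = (1 \<otimes>\<^sub>m 1 \<otimes>\<^sub>m emb c) * massoc (E \<otimes>\<^sub>m 1)"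
    by (simp add: mtensor_mult flip: massoc_one_right massoc_mult)
  have "emb (tmap (\<lambda>x. x) (\<lambda>q. T1 \<Delta> (q \<otimes> c)) ((a \<otimes> b) \<triangleleft> E))
      = id_tensor_coprod \<Delta> (a \<otimes> b) * D2.ext E * (1 \<otimes>\<^sub>m 1 \<otimes>\<^sub>m emb c)"
    by (simp add: emb_T1_right D2.ext_gamma)
  also have "\<dots> = (id_tensor_coprod \<Delta> (a \<otimes> b) * (1 \<otimes>\<^sub>m 1 \<otimes>\<^sub>m emb c)) * massoc (E \<otimes>\<^sub>m 1)"
    unfolding D2_E(2) mult.assoc[symmetric] D2.gamma_e by (simp add: mult.assoc *)
  finally show ?thesis
    by (simp add: id_coprod_pure emb_simps massoc_E_right emb3_inject)
qed

section \<open>Generalized inverses of the canonical maps and regularity\<close>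

lemma lin_G [lin]: "clinear k \<Longrightarrow> clinear (\<lambda>x. G1 (k x))" "clinear k' \<Longrightarrow> clinear (\<lambda>x. G2 (k' x))"
  using G1 G2 clinear_compose unfolding is_G1_def is_G2_def by blast+

lemma T1_G1: "T1 \<Delta> (G1 t) = T1 \<Delta> t"
proof -
  have "t - G1 t \<in> {t. T1 \<Delta> t = 0}" unfolding kernel_T1 by blast
  then show ?thesis by (simp add: clinear_diff[OF clinear_T(1)])
qed

lemma T2_G2: "T2 \<Delta> (G2 t) = T2 \<Delta> t"
proof -
  have "t - G2 t \<in> {t. T2 \<Delta> t = 0}" unfolding kernel_T2 by blast
  then show ?thesis by (simp add: clinear_diff[OF clinear_T(2)])
qed

lemma counit_T1: "clinear \<epsilon>" "sl_l \<epsilon> (T1 \<Delta> t) = tlift (*) t"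
proof -
  show e: "clinear \<epsilon>" using counit unfolding counit_def by blast
  show "sl_l \<epsilon> (T1 \<Delta> t) = tlift (*) t"
    by (rule clinear_eqI_tensor[of "\<lambda>t. sl_l \<epsilon> (T1 \<Delta> t)"])
       (intro lin e | use counit in \<open>simp add: counit_def sl_l_def lin tlift_tensor\<close>)+
qed

lemma counit_T2: "sl_r \<epsilon> (T2 \<Delta> t) = tlift (*) t"
  by (rule clinear_eqI_tensor[of "\<lambda>t. sl_r \<epsilon> (T2 \<Delta> t)"])
     (intro lin counit_T1(1) | use counit in \<open>simp add: counit_def sl_r_def lin tlift_tensor\<close>)+

lemma T1_T2: "tmap ((*) x) (\<lambda>x. x) (T1 \<Delta> (b \<otimes> d)) = tmap (\<lambda>x. x) (\<lambda>q. q * d) (T2 \<Delta> (x \<otimes> b))"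
proof -
  have "emb ((emb x \<otimes>\<^sub>m 1) \<triangleright> T1 \<Delta> (b \<otimes> d)) = emb (T2 \<Delta> (x \<otimes> b) \<triangleleft> (1 \<otimes>\<^sub>m emb d))"
    by (simp add: emb_T1 emb_T2 mult.assoc flip: emb_simps)
  then show ?thesis by (simp only: emb2_inject mtensor_emb_act)
qed

end

context regular_weak_multiplier_hopf_algebra
begin

definition s :: "'a \<Rightarrow> 'a" where "s a = unemb (S a)"

abbreviation si :: "'a \<Rightarrow> 'a" where "si \<equiv> inv_antipode S"

lemma S_eq: "S a = emb (s a)"
proof -
  have "S a \<in> range emb" using bij_antipode by (auto simp: bij_betw_def)
  then show ?thesis unfolding s_def using unemb_emb[OF nd] by auto
qed

lemma s_si [simp]: "s (si a) = a" "si (s a) = a"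
proof -
  have "S (si a) = emb a"
    unfolding inv_antipode_def using bij_antipode
    by (intro f_inv_into_f) (auto simp: bij_betw_def)
  then show "s (si a) = a" unfolding s_def by (simp add: unemb_emb[OF nd])
  show "si (s a) = a"
    unfolding inv_antipode_def S_eq[symmetric] using bij_antipode by (simp add: bij_betw_def)
qed

lemma s_mult: "s (a * b) = s b * s a"
proof -
  have "S (a * b) = S b * S a" using antipode unfolding antipode_def by blast
  then have "emb (s (a * b)) = emb (s b * s a)" by (simp add: S_eq emb_simps(1))
  then show ?thesis by (simp only: emb_inject)
qed

lemma s_linear: "clinear s"
proof -
  have "clinear S" using antipode unfolding antipode_def by blast
  then show ?thesis
    unfolding s_def by (rule lin_unemb[OF nd]) (simp add: S_eq)
qed

lemma si_linear: "clinear si"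
proof -
  have "si (a + b) = si a + si b" "si (c *\<^sub>C a) = c *\<^sub>C si a" for a b c
    by (metis s_si clinear_add[OF s_linear]) (metis s_si clinear_scaleC[OF s_linear])
  then show ?thesis by (simp add: clinear_iff)
qed

lemma si_mult: "si (a * b) = si b * si a"
  by (metis s_si s_mult)

lemma lin_s [lin]: "clinear k \<Longrightarrow> clinear (\<lambda>x. s (k x))" "clinear k' \<Longrightarrow> clinear (\<lambda>x. si (k' x))"
  by (rule clinear_compose[OF _ s_linear] clinear_compose[OF _ si_linear]; assumption)+

lemma antipode_E_left: "(c \<otimes> d) * (E \<triangleright> (a \<otimes> b))
    = tmap (\<lambda>x. x) (\<lambda>q. tlift (\<lambda>u v. u * (s v * b)) (T2 \<Delta> (d \<otimes> q))) (T2 \<Delta> (c \<otimes> a))"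
  using antipode[unfolded antipode_def, THEN conjunct2, THEN conjunct2, THEN conjunct2, THEN conjunct2, THEN conjunct1]
  by (simp add: S_eq id_def lact_fun)

lemma antipode_E_right: "((a \<otimes> b) \<triangleleft> E) * (c \<otimes> d)
    = tmap (\<lambda>p. tlift (\<lambda>u v. a * s u * v) (T1 \<Delta> (p \<otimes> c))) (\<lambda>x. x) (T1 \<Delta> (b \<otimes> d))"
  using antipode[unfolded antipode_def, THEN conjunct2, THEN conjunct2, THEN conjunct2, THEN conjunct2, THEN conjunct2, THEN conjunct1]
  by (simp add: S_eq id_def lact_fun)

lemma antipode_G1: "(emb c \<otimes>\<^sub>m 1) \<triangleright> G1 (a \<otimes> b)
    = tmap (\<lambda>x. x) (\<lambda>q. tlift (\<lambda>u v. s u * v) (T1 \<Delta> (q \<otimes> b))) (T2 \<Delta> (c \<otimes> a))"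
  using antipode[unfolded antipode_def, THEN conjunct2, THEN conjunct2, THEN conjunct2, THEN conjunct2, THEN conjunct2, THEN conjunct2, THEN conjunct1]
  by (simp add: S_eq id_def lact_fun)

lemma antipode_G2: "G2 (a \<otimes> b) \<triangleleft> (1 \<otimes>\<^sub>m emb c)
    = tmap (\<lambda>p. tlift (\<lambda>u v. u * s v) (T2 \<Delta> (a \<otimes> p))) (\<lambda>x. x) (T1 \<Delta> (b \<otimes> c))"
  using antipode[unfolded antipode_def, THEN conjunct2, THEN conjunct2, THEN conjunct2, THEN conjunct2, THEN conjunct2, THEN conjunct2, THEN conjunct2, THEN conjunct1]
  by (simp add: S_eq id_def lact_fun)

lemma antipode_E: "tlift (\<lambda>p q. s p * q) (E \<triangleright> (a \<otimes> b)) = s a * b"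
  using antipode[unfolded antipode_def, THEN conjunct2, THEN conjunct2, THEN conjunct2, THEN conjunct2, THEN conjunct2, THEN conjunct2, THEN conjunct2, THEN conjunct2]
  by (simp add: S_eq lact_fun)

lemma cb_s: "cbilinear (\<lambda>v q. s v * q)" "cbilinear (\<lambda>u v. u * s v)"
  by (intro lin)+

lemma G1_T1: "(emb c \<otimes>\<^sub>m 1) \<triangleright> G1 t
  = tmap (\<lambda>x. x) (tlift (\<lambda>v q. s v * q)) (tassoc (tmap (\<lambda>p. T2 \<Delta> (c \<otimes> p)) (\<lambda>x. x) (T1 \<Delta> t)))"
proof (rule clinear_eqI_tensor[of "\<lambda>t. (emb c \<otimes>\<^sub>m 1) \<triangleright> G1 t"])
  fix a b
  show "(emb c \<otimes>\<^sub>m 1) \<triangleright> G1 (a \<otimes> b) = tmap (\<lambda>x. x) (tlift (\<lambda>v q. s v * q))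
      (tassoc (tmap (\<lambda>p. T2 \<Delta> (c \<otimes> p)) (\<lambda>x. x) (T1 \<Delta> (a \<otimes> b))))"
    unfolding antipode_G1 coassociative_T
    by (rule tmap_tmap[symmetric]) (intro lin)+
qed (intro lin)+

text \<open>
  \<open>R\<^sub>1(a \<otimes> b) = \<Sum> a\<^sub>1 \<otimes> S(a\<^sub>2)b\<close> needs no covering.  For \<open>E(a \<otimes> b) = T\<^sub>1(w)\<close> it equals \<open>G\<^sub>1(w)\<close>, because
  \<open>G\<^sub>1(w)\<close> arises from \<open>T\<^sub>1(w) = \<Sum> a\<^sub>1 \<otimes> a\<^sub>2S(a\<^sub>3)b\<close> by \<open>u \<otimes> v \<mapsto> \<Sum> u\<^sub>1 \<otimes> S(u\<^sub>2)v\<close>.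
\<close>

lemma R1_exists:
  "\<exists>r. T1 \<Delta> r = E \<triangleright> (a \<otimes> b)
    \<and> (\<forall>c. (emb c \<otimes>\<^sub>m 1) \<triangleright> r = tmap (\<lambda>x. x) (\<lambda>q. s q * b) (T2 \<Delta> (c \<otimes> a)))"
proof -
  obtain w where w: "E \<triangleright> (a \<otimes> b) = T1 \<Delta> w" by (rule E_eq_T1)
  have "(emb c \<otimes>\<^sub>m 1) \<triangleright> G1 w = tmap (\<lambda>x. x) (\<lambda>q. s q * b) (T2 \<Delta> (c \<otimes> a))" for c
    unfolding G1_T1 w[symmetric] coproduct_E_left
    by (subst tmap_tmap) (intro lin | simp add: antipode_E)+
  then show ?thesis using T1_G1 w by metis
qed

definition R1 :: "'a \<Rightarrow> 'a \<Rightarrow> 'a tensor2" where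
  "R1 a b = (SOME r. T1 \<Delta> r = E \<triangleright> (a \<otimes> b)
    \<and> (\<forall>c. (emb c \<otimes>\<^sub>m 1) \<triangleright> r = tmap (\<lambda>x. x) (\<lambda>q. s q * b) (T2 \<Delta> (c \<otimes> a))))"

lemma R1: "T1 \<Delta> (R1 a b) = E \<triangleright> (a \<otimes> b)"
  "tmap ((*) c) (\<lambda>x. x) (R1 a b) = tmap (\<lambda>x. x) (\<lambda>q. s q * b) (T2 \<Delta> (c \<otimes> a))"
  using someI_ex[OF R1_exists[of a b]] unfolding R1_def[symmetric] by (simp_all add: mtensor_emb_act)

text \<open>
  \<open>\<Sum> E\<^sub>1 S(E\<^sub>2) = 1\<close>, the counterpart of \<open>\<Sum> S(E\<^sub>1) E\<^sub>2 = 1\<close>.  Both express that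
  \<open>\<Sum> S(b\<^sub>1) b\<^sub>2 S(b\<^sub>3) = S(b)\<close>, with the brackets set in the two possible ways.  Associativity is not
  immediate, since the brackets have to be covered differently: \<open>(a \<otimes> b)E = \<Sum> aS(b\<^sub>1)b\<^sub>2 \<otimes> b\<^sub>3\<close> covers the
  first two factors and \<open>R\<^sub>1(b \<otimes> c) = \<Sum> b\<^sub>1 \<otimes> S(b\<^sub>2)c\<close> the last one.
\<close>

lemma antipode_E': "tlift (\<lambda>p q. p * s q) ((a \<otimes> b) \<triangleleft> E) = a * s b"
proof (rule nondegenerateD(1)[OF nd])
  fix c
  let ?x = "(a \<otimes> b) \<triangleleft> E"
  let ?B = "\<lambda>r y. tlift (\<lambda>u v. a * s u * v) (T1 \<Delta> (r \<otimes> y))"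
  have cb: "cbilinear ?B" "cbilinear (\<lambda>u v. a * s u * v)" by (intro lin)+
  have R: "tmap (\<lambda>x. x) ((*) (s d)) (R1 b c) = tmap (\<lambda>x. x) (\<lambda>q. s q * c) (T1 \<Delta> (b \<otimes> d))" for d
  proof (rule tensor_strip_left[where L = "(*)"])
    fix x
    have "tmap ((*) x) (\<lambda>x. x) (tmap (\<lambda>x. x) ((*) (s d)) (R1 b c))
        = tmap (\<lambda>x. x) ((*) (s d)) (tmap ((*) x) (\<lambda>x. x) (R1 b c))"
      by (simp add: tmap_tmap)
    also have "\<dots> = tmap (\<lambda>x. x) (\<lambda>q. s q * c) (tmap (\<lambda>x. x) (\<lambda>q. q * d) (T2 \<Delta> (x \<otimes> b)))"
      unfolding R1(2) by (simp add: tmap_tmap lin s_mult mult.assoc)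
    also have "\<dots> = tmap ((*) x) (\<lambda>x. x) (tmap (\<lambda>x. x) (\<lambda>q. s q * c) (T1 \<Delta> (b \<otimes> d)))"
      unfolding T1_T2[symmetric] by (simp add: tmap_tmap lin)
    finally show "tmap ((*) x) (\<lambda>x. x) (tmap (\<lambda>x. x) ((*) (s d)) (R1 b c)) =
        tmap ((*) x) (\<lambda>x. x) (tmap (\<lambda>x. x) (\<lambda>q. s q * c) (T1 \<Delta> (b \<otimes> d)))" .
  qed (simp, rule nondegenerateD(2)[OF nd], assumption)
  \<comment> \<open>Both sides are \<open>\<Sum> aS(b\<^sub>1)b\<^sub>2 y \<otimes> S(b\<^sub>3)c\<close> with the second leg put in the place of \<open>y\<close>.\<close>
  have "tlift (*) (tmap (\<lambda>x. x) (\<lambda>q. s q * c) ?x) = tlift ?B (R1 b c)"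
  proof (rule tlift_diagonal)
    fix y
    show "tmap (\<lambda>x. x * y) (\<lambda>x. x) (tmap (\<lambda>x. x) (\<lambda>q. s q * c) ?x)
        = tmap (\<lambda>r. ?B r y) (\<lambda>x. x) (R1 b c)"
    proof (rule tensor_strip_right[where L = "\<lambda>d x. s d * x"])
      fix d
      have "tmap (\<lambda>x. x) (\<lambda>x. s d * x) (tmap (\<lambda>x. x * y) (\<lambda>x. x) (tmap (\<lambda>x. x) (\<lambda>q. s q * c) ?x))
          = tmap (\<lambda>x. x) (\<lambda>q. s q * c) (?x * (y \<otimes> d))"
        unfolding tensor_times_pure
        by (simp add: tmap_tmap lin s_mult mult.assoc)
      also have "\<dots> = tmap (\<lambda>r. ?B r y) (\<lambda>x. x) (tmap (\<lambda>x. x) ((*) (s d)) (R1 b c))"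
        unfolding R antipode_E_right by (simp add: tmap_tmap lin)
      also have "\<dots> = tmap (\<lambda>x. x) (\<lambda>x. s d * x) (tmap (\<lambda>r. ?B r y) (\<lambda>x. x) (R1 b c))"
        by (simp add: tmap_tmap lin)
      finally show "tmap (\<lambda>x. x) (\<lambda>x. s d * x) (tmap (\<lambda>x. x * y) (\<lambda>x. x) (tmap (\<lambda>x. x) (\<lambda>q. s q * c) ?x))
        = tmap (\<lambda>x. x) (\<lambda>x. s d * x) (tmap (\<lambda>r. ?B r y) (\<lambda>x. x) (R1 b c))" .
    next
      show "x = z" if "\<And>d. s d * x = s d * z" for x z
      proof (rule nondegenerateD(2)[OF nd])
        show "d * x = d * z" for d using that[of "si d"] by simp
      qed
    qed simp
  qed (intro lin)+
  also have "tlift ?B (R1 b c) = tlift (\<lambda>u v. a * s u * v) (T1 \<Delta> (R1 b c))"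
    by (rule clinear_eqI_tensor[of "tlift ?B"])
       (intro lin clinear_tlift cb | simp add: tlift_tensor[OF cb(1)])+
  also have "\<dots> = a * tlift (\<lambda>p q. s p * q) (E \<triangleright> (b \<otimes> c))"
    unfolding R1(1) by (subst clinear_out_tlift[of "(*) a"], (intro lin)+, rule tlift_cong_bilinear)
      (simp only: mult.assoc)
  also have "tlift (*) (tmap (\<lambda>x. x) (\<lambda>q. s q * c) ?x) = tlift (\<lambda>p q. p * s q) ?x * c"
    by (subst tlift_tmap, (intro lin)+, subst clinear_out_tlift[of "\<lambda>x. x * c"])
       (intro lin | simp add: mult.assoc)+
  finally show "tlift (\<lambda>p q. p * s q) ?x * c = a * s b * c"
    by (simp add: antipode_E mult.assoc)
qed

lemma s_cancel: "(\<And>d. x * s d = z * s d) \<Longrightarrow> x = z"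
  by (metis nondegenerateD(1)[OF nd] s_si(1))

lemma G2_T2: "G2 t \<triangleleft> (1 \<otimes>\<^sub>m emb c)
  = tmap (tlift (\<lambda>u v. u * s v)) (\<lambda>x. x) (tunassoc (tmap (\<lambda>x. x) (\<lambda>q. T1 \<Delta> (q \<otimes> c)) (T2 \<Delta> t)))"
proof (rule clinear_eqI_tensor[of "\<lambda>t. G2 t \<triangleleft> (1 \<otimes>\<^sub>m emb c)"])
  fix a b
  have "tmap (tlift (\<lambda>u v. u * s v)) (\<lambda>x. x) (tmap (\<lambda>p. T2 \<Delta> (a \<otimes> p)) (\<lambda>x. x) (T1 \<Delta> (b \<otimes> c)))
    = tmap (\<lambda>p. tlift (\<lambda>u v. u * s v) (T2 \<Delta> (a \<otimes> p))) (\<lambda>x. x) (T1 \<Delta> (b \<otimes> c))"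
    by (rule tmap_tmap) (intro lin)+
  then show "G2 (a \<otimes> b) \<triangleleft> (1 \<otimes>\<^sub>m emb c) = tmap (tlift (\<lambda>u v. u * s v)) (\<lambda>x. x)
      (tunassoc (tmap (\<lambda>x. x) (\<lambda>q. T1 \<Delta> (q \<otimes> c)) (T2 \<Delta> (a \<otimes> b))))"
    unfolding antipode_G2 coassociative_T[symmetric] tunassoc_tassoc ..
qed (intro lin)+

lemma R2_exists:
  "\<exists>r. T2 \<Delta> r = (a \<otimes> b) \<triangleleft> E
    \<and> (\<forall>c. r \<triangleleft> (1 \<otimes>\<^sub>m emb c) = tmap (\<lambda>p. a * s p) (\<lambda>x. x) (T1 \<Delta> (b \<otimes> c)))"
proof -
  obtain w where w: "(a \<otimes> b) \<triangleleft> E = T2 \<Delta> w" by (rule E_eq_T2)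
  have "G2 w \<triangleleft> (1 \<otimes>\<^sub>m emb c) = tmap (\<lambda>p. a * s p) (\<lambda>x. x) (T1 \<Delta> (b \<otimes> c))" for c
    unfolding G2_T2 w[symmetric] coproduct_E_right' tunassoc_tassoc
    by (subst tmap_tmap) (intro lin | simp add: antipode_E')+
  then show ?thesis using T2_G2 w by metis
qed

definition R2 :: "'a \<Rightarrow> 'a \<Rightarrow> 'a tensor2" where
  "R2 a b = (SOME r. T2 \<Delta> r = (a \<otimes> b) \<triangleleft> E
    \<and> (\<forall>c. r \<triangleleft> (1 \<otimes>\<^sub>m emb c) = tmap (\<lambda>p. a * s p) (\<lambda>x. x) (T1 \<Delta> (b \<otimes> c))))"

lemma R2: "T2 \<Delta> (R2 a b) = (a \<otimes> b) \<triangleleft> E"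
  "tmap (\<lambda>x. x) (\<lambda>x. x * c) (R2 a b) = tmap (\<lambda>p. a * s p) (\<lambda>x. x) (T1 \<Delta> (b \<otimes> c))"
  using someI_ex[OF R2_exists[of a b]] unfolding R2_def[symmetric] by (simp_all add: mtensor_emb_act)

text \<open>
  Regularity: from \<open>S(a\<^sub>2)S(b) = S(ba\<^sub>2)\<close> it follows that \<open>(1 \<otimes> b)\<Delta>(a)\<close> is the image of
  \<open>R\<^sub>1(a \<otimes> S(b))\<close> under \<open>id \<otimes> S\<inverse>\<close>, and similarly for \<open>\<Delta>(a)(b \<otimes> 1)\<close>.
\<close>

definition T3 :: "'a \<Rightarrow> 'a \<Rightarrow> 'a tensor2"
  where "T3 a b = unemb (\<Delta> a * (emb b \<otimes>\<^sub>m 1))"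

definition T4 :: "'a \<Rightarrow> 'a \<Rightarrow> 'a tensor2"
  where "T4 b a = unemb ((1 \<otimes>\<^sub>m emb b) * \<Delta> a)"

lemma T4_R1: "emb (tmap (\<lambda>x. x) si (R1 a (s b))) = (1 \<otimes>\<^sub>m emb b) * \<Delta> a"
proof (rule strip(4))
  fix c
  have "(emb c \<otimes>\<^sub>m 1) \<triangleright> tmap (\<lambda>x. x) si (R1 a (s b)) = tmap (\<lambda>x. x) si (tmap ((*) c) (\<lambda>x. x) (R1 a (s b)))"
    by (simp add: mtensor_emb_act tmap_tmap lin si_linear)
  also have "\<dots> = (1 \<otimes>\<^sub>m emb b) \<triangleright> T2 \<Delta> (c \<otimes> a)"
    by (simp add: R1(2) mtensor_emb_act tmap_tmap lin si_linear si_mult)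
  finally show "(emb c \<otimes>\<^sub>m 1) * emb (tmap (\<lambda>x. x) si (R1 a (s b))) = (emb c \<otimes>\<^sub>m 1) * ((1 \<otimes>\<^sub>m emb b) * \<Delta> a)"
    by (simp add: emb_simps emb_T2 mtensor_mult flip: mult.assoc)
      (simp add: emb_T2 mtensor_mult flip: mult.assoc emb_simps)
qed

lemma T3_R2: "emb (tmap si (\<lambda>x. x) (R2 (s b) a)) = \<Delta> a * (emb b \<otimes>\<^sub>m 1)"
proof (rule strip(1))
  fix c
  have "tmap si (\<lambda>x. x) (R2 (s b) a) \<triangleleft> (1 \<otimes>\<^sub>m emb c) = tmap si (\<lambda>x. x) (tmap (\<lambda>x. x) (\<lambda>x. x * c) (R2 (s b) a))"
    by (simp add: mtensor_emb_act tmap_tmap lin si_linear)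
  also have "\<dots> = T1 \<Delta> (a \<otimes> c) \<triangleleft> (emb b \<otimes>\<^sub>m 1)"
    by (simp add: R2(2) mtensor_emb_act tmap_tmap lin si_linear si_mult)
  finally show "emb (tmap si (\<lambda>x. x) (R2 (s b) a)) * (1 \<otimes>\<^sub>m emb c) = \<Delta> a * (emb b \<otimes>\<^sub>m 1) * (1 \<otimes>\<^sub>m emb c)"
    by (simp add: emb_simps) (simp add: emb_T1 mtensor_mult mult.assoc flip: emb_simps)
qed

lemma emb_T3: "emb (T3 a b) = \<Delta> a * (emb b \<otimes>\<^sub>m 1)"
  unfolding T3_def T3_R2[symmetric] by (simp add: unemb_emb[OF nd2])

lemma emb_T4: "emb (T4 b a) = (1 \<otimes>\<^sub>m emb b) * \<Delta> a"
  unfolding T4_def T4_R1[symmetric] by (simp add: unemb_emb[OF nd2])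

lemma lin_T34 [lin]:
  "clinear k \<Longrightarrow> clinear (\<lambda>x. T3 (k x) b)" "clinear k \<Longrightarrow> clinear (\<lambda>x. T3 a (k x))"
  "clinear k \<Longrightarrow> clinear (\<lambda>x. T4 (k x) b)" "clinear k \<Longrightarrow> clinear (\<lambda>x. T4 a (k x))"
  unfolding T3_def T4_def
  by (rule lin_unemb[OF nd2], intro lin, assumption, simp flip: emb_T3 emb_T4)+

section \<open>The target and source maps\<close>

text \<open>
  \<open>\<epsilon>\<^sub>t(a) = \<Sum> a\<^sub>1 S(a\<^sub>2)\<close> and \<open>\<epsilon>\<^sub>s(a) = \<Sum> S(a\<^sub>1) a\<^sub>2\<close> can be covered by an element of \<open>A\<close> on one side only.  On
  the other side they are given by applying the counit to \<open>E(a \<otimes> b) = \<Sum> a\<^sub>1 \<otimes> \<epsilon>\<^sub>t(a\<^sub>2)b\<close>, respectively to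
  \<open>(c \<otimes> a)E = \<Sum> c\<epsilon>\<^sub>s(a\<^sub>1) \<otimes> a\<^sub>2\<close>.
\<close>

definition et :: "'a \<Rightarrow> 'a multiplier" where
  "et a = Multiplier (\<lambda>b. sl_l \<epsilon> (E \<triangleright> (a \<otimes> b))) (\<lambda>c. tlift (\<lambda>u v. u * s v) (T2 \<Delta> (c \<otimes> a)))"

definition es :: "'a \<Rightarrow> 'a multiplier" where
  "es a = Multiplier (\<lambda>b. tlift (\<lambda>u v. s u * v) (T1 \<Delta> (a \<otimes> b))) (\<lambda>c. sl_r \<epsilon> ((c \<otimes> a) \<triangleleft> E))"

lemma counit_E_R1: "sl_l \<epsilon> (E \<triangleright> (a \<otimes> b)) = tlift (*) (R1 a b)"
  by (simp add: counit_T1 flip: R1(1))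

lemma counit_E_R2: "sl_r \<epsilon> ((c \<otimes> a) \<triangleleft> E) = tlift (*) (R2 c a)"
  by (simp add: counit_T2 flip: R2(1))

lemma cb_times: "cbilinear ((*) :: 'a \<Rightarrow> 'a \<Rightarrow> 'a)"
  by (intro lin)

lemma et: "et a \<triangleright> b = sl_l \<epsilon> (E \<triangleright> (a \<otimes> b))" "c \<triangleleft> et a = tlift (\<lambda>u v. u * s v) (T2 \<Delta> (c \<otimes> a))"
proof -
  have "x * sl_l \<epsilon> (E \<triangleright> (a \<otimes> y)) = tlift (\<lambda>u v. u * s v) (T2 \<Delta> (x \<otimes> a)) * y" for x y
  proof -
    have "x * sl_l \<epsilon> (E \<triangleright> (a \<otimes> y)) = tlift (\<lambda>p q. x * (p * q)) (R1 a y)"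
      unfolding counit_E_R1 by (rule clinear_out_tlift) (intro lin)+
    also have "\<dots> = tlift (*) (tmap ((*) x) (\<lambda>x. x) (R1 a y))"
      by (subst tlift_tmap, (intro lin)+, rule tlift_cong_bilinear) (simp only: mult.assoc)
    also have "\<dots> = tlift (\<lambda>u v. u * s v * y) (T2 \<Delta> (x \<otimes> a))"
      unfolding R1(2) by (subst tlift_tmap) (intro lin | simp add: mult.assoc)+
    also have "\<dots> = tlift (\<lambda>u v. u * s v) (T2 \<Delta> (x \<otimes> a)) * y"
      by (rule clinear_out_tlift[symmetric]) (intro lin)+
    finally show ?thesis .
  qed
  moreover have "clinear (\<lambda>b. sl_l \<epsilon> (E \<triangleright> (a \<otimes> b)))" "clinear (\<lambda>c. tlift (\<lambda>u v. u * s v) (T2 \<Delta> (c \<otimes> a)))"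
    by (intro lin counit_T1)+
  ultimately show "et a \<triangleright> b = sl_l \<epsilon> (E \<triangleright> (a \<otimes> b))"
    "c \<triangleleft> et a = tlift (\<lambda>u v. u * s v) (T2 \<Delta> (c \<otimes> a))"
    unfolding et_def by (simp_all add: Multiplier_act[OF nd])
qed

lemma es: "es a \<triangleright> b = tlift (\<lambda>u v. s u * v) (T1 \<Delta> (a \<otimes> b))" "c \<triangleleft> es a = sl_r \<epsilon> ((c \<otimes> a) \<triangleleft> E)"
proof -
  have "x * tlift (\<lambda>u v. s u * v) (T1 \<Delta> (a \<otimes> y)) = sl_r \<epsilon> ((x \<otimes> a) \<triangleleft> E) * y" for x y
  proof -
    have "sl_r \<epsilon> ((x \<otimes> a) \<triangleleft> E) * y = tlift (\<lambda>p q. p * q * y) (R2 x a)"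
      unfolding counit_E_R2 by (rule clinear_out_tlift) (intro lin)+
    also have "\<dots> = tlift (*) (tmap (\<lambda>x. x) (\<lambda>x. x * y) (R2 x a))"
      by (subst tlift_tmap) (intro lin | simp add: mult.assoc)+
    also have "\<dots> = tlift (\<lambda>u v. x * (s u * v)) (T1 \<Delta> (a \<otimes> y))"
      unfolding R2(2) by (subst tlift_tmap, (intro lin)+, rule tlift_cong_bilinear) (simp only: mult.assoc)
    also have "\<dots> = x * tlift (\<lambda>u v. s u * v) (T1 \<Delta> (a \<otimes> y))"
      by (rule clinear_out_tlift[symmetric]) (intro lin)+
    finally show ?thesis by simp
  qed
  moreover have "clinear (\<lambda>b. tlift (\<lambda>u v. s u * v) (T1 \<Delta> (a \<otimes> b)))" "clinear (\<lambda>c. sl_r \<epsilon> ((c \<otimes> a) \<triangleleft> E))"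
    by (intro lin counit_T1)+
  ultimately show "es a \<triangleright> b = tlift (\<lambda>u v. s u * v) (T1 \<Delta> (a \<otimes> b))"
    "c \<triangleleft> es a = sl_r \<epsilon> ((c \<otimes> a) \<triangleleft> E)"
    unfolding es_def by (simp_all add: Multiplier_act[OF nd])
qed

lemma et_R1: "et a \<triangleright> b = tlift (*) (R1 a b)"
  by (simp add: et counit_E_R1)

lemma es_R2: "c \<triangleleft> es a = tlift (*) (R2 c a)"
  by (simp add: es counit_E_R2)

lemma lin_et [lin]: "clinear k \<Longrightarrow> clinear (\<lambda>x. et (k x))"
proof -
  have "et (x + y) = et x + et y" "et (r *\<^sub>C x) = r *\<^sub>C et x" for x y r
    by (rule multiplier_eqI_right[OF nd];
        simp add: et tensor_add_right tensor_scaleC_right clinear_add[OF clinear_T(2)]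
          clinear_scaleC[OF clinear_T(2)] clinear_add[OF clinear_tlift[OF cb_s(2)]]
          clinear_scaleC[OF clinear_tlift[OF cb_s(2)]])+
  then show "clinear k \<Longrightarrow> clinear (\<lambda>x. et (k x))" by (simp add: clinear_iff)
qed

lemma eps_t_eq: "eps_t \<Delta> S a = et a"
  unfolding eps_t_def
proof (rule the_equality)
  have *: "x * (et a \<triangleright> y) = tlift (\<lambda>p q. p * (S q \<triangleright> y)) (T2 \<Delta> (x \<otimes> a))" for x y
  proof -
    have "x * (et a \<triangleright> y) = tlift (\<lambda>u v. u * s v) (T2 \<Delta> (x \<otimes> a)) * y"
      unfolding times_lact et(2) ..
    also have "\<dots> = tlift (\<lambda>u v. u * s v * y) (T2 \<Delta> (x \<otimes> a))"
      by (rule clinear_out_tlift) (intro lin)+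
    finally show ?thesis by (simp add: S_eq mult.assoc)
  qed
  then show "\<forall>b c. c * (et a \<triangleright> b) = tlift (\<lambda>p q. p * (S q \<triangleright> b)) (T2 \<Delta> (c \<otimes> a))" by blast
  fix m
  assume m: "\<forall>b c. c * (m \<triangleright> b) = tlift (\<lambda>p q. p * (S q \<triangleright> b)) (T2 \<Delta> (c \<otimes> a))"
  show "m = et a"
    by (rule multiplier_eqI_left[OF nd], rule nondegenerateD(2)[OF nd]) (simp add: m *)
qed

lemma E_et: "tmap ((*) c) (\<lambda>x. x) (E \<triangleright> (a \<otimes> b)) = tmap (\<lambda>x. x) (\<lambda>q. et q \<triangleright> b) (T2 \<Delta> (c \<otimes> a))"
proof (rule tensor_strip_right[where L = "(*)"])
  fix d
  have e: "tlift (\<lambda>u v. u * (s v * b)) (T2 \<Delta> (d \<otimes> q)) = d * (et q \<triangleright> b)" for q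
  proof -
    have "d * (et q \<triangleright> b) = tlift (\<lambda>u v. u * s v * b) (T2 \<Delta> (d \<otimes> q))"
      unfolding times_lact et(2) by (rule clinear_out_tlift) (intro lin)+
    then show ?thesis by (simp add: mult.assoc)
  qed
  have "tmap (\<lambda>x. x) ((*) d) (tmap ((*) c) (\<lambda>x. x) (E \<triangleright> (a \<otimes> b))) = (c \<otimes> d) * (E \<triangleright> (a \<otimes> b))"
    by (simp add: tmap_tmap lin tensor_times)
  also have "\<dots> = tmap (\<lambda>x. x) ((*) d) (tmap (\<lambda>x. x) (\<lambda>q. et q \<triangleright> b) (T2 \<Delta> (c \<otimes> a)))"
    unfolding antipode_E_left e by (simp add: tmap_tmap lin)
  finally show "tmap (\<lambda>x. x) ((*) d) (tmap ((*) c) (\<lambda>x. x) (E \<triangleright> (a \<otimes> b))) =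
      tmap (\<lambda>x. x) ((*) d) (tmap (\<lambda>x. x) (\<lambda>q. et q \<triangleright> b) (T2 \<Delta> (c \<otimes> a)))" .
qed (simp, rule nondegenerateD(2)[OF nd], assumption)

lemma et_T1: "tlift (\<lambda>p q. et p \<triangleright> q) (T1 \<Delta> t) = tlift (*) t"
proof -
  have cb: "cbilinear (\<lambda>p q. et p \<triangleright> q)" by (intro lin)
  have "tlift (\<lambda>p q. et p \<triangleright> q) u = sl_l \<epsilon> (E \<triangleright> u)" for u
  proof (rule clinear_eqI_tensor[OF clinear_tlift[OF cb]])
    show "clinear (\<lambda>u. sl_l \<epsilon> (E \<triangleright> u))" by (intro lin counit_T1)
    show "tlift (\<lambda>p q. et p \<triangleright> q) (a \<otimes> b) = sl_l \<epsilon> (E \<triangleright> (a \<otimes> b))" for a b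
      unfolding tlift_tensor[OF cb] by (rule et(1))
  qed
  then show ?thesis by (simp add: E_T1 counit_T1)
qed

section \<open>The legs of the canonical idempotent\<close>

lemma A_t_iff: "z \<in> A_t \<Delta> E \<longleftrightarrow> (\<forall>b. \<Delta> (z \<triangleright> b) = (z \<otimes>\<^sub>m 1) * \<Delta> b)"
proof -
  have "Delta.ext z = (z \<otimes>\<^sub>m 1) * E" if "\<forall>b. \<Delta> (z \<triangleright> b) = (z \<otimes>\<^sub>m 1) * \<Delta> b"
    by (rule Delta.ext_eqI_right) (simp_all add: mult.assoc E_idempotent E_coproduct that)
  moreover have "\<Delta> (z \<triangleright> b) = (z \<otimes>\<^sub>m 1) * \<Delta> b" if "Delta.ext z = (z \<otimes>\<^sub>m 1) * E" for b
    using Delta.ext_gamma(1)[of z b] by (simp add: that mult.assoc E_coproduct)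
  ultimately show ?thesis unfolding A_t_def Delta.mult_ext_eq by blast
qed

lemma A_tD: "z \<in> A_t \<Delta> E \<Longrightarrow> \<Delta> (z \<triangleright> b) = (z \<otimes>\<^sub>m 1) * \<Delta> b"
  by (simp add: A_t_iff)

text \<open>
  The right leg of \<open>E\<close> lies in \<open>A\<^sub>t\<close> by \<open>(id \<otimes> \<Delta>)E = (E \<otimes> 1)(1 \<otimes> E)\<close>, and it commutes with the left leg
  because \<open>E \<otimes> 1\<close> and \<open>1 \<otimes> E\<close> commute.
\<close>

lemma slice_E:
  assumes f: "clinear f" and z: "\<And>d. z \<triangleright> d = sl_l f (E \<triangleright> (c \<otimes> d))"
  shows "z \<in> A_t \<Delta> E" and "(z \<otimes>\<^sub>m 1) * E = E * (z \<otimes>\<^sub>m 1)"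
proof -
  have g: "clinear (\<lambda>p. E \<triangleright> (c \<otimes> p))" by (intro lin)
  have zt: "(z \<otimes>\<^sub>m 1) \<triangleright> t = sl_l f (tassoc (tmap (\<lambda>p. E \<triangleright> (c \<otimes> p)) (\<lambda>x. x) t))" for t
    by (simp add: sl_l_tassoc_tmap[OF f g] mtensor_lact lact_fun z[symmetric])
  have "\<Delta> (z \<triangleright> d) = (z \<otimes>\<^sub>m 1) * \<Delta> d" for d
  proof (rule strip(1))
    fix y
    have "T1 \<Delta> ((z \<triangleright> d) \<otimes> y) = sl_l f (tmap (\<lambda>x. x) (\<lambda>q. T1 \<Delta> (q \<otimes> y)) (E \<triangleright> (c \<otimes> d)))"
      unfolding z by (subst sl_tmap(2)) (intro lin f | simp)+
    also have "\<dots> = (z \<otimes>\<^sub>m 1) \<triangleright> T1 \<Delta> (d \<otimes> y)"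
      unfolding coproduct_E_right zt ..
    finally have "emb (T1 \<Delta> ((z \<triangleright> d) \<otimes> y)) = emb ((z \<otimes>\<^sub>m 1) \<triangleright> T1 \<Delta> (d \<otimes> y))" by simp
    then show "\<Delta> (z \<triangleright> d) * (1 \<otimes>\<^sub>m emb y) = (z \<otimes>\<^sub>m 1) * \<Delta> d * (1 \<otimes>\<^sub>m emb y)"
      by (simp add: emb_T1 mult.assoc flip: emb_simps)
  qed
  then show "z \<in> A_t \<Delta> E" by (simp add: A_t_iff)
  show "(z \<otimes>\<^sub>m 1) * E = E * (z \<otimes>\<^sub>m 1)"
  proof (rule multiplier_eqI_left[OF nd2])
    have zt': "(z \<otimes>\<^sub>m 1) \<triangleright> t = sl_l f (massoc (E \<otimes>\<^sub>m 1) \<triangleright> (c \<otimes> t))" for t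
      by (simp add: zt massoc_E_left)
    fix t
    have "((z \<otimes>\<^sub>m 1) * E) \<triangleright> t = sl_l f ((massoc (E \<otimes>\<^sub>m 1) * (1 \<otimes>\<^sub>m E)) \<triangleright> (c \<otimes> t))"
      by (simp add: zt')
    also have "\<dots> = sl_l f ((1 \<otimes>\<^sub>m E) \<triangleright> (massoc (E \<otimes>\<^sub>m 1) \<triangleright> (c \<otimes> t)))"
      unfolding E_commute by simp
    also have "\<dots> = E \<triangleright> sl_l f (massoc (E \<otimes>\<^sub>m 1) \<triangleright> (c \<otimes> t))"
      by (simp add: mtensor_lact lact_fun sl_tmap(2) f)
    finally show "((z \<otimes>\<^sub>m 1) * E) \<triangleright> t = (E * (z \<otimes>\<^sub>m 1)) \<triangleright> t" by (simp add: zt')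
  qed
qed

lemma et_A_t: "et a \<in> A_t \<Delta> E" "(et a \<otimes>\<^sub>m 1) * E = E * (et a \<otimes>\<^sub>m 1)"
  by (rule slice_E[OF counit_T1(1) et(1)])+

lemma et_A_t_mult:
  assumes "z \<in> A_t \<Delta> E"
  shows "et (z \<triangleright> b) = z * et b"
proof (rule multiplier_eqI_right[OF nd])
  fix c
  have "emb (T2 \<Delta> (c \<otimes> (z \<triangleright> b))) = emb (T2 \<Delta> ((c \<triangleleft> z) \<otimes> b))"
    by (simp add: emb_T2 A_tD[OF assms] mtensor_mult emb_simps flip: mult.assoc)
  then have "T2 \<Delta> (c \<otimes> (z \<triangleright> b)) = T2 \<Delta> ((c \<triangleleft> z) \<otimes> b)" by (simp only: emb2_inject)
  then show "c \<triangleleft> et (z \<triangleright> b) = c \<triangleleft> (z * et b)" by (simp add: et)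
qed

text \<open>
  For \<open>\<epsilon>\<^sub>t(b)\<close> and \<open>\<epsilon>\<^sub>t(zb) = z\<epsilon>\<^sub>t(b)\<close> this is known, and \<open>\<epsilon>\<^sub>t(A)A\<close> spans \<open>A\<close> because
  \<open>\<Sum> \<epsilon>\<^sub>t(a\<^sub>1)a\<^sub>2 = a\<close>.
\<close>

lemma A_t_commute:
  assumes z: "z \<in> A_t \<Delta> E"
  shows "(z \<otimes>\<^sub>m 1) * E = E * (z \<otimes>\<^sub>m 1)"
proof (rule strip(2))
  fix a
  let ?m = "(z \<otimes>\<^sub>m 1) * E" and ?n = "E * (z \<otimes>\<^sub>m 1)"
  have *: "?m * (et b \<otimes>\<^sub>m 1) = ?n * (et b \<otimes>\<^sub>m 1)" for b
  proof -
    have "?m * (et b \<otimes>\<^sub>m 1) = (z \<otimes>\<^sub>m 1) * (E * (et b \<otimes>\<^sub>m 1))" by (simp only: mult.assoc)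
    also have "\<dots> = (z \<otimes>\<^sub>m 1) * (et b \<otimes>\<^sub>m 1) * E"
      by (simp only: mult.assoc et_A_t(2)[symmetric])
    also have "\<dots> = (et (z \<triangleright> b) \<otimes>\<^sub>m 1) * E"
      by (simp add: et_A_t_mult[OF z] mtensor_mult)
    also have "\<dots> = ?n * (et b \<otimes>\<^sub>m 1)"
      unfolding et_A_t(2) by (simp add: et_A_t_mult[OF z] mtensor_mult mult.assoc)
    finally show ?thesis .
  qed
  have cb: "cbilinear (\<lambda>p q. et p \<triangleright> q)" by (intro lin)
  have "?m \<triangleright> ((a * b) \<otimes> d) = ?n \<triangleright> ((a * b) \<otimes> d)" for b d
  proof -
    have "?m \<triangleright> ((et p \<triangleright> q) \<otimes> d) = ?n \<triangleright> ((et p \<triangleright> q) \<otimes> d)" for p q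
      using arg_cong[OF *[of p], of "\<lambda>k. k \<triangleright> (q \<otimes> d)"] by simp
    then have "?m \<triangleright> (tlift (\<lambda>p q. et p \<triangleright> q) t \<otimes> d) = ?n \<triangleright> (tlift (\<lambda>p q. et p \<triangleright> q) t \<otimes> d)" for t
    proof (induction t)
      case (add s t)
      then show ?case
        by (simp only: clinear_add[OF clinear_tlift[OF cb]] tensor_add_left clinear_add[OF clinear_lact])
    qed (simp only: tlift_tensor[OF cb])
    from this[of "T1 \<Delta> (a \<otimes> b)"] show ?thesis
      by (simp add: et_T1 tlift_tensor[OF cb_times])
  qed
  note pure = this
  show "?m * (emb a \<otimes>\<^sub>m 1) = ?n * (emb a \<otimes>\<^sub>m 1)"
  proof (rule multiplier_eqI_left[OF nd2])
    show "(?m * (emb a \<otimes>\<^sub>m 1)) \<triangleright> t = (?n * (emb a \<otimes>\<^sub>m 1)) \<triangleright> t" for t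
      by (rule clinear_eqI_tensor[OF clinear_lact clinear_lact]) (use pure in simp)
  qed
qed

lemma A_t_right:
  assumes z: "z \<in> A_t \<Delta> E"
  shows "\<Delta> (b \<triangleleft> z) = \<Delta> b * (z \<otimes>\<^sub>m 1)"
proof -
  have "Delta.ext z = E * (z \<otimes>\<^sub>m 1)"
    using z unfolding A_t_def Delta.mult_ext_eq by (simp add: A_t_commute[OF z])
  then show ?thesis
    using Delta.ext_gamma(2)[of b z] by (simp add: E_coproduct flip: mult.assoc)
qed

text \<open>
  The corresponding facts for the left leg, obtained by slicing the third factor with the counit
\<close>

lemma es_E: "(1 \<otimes>\<^sub>m es q) * E = E * (1 \<otimes>\<^sub>m es q)"
proof (rule multiplier_eqI_right[OF nd2], rule clinear_eqI_tensor[OF clinear_ract clinear_ract])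
  fix a b
  note e = counit_T1(1)
  have l: "clinear (sl_r \<epsilon>)" using lin_sl(1)[OF e clinear_id(2)] by simp
  have g: "clinear (\<lambda>p. (a \<otimes> p) \<triangleleft> E)" by (intro lin)
  have "tmap (\<lambda>x. x) (sl_r \<epsilon>) (tassoc (((a \<otimes> b) \<triangleleft> E) \<otimes> q) \<triangleleft> (1 \<otimes>\<^sub>m E))
      = ((a \<otimes> b) \<triangleleft> E) \<triangleleft> (1 \<otimes>\<^sub>m es q)"
    unfolding E_mid_right by (subst tmap_tmap) (intro lin l | simp add: mtensor_ract es)+
  moreover have "tmap (\<lambda>x. x) (sl_r \<epsilon>) ((a \<otimes> ((b \<otimes> q) \<triangleleft> E)) \<triangleleft> massoc (E \<otimes>\<^sub>m 1))
      = (a \<otimes> (b \<triangleleft> es q)) \<triangleleft> E"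
    unfolding massoc_E_right by (simp add: sl_r_tassoc_tmap[OF e g] es)
  moreover have "tassoc (((a \<otimes> b) \<triangleleft> E) \<otimes> q) \<triangleleft> (1 \<otimes>\<^sub>m E)
      = (a \<otimes> ((b \<otimes> q) \<triangleleft> E)) \<triangleleft> massoc (E \<otimes>\<^sub>m 1)"
  proof -
    have "tassoc (((a \<otimes> b) \<triangleleft> E) \<otimes> q) \<triangleleft> (1 \<otimes>\<^sub>m E)
        = (a \<otimes> (b \<otimes> q)) \<triangleleft> (massoc (E \<otimes>\<^sub>m 1) * (1 \<otimes>\<^sub>m E))"
      by (simp add: massoc_act flip: tassoc(2))
    then show ?thesis unfolding E_commute by simp
  qed
  ultimately show "(a \<otimes> b) \<triangleleft> ((1 \<otimes>\<^sub>m es q) * E) = (a \<otimes> b) \<triangleleft> (E * (1 \<otimes>\<^sub>m es q))"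
    by simp
qed

lemma coproduct_es_right: "\<Delta> (a \<triangleleft> es q) = \<Delta> a * (1 \<otimes>\<^sub>m es q)"
proof (rule strip(4))
  fix x
  note e = counit_T1(1)
  have l: "clinear (sl_r \<epsilon>)" using lin_sl(1)[OF e clinear_id(2)] by simp
  have g: "clinear (\<lambda>p. T2 \<Delta> (x \<otimes> p))" by (intro lin)
  have "T2 \<Delta> (x \<otimes> (a \<triangleleft> es q))
      = tmap (\<lambda>x. x) (sl_r \<epsilon>) (tassoc (tmap (\<lambda>p. T2 \<Delta> (x \<otimes> p)) (\<lambda>x. x) ((a \<otimes> q) \<triangleleft> E)))"
    by (simp add: sl_r_tassoc_tmap[OF e g] es)
  also have "\<dots> = T2 \<Delta> (x \<otimes> a) \<triangleleft> (1 \<otimes>\<^sub>m es q)"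
    unfolding coproduct_E_left' by (subst tmap_tmap) (intro lin l | simp add: mtensor_ract es)+
  finally have "emb (T2 \<Delta> (x \<otimes> (a \<triangleleft> es q))) = emb (T2 \<Delta> (x \<otimes> a) \<triangleleft> (1 \<otimes>\<^sub>m es q))" by simp
  then show "(emb x \<otimes>\<^sub>m 1) * \<Delta> (a \<triangleleft> es q) = (emb x \<otimes>\<^sub>m 1) * (\<Delta> a * (1 \<otimes>\<^sub>m es q))"
    by (simp add: emb_T2 mult.assoc flip: emb_simps)
qed

lemma coproduct_es_left: "\<Delta> (es q \<triangleright> b) = (1 \<otimes>\<^sub>m es q) * \<Delta> b"
proof -
  have "Delta.ext (es q) = E * (1 \<otimes>\<^sub>m es q)"
    by (rule Delta.ext_eqI)
       (simp_all add: E_idempotent E_coproduct coproduct_es_right flip: mult.assoc)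
  then show ?thesis
    using Delta.ext_gamma(1)[of "es q" b] by (simp add: mult.assoc E_coproduct flip: es_E)
qed

lemma T2_es: "T2 \<Delta> (c \<otimes> (es q \<triangleright> a)) = tmap (\<lambda>x. x) (\<lambda>v. es q \<triangleright> v) (T2 \<Delta> (c \<otimes> a))"
proof -
  have "emb (T2 \<Delta> (c \<otimes> (es q \<triangleright> a))) = emb ((1 \<otimes>\<^sub>m es q) \<triangleright> T2 \<Delta> (c \<otimes> a))"
    by (simp add: emb_T2 coproduct_es_left mtensor_mult flip: mult.assoc emb_simps)
  then show ?thesis by (simp only: emb2_inject mtensor_lact lact_fun)
qed

section \<open>The Casimir property\<close>

lemma tlift_s_coproduct: "tlift (\<lambda>u v. u * s v) (t \<triangleleft> \<Delta> b) = tlift (\<lambda>u v. (u \<triangleleft> et b) * s v) t"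
proof -
  have cb: "cbilinear (\<lambda>u v. (u \<triangleleft> et b) * s v)" by (intro lin)
  show ?thesis
  proof (rule clinear_eqI_tensor[OF _ clinear_tlift[OF cb]])
    show "clinear (\<lambda>t. tlift (\<lambda>u v. u * s v) (t \<triangleleft> \<Delta> b))" by (intro lin)
    fix u v
    have "emb ((u \<otimes> v) \<triangleleft> \<Delta> b) = emb (tmap (\<lambda>x. x) ((*) v) (T2 \<Delta> (u \<otimes> b)))"
      unfolding emb_tmap emb_T2 emb_simps(3)[symmetric] emb_tensor mult.assoc[symmetric] mtensor_mult
      by simp
    then have "(u \<otimes> v) \<triangleleft> \<Delta> b = tmap (\<lambda>x. x) ((*) v) (T2 \<Delta> (u \<otimes> b))"
      by (simp only: emb2_inject)
    then have "tlift (\<lambda>u v. u * s v) ((u \<otimes> v) \<triangleleft> \<Delta> b) = tlift (\<lambda>u' v'. u' * s v' * s v) (T2 \<Delta> (u \<otimes> b))"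
      by (simp add: tlift_tmap[OF cb_s(2)] s_mult mult.assoc)
    also have "\<dots> = (u \<triangleleft> et b) * s v"
      unfolding et(2) by (rule clinear_out_tlift[symmetric]) (intro lin)+
    finally show "tlift (\<lambda>u v. u * s v) ((u \<otimes> v) \<triangleleft> \<Delta> b) = tlift (\<lambda>u v. (u \<triangleleft> et b) * s v) (u \<otimes> v)"
      by (simp add: tlift_tensor[OF cb])
  qed
qed

lemma et_mult: "c \<triangleleft> et (a * b) = tlift (\<lambda>u v. (u \<triangleleft> et b) * s v) (T2 \<Delta> (c \<otimes> a))"
proof -
  have "emb (T2 \<Delta> (c \<otimes> (a * b))) = emb (T2 \<Delta> (c \<otimes> a) \<triangleleft> \<Delta> b)"
    by (simp add: emb_T2 coproduct_mult mult.assoc flip: emb_simps)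
  then have "T2 \<Delta> (c \<otimes> (a * b)) = T2 \<Delta> (c \<otimes> a) \<triangleleft> \<Delta> b" by (simp only: emb2_inject)
  then show ?thesis by (simp add: et tlift_s_coproduct)
qed

lemma tlift_s_mtensor: "tlift (\<lambda>u v. (u \<triangleleft> z) * s v) t = tlift (\<lambda>u v. u * s v) (t \<triangleleft> (z \<otimes>\<^sub>m 1))"
  unfolding mtensor_ract by (subst tlift_tmap) (intro lin | simp)+

lemma et_mult_et: "et (a * b) = et (a \<triangleleft> et b)"
proof (rule multiplier_eqI_right[OF nd])
  fix c
  have "emb (T2 \<Delta> (c \<otimes> (a \<triangleleft> et b))) = emb (T2 \<Delta> (c \<otimes> a) \<triangleleft> (et b \<otimes>\<^sub>m 1))"
    by (simp add: emb_T2 A_t_right[OF et_A_t(1)] mult.assoc flip: emb_simps)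
  then have "T2 \<Delta> (c \<otimes> (a \<triangleleft> et b)) = T2 \<Delta> (c \<otimes> a) \<triangleleft> (et b \<otimes>\<^sub>m 1)" by (simp only: emb2_inject)
  then show "c \<triangleleft> et (a * b) = c \<triangleleft> et (a \<triangleleft> et b)"
    unfolding et_mult tlift_s_mtensor et(2)[of c "a \<triangleleft> et b"] by (simp only:)
qed

text \<open>
  \<open>\<Sum> cE\<^sub>1 z S(yE\<^sub>2) = c z S(y)\<close> for \<open>z = \<epsilon>\<^sub>t(x)\<close>, since \<open>z\<close> commutes with \<open>E\<^sub>1\<close> and \<open>\<Sum> E\<^sub>1 S(E\<^sub>2) = 1\<close>
\<close>

lemma tlift_s_E_et: "tlift (\<lambda>u v. (u \<triangleleft> et x) * s v) ((c \<otimes> y) \<triangleleft> E) = (c \<triangleleft> et x) * s y"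
proof -
  have "((c \<otimes> y) \<triangleleft> E) \<triangleleft> (et x \<otimes>\<^sub>m 1) = ((c \<triangleleft> et x) \<otimes> y) \<triangleleft> E"
    using arg_cong[OF et_A_t(2)[of x], of "\<lambda>m. (c \<otimes> y) \<triangleleft> m"] by simp
  then show ?thesis by (simp add: tlift_s_mtensor antipode_E')
qed

text \<open>
  With \<open>\<Sum> u \<otimes> v = (c \<otimes> d)E\<close> in the range of \<open>T\<^sub>2\<close>, the element \<open>\<epsilon>\<^sub>t(b)\<close> is recovered from the elements
  \<open>c\<epsilon>\<^sub>t(yb) = \<Sum> cy\<^sub>1 \<epsilon>\<^sub>t(b) S(y\<^sub>2)\<close>.
\<close>

lemma et_eqI:
  assumes "\<And>y. et (y * b) = et (y * b')"
  shows "et b = et b'"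
proof (rule multiplier_eqI_right[OF nd], rule s_cancel)
  fix c d
  have cb: "cbilinear (\<lambda>u v. (u \<triangleleft> et x) * s v)" for x by (intro lin)
  have "tlift (\<lambda>u v. (u \<triangleleft> et b) * s v) (T2 \<Delta> t) = tlift (\<lambda>u v. (u \<triangleleft> et b') * s v) (T2 \<Delta> t)" for t
  proof (rule clinear_eqI_tensor[of "\<lambda>t. tlift (\<lambda>u v. (u \<triangleleft> et b) * s v) (T2 \<Delta> t)"])
    show "clinear (\<lambda>t. tlift (\<lambda>u v. (u \<triangleleft> et b) * s v) (T2 \<Delta> t))"
      "clinear (\<lambda>t. tlift (\<lambda>u v. (u \<triangleleft> et b') * s v) (T2 \<Delta> t))" by (intro lin)+
    show "tlift (\<lambda>u v. (u \<triangleleft> et b) * s v) (T2 \<Delta> (a \<otimes> y)) = tlift (\<lambda>u v. (u \<triangleleft> et b') * s v) (T2 \<Delta> (a \<otimes> y))"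
      for a y by (simp only: et_mult[symmetric] assms)
  qed
  moreover obtain t where "(c \<otimes> d) \<triangleleft> E = T2 \<Delta> t" by (rule E_eq_T2)
  ultimately show "(c \<triangleleft> et b) * s d = (c \<triangleleft> et b') * s d"
    using tlift_s_E_et[of b c d] tlift_s_E_et[of b' c d] by simp
qed

text \<open>
  Formally, for \<open>x = 1\<close>, this is
  \<open>\<epsilon>\<^sub>t(\<epsilon>\<^sub>s(q)) = \<Sum> \<epsilon>\<^sub>t(S(q\<^sub>1)q\<^sub>2) = \<Sum> \<epsilon>\<^sub>t(S(q\<^sub>1)\<epsilon>\<^sub>t(q\<^sub>2)) = \<epsilon>\<^sub>t(S(q))\<close>.  The element \<open>x\<close> covers \<open>q\<^sub>2\<close>:
  \<open>\<Sum> S(q\<^sub>1)\<epsilon>\<^sub>t(q\<^sub>2x) = \<Sum> \<epsilon>\<^sub>s(q\<^sub>1)\<epsilon>\<^sub>t(x)S(q\<^sub>2) = \<epsilon>\<^sub>t(x)S(q)\<close>.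
\<close>

lemma et_es: "et (es q \<triangleright> x) = et x * et (s q)"
proof -
  have "et (y * (es q \<triangleright> x)) = et (y * (et x \<triangleright> s q))" for y
  proof -
    have cb: "cbilinear (\<lambda>u v. (u \<triangleleft> et x) * s v)" "cbilinear (\<lambda>u v. u \<triangleleft> et (v * x))"
      by (intro lin)+
    have "et (y * (es q \<triangleright> x)) = et (tlift (\<lambda>u v. u * v * x) (R2 y q))"
      unfolding times_lact es_R2 by (subst clinear_out_tlift[of "\<lambda>a. a * x"]) (intro lin | simp)+
    also have "\<dots> = tlift (\<lambda>u v. et (u * v * x)) (R2 y q)"
      by (rule clinear_out_tlift) (intro lin)+
    also have "\<dots> = tlift (\<lambda>u v. et (u \<triangleleft> et (v * x))) (R2 y q)"
      by (simp add: mult.assoc et_mult_et[of _ "_ * _"])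
    also have "\<dots> = et (tlift (\<lambda>u v. u \<triangleleft> et (v * x)) (R2 y q))"
      by (rule clinear_out_tlift[symmetric]) (intro lin)+
    also have "tlift (\<lambda>u v. u \<triangleleft> et (v * x)) t = tlift (\<lambda>u v. (u \<triangleleft> et x) * s v) (T2 \<Delta> t)" for t
    proof (rule clinear_eqI_tensor[OF clinear_tlift[OF cb(2)]])
      show "clinear (\<lambda>t. tlift (\<lambda>u v. (u \<triangleleft> et x) * s v) (T2 \<Delta> t))" by (intro lin)
    qed (rule trans[OF tlift_tensor[OF cb(2)] et_mult])
    finally show ?thesis by (simp add: R2 tlift_s_E_et times_lact)
  qed
  then have "et (es q \<triangleright> x) = et (et x \<triangleright> s q)" by (rule et_eqI)
  then show ?thesis by (simp add: et_A_t_mult et_A_t(1))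
qed

text \<open>
  \<open>E(w \<otimes> 1) = E(1 \<otimes> \<epsilon>\<^sub>t(S(q)))\<close> for \<open>w = \<epsilon>\<^sub>s(q)\<close>: apply \<open>E(a \<otimes> b) = \<Sum> a\<^sub>1 \<otimes> \<epsilon>\<^sub>t(a\<^sub>2)b\<close> to \<open>wa\<close>, whose
  coproduct is \<open>(1 \<otimes> w)\<Delta>(a)\<close>.
\<close>

lemma E_Casimir: "E \<triangleright> ((es q \<triangleright> a) \<otimes> b) = E \<triangleright> (a \<otimes> (et (s q) \<triangleright> b))"
proof (rule tensor_strip_left[where L = "(*)"])
  show "tmap ((*) c) (\<lambda>x. x) (E \<triangleright> ((es q \<triangleright> a) \<otimes> b)) =
      tmap ((*) c) (\<lambda>x. x) (E \<triangleright> (a \<otimes> (et (s q) \<triangleright> b)))" for c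
    unfolding E_et T2_es by (subst tmap_tmap) (intro lin | simp add: et_es)+
qed (simp, rule nondegenerateD(2)[OF nd], assumption)

text \<open>
  \<open>S(\<epsilon>\<^sub>s(q)) = \<epsilon>\<^sub>t(S(q))\<close>: besides the formula for \<open>\<epsilon>\<^sub>t(\<epsilon>\<^sub>s(q)x)\<close> above there is
  \<open>c\<epsilon>\<^sub>t(\<epsilon>\<^sub>s(q)x) = \<Sum> cx\<^sub>1S(\<epsilon>\<^sub>s(q)x\<^sub>2)\<close>, and the two are compared on \<open>(a \<otimes> x)E\<close> in the range of \<open>T\<^sub>2\<close>.
\<close>

lemma s_es: "s (es q \<triangleright> x) = s x \<triangleleft> et (s q)"
proof -
  \<comment> \<open>\<open>S(\<epsilon>\<^sub>s(q))\<close> as a multiplier\<close>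
  define W where "W = Multiplier (\<lambda>b. s (si b \<triangleleft> es q)) (\<lambda>b. s (es q \<triangleright> si b))"
  have W: "s v \<triangleleft> W = s (es q \<triangleright> v)" for v
  proof -
    have "a * s (si b \<triangleleft> es q) = s (es q \<triangleright> si a) * b" for a b
    proof -
      have "a * s (si b \<triangleleft> es q) = s ((si b \<triangleleft> es q) * si a)" by (simp add: s_mult)
      also have "\<dots> = s (si b * (es q \<triangleright> si a))" by (simp add: times_lact)
      finally show ?thesis by (simp add: s_mult)
    qed
    moreover have "clinear (\<lambda>b. s (si b \<triangleleft> es q))" "clinear (\<lambda>b. s (es q \<triangleright> si b))" by (intro lin)+
    ultimately show ?thesis unfolding W_def by (simp add: Multiplier_act(2)[OF nd])
  qed
  have out: "tlift (\<lambda>u v. u * s v) t \<triangleleft> m = tlift (\<lambda>u v. u * (s v \<triangleleft> m)) t" for t m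
    by (subst clinear_out_tlift[of "\<lambda>x. x \<triangleleft> m"]) (intro lin | simp add: ract_times)+
  have "tlift (\<lambda>u v. u * s v) (T2 \<Delta> t) \<triangleleft> W = tlift (\<lambda>u v. u * s v) (T2 \<Delta> t) \<triangleleft> et (s q)" for t
  proof (rule clinear_eqI_tensor[of "\<lambda>t. tlift _ (T2 \<Delta> t) \<triangleleft> W"])
    fix c x
    have "tlift (\<lambda>u v. u * s v) (T2 \<Delta> (c \<otimes> x)) \<triangleleft> W
        = tlift (\<lambda>u v. u * s v) (tmap (\<lambda>x. x) (\<lambda>v. es q \<triangleright> v) (T2 \<Delta> (c \<otimes> x)))"
      unfolding out W by (subst tlift_tmap) (intro lin | simp)+
    also have "\<dots> = c \<triangleleft> et (es q \<triangleright> x)" by (simp add: et T2_es)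
    finally show "tlift (\<lambda>u v. u * s v) (T2 \<Delta> (c \<otimes> x)) \<triangleleft> W
        = tlift (\<lambda>u v. u * s v) (T2 \<Delta> (c \<otimes> x)) \<triangleleft> et (s q)"
      by (simp add: et_es flip: et(2))
  qed (intro lin)+
  note T2 = this
  have "a * s (es q \<triangleright> x) = a * (s x \<triangleleft> et (s q))" for a
  proof -
    obtain t where t: "(a \<otimes> x) \<triangleleft> E = T2 \<Delta> t" by (rule E_eq_T2)
    show ?thesis
      using T2[of t] by (simp add: antipode_E' ract_times W flip: t)
  qed
  then show ?thesis by (rule nondegenerateD(2)[OF nd])
qed

lemma E_tmap_right: "E \<triangleright> tmap (\<lambda>x. x) (\<lambda>x. x * b) t = tmap (\<lambda>x. x) (\<lambda>x. x * b) (E \<triangleright> t)"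
proof -
  have "emb (E \<triangleright> tmap (\<lambda>x. x) (\<lambda>x. x * b) t) = emb (tmap (\<lambda>x. x) (\<lambda>x. x * b) (E \<triangleright> t))"
    unfolding emb_tmap emb_simps(2)[symmetric] by (simp only: mult.assoc)
  then show ?thesis by (simp only: emb2_inject)
qed

lemma E_T3: "E \<triangleright> T3 a b = T3 a b"
proof -
  have "emb (E \<triangleright> T3 a b) = emb (T3 a b)"
    unfolding emb_simps(2)[symmetric] emb_T3 by (simp add: E_coproduct flip: mult.assoc)
  then show ?thesis by (simp only: emb2_inject)
qed

lemma cb_T3_si: "cbilinear (\<lambda>u v. T3 v (si u))"
  by (intro lin)

text \<open>
  Since \<open>S\<inverse>\<close> reverses products, \<open>S\<inverse>(y\<epsilon>\<^sub>t(p)) = \<Sum> p\<^sub>2S\<inverse>(yp\<^sub>1)\<close>; put \<open>p = a\<^sub>1\<close> and use coassociativity.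
\<close>

lemma et_T1_T3: "tmap (\<lambda>p. si (y \<triangleleft> et p)) (\<lambda>x. x) (T1 \<Delta> (a \<otimes> b))
    = tmap (\<lambda>x. x) (\<lambda>x. x * b) (tlift (\<lambda>u v. T3 v (si u)) (T2 \<Delta> (y \<otimes> a)))"
proof -
  have B: "cbilinear (\<lambda>u v. v * si u)" by (intro lin)
  have "si (y \<triangleleft> et p) = tlift (\<lambda>u v. v * si u) (T2 \<Delta> (y \<otimes> p))" for p
    unfolding et by (subst clinear_out_tlift[of si]) (intro lin si_linear | simp add: si_mult)+
  then have "tmap (\<lambda>p. si (y \<triangleleft> et p)) (\<lambda>x. x) (T1 \<Delta> (a \<otimes> b))
    = tmap (tlift (\<lambda>u v. v * si u)) (\<lambda>x. x)
        (tunassoc (tassoc (tmap (\<lambda>p. T2 \<Delta> (y \<otimes> p)) (\<lambda>x. x) (T1 \<Delta> (a \<otimes> b)))))"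
    unfolding tunassoc_tassoc by (subst tmap_tmap) (intro lin clinear_tlift[OF B] | simp)+
  also have "\<dots> = tlift (\<lambda>u v. tmap (\<lambda>x. x * si u) (\<lambda>x. x) (T1 \<Delta> (v \<otimes> b))) (T2 \<Delta> (y \<otimes> a))"
    unfolding coassociative_T by (rule tmap_tunassoc_left) (intro lin)+
  also have "\<dots> = tlift (\<lambda>u v. tmap (\<lambda>x. x) (\<lambda>x. x * b) (T3 v (si u))) (T2 \<Delta> (y \<otimes> a))"
  proof (rule tlift_cong_bilinear)
    fix u v
    have "emb (tmap (\<lambda>x. x * si u) (\<lambda>x. x) (T1 \<Delta> (v \<otimes> b)))
        = emb (tmap (\<lambda>x. x) (\<lambda>x. x * b) (T3 v (si u)))"
      by (simp add: emb_tmap emb_T1 emb_T3 mult.assoc mtensor_mult)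
    then show "tmap (\<lambda>x. x * si u) (\<lambda>x. x) (T1 \<Delta> (v \<otimes> b))
        = tmap (\<lambda>x. x) (\<lambda>x. x * b) (T3 v (si u))"
      by (simp only: emb2_inject)
  qed
  also have "\<dots> = tmap (\<lambda>x. x) (\<lambda>x. x * b) (tlift (\<lambda>u v. T3 v (si u)) (T2 \<Delta> (y \<otimes> a)))"
    by (rule clinear_out_tlift[symmetric]) (intro lin)+
  finally show ?thesis .
qed

text \<open>
  \<open>E(1 \<otimes> a) = \<Sum> S\<inverse>(\<epsilon>\<^sub>t(a\<^sub>1)) \<otimes> a\<^sub>2\<close>: by the Casimir property the right side becomes
  \<open>E(1 \<otimes> \<Sum> \<epsilon>\<^sub>t(a\<^sub>1)a\<^sub>2) = E(1 \<otimes> a)\<close> when multiplied by \<open>E\<close>.  It is fixed by \<open>E\<close>, because it equals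
  \<open>\<Sum> a\<^sub>2S\<inverse>(a\<^sub>1) \<otimes> a\<^sub>3\<close>.
\<close>

lemma E_right_T1: "E \<triangleright> (si y \<otimes> (a * b)) = tmap (\<lambda>p. si (y \<triangleleft> et p)) (\<lambda>x. x) (T1 \<Delta> (a \<otimes> b))"
proof -
  have cb: "cbilinear (\<lambda>p q. et p \<triangleright> q)" by (intro lin)
  have l: "clinear (\<lambda>p. si (y \<triangleleft> et p))" by (intro lin)
  have si: "si (y \<triangleleft> et p) = es (si p) \<triangleright> si y" for p
    using s_es[of "si p" "si y"] by (metis s_si)
  have "E \<triangleright> tmap (\<lambda>p. si (y \<triangleleft> et p)) (\<lambda>x. x) t = E \<triangleright> (si y \<otimes> tlift (\<lambda>p q. et p \<triangleright> q) t)" for t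
  proof (rule clinear_eqI_tensor[of "\<lambda>t. E \<triangleright> tmap (\<lambda>p. si (y \<triangleleft> et p)) (\<lambda>x. x) t"])
    show "clinear (\<lambda>t. E \<triangleright> tmap (\<lambda>p. si (y \<triangleleft> et p)) (\<lambda>x. x) t)"
      "clinear (\<lambda>t. E \<triangleright> (si y \<otimes> tlift (\<lambda>p q. et p \<triangleright> q) t))" by (intro lin)+
    show "E \<triangleright> tmap (\<lambda>p. si (y \<triangleleft> et p)) (\<lambda>x. x) (p \<otimes> q)
        = E \<triangleright> (si y \<otimes> tlift (\<lambda>p q. et p \<triangleright> q) (p \<otimes> q))" for p q
      unfolding tmap_tensor[OF l clinear_id(2)] tlift_tensor[OF cb]
      using E_Casimir[of "si p" "si y" q] by (simp add: si)
  qed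
  from this[of "T1 \<Delta> (a \<otimes> b)"]
  have "E \<triangleright> tmap (\<lambda>p. si (y \<triangleleft> et p)) (\<lambda>x. x) (T1 \<Delta> (a \<otimes> b)) = E \<triangleright> (si y \<otimes> (a * b))"
    by (simp add: et_T1 tlift_tensor[OF cb_times])
  moreover have "E \<triangleright> tlift (\<lambda>u v. T3 v (si u)) w = tlift (\<lambda>u v. T3 v (si u)) w" for w
    by (simp add: clinear_out_tlift[OF clinear_lact cb_T3_si] E_T3)
  ultimately show ?thesis by (simp add: et_T1_T3 E_tmap_right)
qed

lemma E_right_T2: "E \<triangleright> (si y \<otimes> a) = tlift (\<lambda>u v. T3 v (si u)) (T2 \<Delta> (y \<otimes> a))"
proof (rule tensor_strip_right[where L = "\<lambda>b x. x * b"])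
  have l: "clinear (\<lambda>x::'a. x * b)" for b by simp
  show "tmap (\<lambda>x. x) (\<lambda>x. x * b) (E \<triangleright> (si y \<otimes> a))
      = tmap (\<lambda>x. x) (\<lambda>x. x * b) (tlift (\<lambda>u v. T3 v (si u)) (T2 \<Delta> (y \<otimes> a)))" for b
    unfolding et_T1_T3[symmetric] E_right_T1[symmetric] E_tmap_right[symmetric]
      tmap_tensor[OF clinear_id(2) l] by (rule refl)
qed (simp, rule nondegenerateD(1)[OF nd], assumption)

section \<open>Local units\<close>

text \<open>
  The element \<open>E(1 \<otimes> c)\<close> is a finite sum \<open>\<Sum> w\<^sub>i \<otimes> c\<^sub>i\<close> with multipliers \<open>w\<^sub>i\<close>.  Its right leg lies in \<open>Ac\<close>,
  hence so does \<open>c = \<Sum> S(w\<^sub>i)c\<^sub>i\<close>.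
\<close>

lemma local_unit: "\<exists>e. e * c = (c::'a)"
proof -
  let ?V = "range (\<lambda>x. x * c)"
  have sub: "csubspace ?V"
    by (rule complex_vector.subspaceI)
       (auto simp: image_iff intro: exI[of _ 0] simp flip: distrib_right mult_scaleC_left)
  obtain p where p: "clinear p" "\<And>v. v \<in> ?V \<Longrightarrow> p v = v" "\<And>x. p x \<in> ?V"
    using subspace_projection[OF sub] by blast
  have killed: "clinear (\<lambda>x. g (x - p x))" "g (x * c - p (x * c)) = 0" if "clinear g" for g :: "'a \<Rightarrow> complex" and x
    using p that by (auto simp: clinear_iff clinear_diff algebra_simps clinear_zero[OF that])
  \<comment> \<open>The right leg of \<open>R\<^sub>1(v \<otimes> c)\<close> lies in \<open>S(A)c\<close>, so \<open>\<epsilon>\<^sub>t(v)c\<close>, the product of its legs, is in \<open>Ac\<close>.\<close>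
  have R: "tmap (\<lambda>x. x) p (R1 v c) = R1 v c" for v
  proof -
    have "sl_r g (tmap (\<lambda>x. x) (\<lambda>x. x - p x) (R1 v c)) = 0" if g: "clinear g" for g :: "'a \<Rightarrow> complex"
    proof (rule nondegenerateD(2)[OF nd])
      fix y
      have "sl_r (\<lambda>x. g (x - p x)) (tmap (\<lambda>x. x) (\<lambda>q. s q * c) t) = 0" for t :: "'a tensor2"
        by (subst sl_tmap(1)) (use killed[OF g] in \<open>simp_all add: lin sl_r_zero\<close>)
      then have "sl_r (\<lambda>x. g (x - p x)) (tmap ((*) y) (\<lambda>x. x) (R1 v c)) = 0"
        unfolding R1(2) .
      then show "y * sl_r g (tmap (\<lambda>x. x) (\<lambda>x. x - p x) (R1 v c)) = y * 0"
        by (simp add: sl_tmap lin p(1) g killed(1)[OF g])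
    qed
    then have "tmap (\<lambda>x. x) (\<lambda>x. x - p x) (R1 v c) = 0"
      by (intro tensor_eqI_slices) (simp add: clinear_zero[OF lin_sl(1)[OF _ clinear_id(2)]])
    moreover have "tmap (\<lambda>x. x) (\<lambda>x. x - p x) t = t - tmap (\<lambda>x. x) p t" for t :: "'a tensor2"
      by (rule clinear_eqI_tensor[of "\<lambda>t. tmap (\<lambda>x. x) (\<lambda>x. x - p x) t"])
         (intro lin p(1) | simp add: p(1) lin clinear_diff[OF clinear_tensor(1)])+
    ultimately show ?thesis by simp
  qed
  have V: "tlift B t \<in> ?V" if "cbilinear B" "\<And>x y. B x y \<in> ?V" for B :: "'a \<Rightarrow> 'a \<Rightarrow> 'a" and t
    using that complex_vector.subspace_add[OF sub]
    by (induction t) (simp_all only: clinear_add[OF clinear_tlift[OF that(1)]] tlift_tensor[OF that(1)])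
  have et_V: "et v \<triangleright> c \<in> ?V" for v
  proof -
    have "et v \<triangleright> c = tlift (\<lambda>r q. r * p q) (R1 v c)"
      unfolding et_R1 by (subst R[symmetric], subst tlift_tmap) (intro lin p(1) | simp)+
    moreover have "r * p q \<in> ?V" for r q
      using p(3)[of q] by (auto simp flip: mult.assoc)
    ultimately show ?thesis using V[of "\<lambda>r q. r * p q"] by (simp add: lin p(1))
  qed
  have E_V: "sl_r (\<lambda>x. g (x - p x)) (E \<triangleright> (x \<otimes> c)) = 0" if g: "clinear g" for g :: "'a \<Rightarrow> complex" and x
  proof (rule nondegenerateD(2)[OF nd])
    fix y
    have "g ((et q \<triangleright> c) - p (et q \<triangleright> c)) = 0" for q
      using p(2)[OF et_V[of q]] by (simp add: clinear_zero[OF g])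
    then have "sl_r (\<lambda>x. g (x - p x)) (tmap (\<lambda>x. x) (\<lambda>q. et q \<triangleright> c) t) = 0" for t :: "'a tensor2"
      by (subst sl_tmap(1)) (use killed[OF g] in \<open>simp_all add: lin sl_r_zero\<close>)
    then have "sl_r (\<lambda>x. g (x - p x)) (tmap ((*) y) (\<lambda>x. x) (E \<triangleright> (x \<otimes> c))) = 0"
      unfolding E_et .
    then show "y * sl_r (\<lambda>x. g (x - p x)) (E \<triangleright> (x \<otimes> c)) = y * 0"
      by (simp add: sl_tmap lin killed(1)[OF g])
  qed
  have cb: "cbilinear (\<lambda>p q. et p \<triangleright> q)" "cbilinear (\<lambda>v q. et v \<triangleright> p q)" by (intro lin p(1))+
  have l: "clinear (\<lambda>t. tmap (\<lambda>p. si (y \<triangleleft> et p)) (\<lambda>x. x) t)" for y by (intro lin)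
  \<comment> \<open>\<open>T = \<Sum> p \<otimes> q\<close> represents \<open>E(1 \<otimes> c) = \<Sum> S\<inverse>(\<epsilon>\<^sub>t(p)) \<otimes> q\<close>.\<close>
  obtain T where T: "tlift (\<lambda>p q. et p \<triangleright> q) T = c"
    "\<And>y. tmap (\<lambda>p. si (y \<triangleleft> et p)) (\<lambda>x. x) T = E \<triangleright> (si y \<otimes> c)"
  proof -
    have "\<exists>T. tlift (\<lambda>p q. et p \<triangleright> q) T = c
      \<and> (\<forall>y. tmap (\<lambda>p. si (y \<triangleleft> et p)) (\<lambda>x. x) T = E \<triangleright> (si y \<otimes> c))" for c
      using idempotent_span[of c]
    proof (induction rule: complex_vector.span_induct_alt)
      case base
      show ?case
        by (intro exI[of _ 0]) (simp add: clinear_zero[OF clinear_tlift[OF cb(1)]] clinear_zero[OF l]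
            clinear_zero[OF clinear_tensor(1)] clinear_zero[OF clinear_lact])
    next
      case (step r x z)
      then obtain a b T where x: "x = a * b" and T: "tlift (\<lambda>p q. et p \<triangleright> q) T = z"
        "\<And>y. tmap (\<lambda>p. si (y \<triangleleft> et p)) (\<lambda>x. x) T = E \<triangleright> (si y \<otimes> z)" by blast
      show ?case
      proof (intro exI[of _ "r *\<^sub>C T1 \<Delta> (a \<otimes> b) + T"] conjI allI)
        show "tlift (\<lambda>p q. et p \<triangleright> q) (r *\<^sub>C T1 \<Delta> (a \<otimes> b) + T) = r *\<^sub>C x + z"
          by (simp add: clinear_add[OF clinear_tlift[OF cb(1)]] clinear_scaleC[OF clinear_tlift[OF cb(1)]]
              et_T1 tlift_tensor[OF cb_times] T x)
        show "tmap (\<lambda>p. si (y \<triangleleft> et p)) (\<lambda>x. x) (r *\<^sub>C T1 \<Delta> (a \<otimes> b) + T) = E \<triangleright> (si y \<otimes> (r *\<^sub>C x + z))" for y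
          by (simp add: clinear_add[OF l] clinear_scaleC[OF l] T x E_right_T1[symmetric]
              tensor_add_right tensor_scaleC_right clinear_add[OF clinear_lact] clinear_scaleC[OF clinear_lact])
      qed
    qed
    then show ?thesis using that by blast
  qed
  have l': "clinear et" using lin_et[OF clinear_id(2)] by simp
  have "tmap et (\<lambda>q. q - p q) T = 0"
  proof (rule tensor_eqI_slices)
    fix g :: "'a \<Rightarrow> complex"
    assume g: "clinear g"
    have "y \<triangleleft> et (sl_r (\<lambda>x. g (x - p x)) T) = 0" for y
    proof -
      have "si (y \<triangleleft> et (sl_r (\<lambda>x. g (x - p x)) T)) = sl_r (\<lambda>x. g (x - p x)) (tmap (\<lambda>p. si (y \<triangleleft> et p)) (\<lambda>x. x) T)"
        by (subst sl_tmap(1)) (intro lin killed(1)[OF g] | simp)+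
      then have "si (y \<triangleleft> et (sl_r (\<lambda>x. g (x - p x)) T)) = 0" by (simp add: T(2) E_V[OF g])
      then show ?thesis by (metis clinear_zero[OF s_linear] s_si(1))
    qed
    then have "et (sl_r (\<lambda>x. g (x - p x)) T) = 0"
      by (intro multiplier_eqI_right[OF nd]) simp
    then show "sl_r g (tmap et (\<lambda>q. q - p q) T) = sl_r g (0 :: ('a multiplier, 'a) tensor)"
      by (subst sl_tmap(1)) (intro lin l' g p(1) | simp add: clinear_zero[OF lin_sl(1)[OF g clinear_id(2)]])+
  qed
  then have "tlift (\<lambda>m q. m \<triangleright> q) (tmap et (\<lambda>q. q - p q) T) = 0"
    by (simp add: clinear_zero[OF clinear_tlift] lin)
  moreover have "tlift (\<lambda>m q. m \<triangleright> q) (tmap et (\<lambda>q. q - p q) t)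
      = tlift (\<lambda>p q. et p \<triangleright> q) t - tlift (\<lambda>v q. et v \<triangleright> p q) t" for t
  proof -
    have "tlift (\<lambda>m q. m \<triangleright> q) (tmap et (\<lambda>q. q - p q) t) = tlift (\<lambda>v q. et v \<triangleright> (q - p q)) t"
      by (subst tlift_tmap) (intro lin l' p(1) | simp)+
    also have "\<dots> = tlift (\<lambda>p q. et p \<triangleright> q) t - tlift (\<lambda>v q. et v \<triangleright> p q) t"
    proof -
      have cb': "cbilinear (\<lambda>v q. et v \<triangleright> (q - p q))" by (intro lin p(1))
      show ?thesis
      proof (rule clinear_eqI_tensor[OF clinear_tlift[OF cb']])
        show "clinear (\<lambda>t. tlift (\<lambda>p q. et p \<triangleright> q) t - tlift (\<lambda>v q. et v \<triangleright> p q) t)" by (intro lin p(1))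
      qed (unfold tlift_tensor[OF cb'] tlift_tensor[OF cb(1)] tlift_tensor[OF cb(2)],
          rule clinear_diff[OF clinear_lact])
    qed
    finally show ?thesis .
  qed
  ultimately have "c = tlift (\<lambda>v q. et v \<triangleright> p q) T" using T(1) by simp
  moreover have "et v \<triangleright> p q \<in> ?V" for v q
    using p(3)[of q] by (auto simp: lact_times)
  ultimately have "c \<in> ?V" using V[OF cb(2)] by metis
  then show ?thesis by (metis imageE)
qed

text \<open>
  If \<open>e\<close> fixes \<open>c\<^sub>2, \<dots>\<close> and \<open>e'\<close> fixes \<open>c\<^sub>1 - ec\<^sub>1\<close>, then \<open>1 - (1 - e')(1 - e)\<close> fixes all of them.
\<close>

lemma local_units: "\<exists>e. \<forall>c\<in>set cs. e * c = (c::'a)"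
proof (induction cs)
  case (Cons c cs)
  then obtain e where e: "\<And>c. c \<in> set cs \<Longrightarrow> e * c = c" by blast
  obtain e' where e': "e' * (c - e * c) = c - e * c" using local_unit by blast
  show ?case
  proof (intro exI[of _ "e + e' - e' * e"] ballI)
    fix d assume "d \<in> set (c # cs)"
    then consider "d = c" | "e * d = d" using e by auto
    then show "(e + e' - e' * e) * d = d"
    proof cases
      case 1
      then show ?thesis using e' by (simp add: algebra_simps)
    next
      case 2
      then show ?thesis by (simp add: left_diff_distrib distrib_right mult.assoc)
    qed
  qed
qed simp

section \<open>Slices of coproducts\<close>

lemma slice_right_act:
  assumes f: "clinear f"
  shows "slice_right f (\<Delta> a) \<triangleright> b = sl_r f (T3 a b)" "c \<triangleleft> slice_right f (\<Delta> a) = sl_r f (T2 \<Delta> (c \<otimes> a))"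
proof -
  have eq: "slice_right f (\<Delta> a) = Multiplier (\<lambda>b. sl_r f (T3 a b)) (\<lambda>c. sl_r f (T2 \<Delta> (c \<otimes> a)))"
    unfolding slice_right_def sl_r_def T3_def by (simp add: unemb_emb[OF nd2] flip: emb_T2)
  have "c * sl_r f (T3 a b) = sl_r f (T2 \<Delta> (c \<otimes> a)) * b" for b c
  proof -
    have "emb (tmap ((*) c) (\<lambda>x. x) (T3 a b)) = emb (tmap (\<lambda>x. x * b) (\<lambda>x. x) (T2 \<Delta> (c \<otimes> a)))"
      by (simp add: emb_tmap emb_T2 emb_T3 mult.assoc)
    then have "sl_r f (tmap ((*) c) (\<lambda>x. x) (T3 a b)) = sl_r f (tmap (\<lambda>x. x * b) (\<lambda>x. x) (T2 \<Delta> (c \<otimes> a)))"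
      by (simp only: emb2_inject)
    then show ?thesis by (simp add: sl_tmap f)
  qed
  moreover have "clinear (\<lambda>b. sl_r f (T3 a b))" "clinear (\<lambda>c. sl_r f (T2 \<Delta> (c \<otimes> a)))"
    by (intro lin f)+
  ultimately show "slice_right f (\<Delta> a) \<triangleright> b = sl_r f (T3 a b)"
    "c \<triangleleft> slice_right f (\<Delta> a) = sl_r f (T2 \<Delta> (c \<otimes> a))"
    unfolding eq by (simp_all add: Multiplier_act[OF nd])
qed

lemma slice_left_act:
  assumes f: "clinear f"
  shows "slice_left f (\<Delta> a) \<triangleright> b = sl_l f (T1 \<Delta> (a \<otimes> b))"
proof -
  have eq: "slice_left f (\<Delta> a) = Multiplier (\<lambda>b. sl_l f (T1 \<Delta> (a \<otimes> b))) (\<lambda>c. sl_l f (T4 c a))"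
    unfolding slice_left_def sl_l_def T4_def by (simp add: unemb_emb[OF nd2] flip: emb_T1)
  have "c * sl_l f (T1 \<Delta> (a \<otimes> b)) = sl_l f (T4 c a) * b" for b c
  proof -
    have "emb (tmap (\<lambda>x. x) ((*) c) (T1 \<Delta> (a \<otimes> b))) = emb (tmap (\<lambda>x. x) (\<lambda>x. x * b) (T4 c a))"
      by (simp add: emb_tmap emb_T1 emb_T4 mult.assoc)
    then have "sl_l f (tmap (\<lambda>x. x) ((*) c) (T1 \<Delta> (a \<otimes> b))) = sl_l f (tmap (\<lambda>x. x) (\<lambda>x. x * b) (T4 c a))"
      by (simp only: emb2_inject)
    then show ?thesis by (simp add: sl_tmap f)
  qed
  moreover have "clinear (\<lambda>b. sl_l f (T1 \<Delta> (a \<otimes> b)))" "clinear (\<lambda>c. sl_l f (T4 c a))"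
    by (intro lin f)+
  ultimately show "slice_left f (\<Delta> a) \<triangleright> b = sl_l f (T1 \<Delta> (a \<otimes> b))"
    unfolding eq by (simp add: Multiplier_act[OF nd])
qed

lemma T3_A_t:
  assumes "z \<in> A_t \<Delta> E"
  shows "T3 (b \<triangleleft> z) c = T3 b (z \<triangleright> c)"
proof -
  have "emb (T3 (b \<triangleleft> z) c) = emb (T3 b (z \<triangleright> c))"
    by (simp add: emb_T3 A_t_right[OF assms] mtensor_mult emb_simps mult.assoc)
  then show ?thesis by (simp only: emb2_inject)
qed

lemma coproduct_inject:
  assumes "\<Delta> a = \<Delta> b"
  shows "a = b"
proof (rule nondegenerateD(1)[OF nd])
  fix c
  have "emb (T1 \<Delta> (a \<otimes> c)) = emb (T1 \<Delta> (b \<otimes> c))" by (simp add: emb_T1 assms)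
  then have "tlift (*) (a \<otimes> c) = tlift (*) (b \<otimes> c)"
    by (simp only: emb2_inject flip: counit_T1(2))
  then show "a * c = b * c" by (simp add: tlift_tensor[OF cb_times])
qed

lemma A_t_subspace: "csubspace (A_t \<Delta> E)"
  by (rule complex_vector.subspaceI)
     (auto simp: A_t_iff clinear_zero[OF Delta.lin_gamma] clinear_add[OF Delta.lin_gamma]
       clinear_scaleC[OF Delta.lin_gamma] distrib_right mult_scaleC_left
       clinear_zero[OF lin_mtensor(1)[OF clinear_id(2)]]
       clinear_add[OF lin_mtensor(1)[OF clinear_id(2)]] clinear_scaleC[OF lin_mtensor(1)[OF clinear_id(2)]])

lemma D1_left: "D1.ext (emb p \<otimes>\<^sub>m 1) = massoc (\<Delta> p \<otimes>\<^sub>m 1)"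
proof (rule D1.ext_eqI)
  show "massoc (E \<otimes>\<^sub>m 1) * massoc (\<Delta> p \<otimes>\<^sub>m 1) = massoc (\<Delta> p \<otimes>\<^sub>m 1)"
    by (simp add: mtensor_mult E_coproduct flip: massoc_mult)
  show "coprod_tensor_id \<Delta> t * massoc (\<Delta> p \<otimes>\<^sub>m 1) = coprod_tensor_id \<Delta> (t \<triangleleft> (emb p \<otimes>\<^sub>m 1))" for t
    by (induction t)
      (simp_all add: coprod_tensor_id_tensor mtensor_mult coproduct_mult emb_simps distrib_right
        clinear_add[OF clinear_id_coprod(2)] clinear_add[OF clinear_ract] flip: massoc_mult)
qed

text \<open>
  \<open>\<Sum> a\<^sub>1c \<otimes> a\<^sub>2d \<otimes> a\<^sub>3 = \<Sum> (a\<^sub>1p)\<^sub>1 \<otimes> (a\<^sub>1p)\<^sub>2q \<otimes> a\<^sub>2\<close> if \<open>E(c \<otimes> d) = T\<^sub>1(\<Sum> p \<otimes> q)\<close>.  The factor \<open>c \<otimes> d\<close> may be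
  replaced by \<open>E(c \<otimes> d)\<close> because \<open>(\<Delta> \<otimes> id)\<Delta>(a)\<close> absorbs \<open>E \<otimes> 1\<close>.
\<close>

lemma coassociative_T3:
  assumes w: "E \<triangleright> (c \<otimes> d) = T1 \<Delta> w"
  shows "tmap (\<lambda>x. x) (\<lambda>q. T3 q d) (T3 a c)
    = tlift (\<lambda>p q. tassoc (tmap (\<lambda>u. T1 \<Delta> (u \<otimes> q)) (\<lambda>x. x) (T3 a p))) w"
proof -
  have l: "clinear (\<lambda>q. T3 q d)" by (intro lin)
  have e: "emb (tmap (\<lambda>x. x) (\<lambda>q. T3 q d) t) = id_tensor_coprod \<Delta> t * (1 \<otimes>\<^sub>m emb d \<otimes>\<^sub>m 1)" for t
  proof (induction t)
    case (add s t)
    then show ?case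
      by (simp add: clinear_add[OF clinear_tmap[OF clinear_id(2) l]]
          clinear_add[OF lin_eta(5)] clinear_add[OF clinear_id_coprod(1)] distrib_right)
  next
    case (tensor p q)
    show ?case by (simp add: l id_tensor_coprod_tensor mtensor_mult emb_T3 emb_tensor)
  qed
  have e': "emb (tassoc (tmap (\<lambda>u. T1 \<Delta> (u \<otimes> q)) (\<lambda>x. x) t))
      = coprod_tensor_id \<Delta> t * massoc ((1 \<otimes>\<^sub>m emb q) \<otimes>\<^sub>m 1)" for q t
  proof -
    have l: "clinear (\<lambda>u. T1 \<Delta> (u \<otimes> q))" by (intro lin)
    show ?thesis
    proof (induction t)
      case (add s t)
      then show ?case
        by (simp add: clinear_add[OF clinear_tmap[OF l]] clinear_add[OF tassoc(1)]
            clinear_add[OF lin_eta(5)] clinear_add[OF clinear_id_coprod(2)] distrib_right)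
    next
      case (tensor u v)
      show ?case
        by (simp add: l coprod_tensor_id_tensor mtensor_mult emb_T1 emb_tensor flip: massoc_mult massoc_emb)
    qed
  qed
  have cb: "cbilinear (\<lambda>p q. tassoc (tmap (\<lambda>u. T1 \<Delta> (u \<otimes> q)) (\<lambda>x. x) (T3 a p)))" by (intro lin)
  have "emb (tlift (\<lambda>p q. tassoc (tmap (\<lambda>u. T1 \<Delta> (u \<otimes> q)) (\<lambda>x. x) (T3 a p))) t)
      = D1.ext (\<Delta> a) * massoc (emb (T1 \<Delta> t) \<otimes>\<^sub>m 1)" for t
  proof (induction t)
    case (add s t)
    then show ?case
      by (simp add: clinear_add[OF clinear_tlift[OF cb]] clinear_add[OF lin_eta(5)] distrib_left
          clinear_add[OF clinear_T(1)] clinear_add[OF lin_mtensor(1)[OF clinear_id(2)]] massoc_add)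
  next
    case (tensor p q)
    have "coprod_tensor_id \<Delta> (T3 a p) = D1.ext (\<Delta> a) * massoc (\<Delta> p \<otimes>\<^sub>m 1)"
      by (simp add: emb_T3 D1.extension(2) D1_left flip: D1.extension(3))
    then show ?case
      by (simp add: tlift_tensor[OF cb] e' emb_T1 mtensor_mult mult.assoc flip: massoc_mult)
  qed
  note this[of w]
  also have "massoc (emb (T1 \<Delta> w) \<otimes>\<^sub>m 1) = massoc (E \<otimes>\<^sub>m 1) * massoc (emb (c \<otimes> d) \<otimes>\<^sub>m 1)"
    by (simp add: mtensor_mult emb_simps flip: w massoc_mult)
  also have "D1.ext (\<Delta> a) * \<dots> = D2.ext (\<Delta> a) * massoc (emb (c \<otimes> d) \<otimes>\<^sub>m 1)"
    by (simp add: D1.e_ext coassociative[symmetric] flip: mult.assoc)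
  also have "massoc (emb (c \<otimes> d) \<otimes>\<^sub>m 1) = emb c \<otimes>\<^sub>m emb d \<otimes>\<^sub>m 1"
    by (simp add: emb_tensor massoc_mtensor)
  also have "D2.ext (\<Delta> a) * (emb c \<otimes>\<^sub>m emb d \<otimes>\<^sub>m 1)
      = D2.ext (\<Delta> a) * ((emb c \<otimes>\<^sub>m E) * (1 \<otimes>\<^sub>m emb d \<otimes>\<^sub>m 1))"
  proof -
    have "D2.ext (\<Delta> a) * (1 \<otimes>\<^sub>m E) * (emb c \<otimes>\<^sub>m emb d \<otimes>\<^sub>m 1)
        = D2.ext (\<Delta> a) * ((emb c \<otimes>\<^sub>m E) * (1 \<otimes>\<^sub>m emb d \<otimes>\<^sub>m 1))"
      by (simp add: mult.assoc mtensor_mult)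
    then show ?thesis by (simp add: D2.e_ext)
  qed
  also have "\<dots> = emb (tmap (\<lambda>x. x) (\<lambda>q. T3 q d) (T3 a c))"
    by (simp add: e emb_T3 D2.extension(2) D2_left mult.assoc flip: D2.extension(3))
  finally show ?thesis by (simp only: emb3_inject)
qed

end

section \<open>The integral defined by a faithful cointegral\<close>

locale faithfully_cointegral = regular_weak_multiplier_hopf_algebra \<Delta> \<epsilon> E G1 G2 S
  for \<Delta> :: "'a::complex_algebra coprod" and \<epsilon> E G1 G2 S +
  fixes h :: 'a
  assumes cointegral: "left_cointegral \<Delta> S (emb h)"
    and faithful: "faithful_cointegral \<Delta> h"
begin

lemma h_nonzero: "h \<noteq> 0"
  using cointegral clinear_zero[OF lin_eta(5)] unfolding left_cointegral_def by metis

lemma cointegral_et: "a * h = et a \<triangleright> h"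
proof -
  have "emb a * emb h = et a * emb h"
    using cointegral unfolding left_cointegral_def eps_t_eq by blast
  then show ?thesis by (simp add: emb_simps(2) emb_inject)
qed

lemma faithful_right:
  assumes f: "clinear f" and "\<And>c. sl_r f (T3 h c) = 0"
  shows "f x = 0"
proof -
  have "slice_right f (\<Delta> h) = 0"
    by (rule multiplier_eqI_left[OF nd]) (simp add: slice_right_act f assms)
  then show ?thesis using faithful f unfolding faithful_cointegral_def by metis
qed

lemma faithful_left:
  assumes f: "clinear f" and "\<And>c. sl_l f (T1 \<Delta> (h \<otimes> c)) = 0"
  shows "f x = 0"
proof -
  have "slice_left f (\<Delta> h) = 0"
    by (rule multiplier_eqI_left[OF nd]) (simp add: slice_left_act f assms)
  then show ?thesis using faithful f unfolding faithful_cointegral_def by metis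
qed

text \<open>
  \<open>\<Sum> h\<^sub>1 \<otimes> ah\<^sub>2 = \<Sum> S(a\<^sub>1)a\<^sub>2h\<^sub>1 \<otimes> a\<^sub>3h\<^sub>2 = \<Sum> S(a\<^sub>1)\<epsilon>\<^sub>t(a\<^sub>2)h\<^sub>1 \<otimes> h\<^sub>2 = \<Sum> S(a)h\<^sub>1 \<otimes> h\<^sub>2\<close>
\<close>

lemma cointegral_coproduct: "(1 \<otimes>\<^sub>m emb a) * \<Delta> h = (emb (s a) \<otimes>\<^sub>m 1) * \<Delta> h"
proof (rule strip(4))
  fix y
  have cb: "cbilinear (\<lambda>u v. u * s v)" by (rule cb_s)
  have T2: "emb (T2 \<Delta> t) * \<Delta> h = (emb (tlift (\<lambda>u v. u * s v) (T2 \<Delta> t)) \<otimes>\<^sub>m 1) * \<Delta> h" for t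
  proof (induction t)
    case (add s t)
    then show ?case
      by (simp add: clinear_add[OF clinear_T(2)] clinear_add[OF lin_eta(5)] distrib_right
          clinear_add[OF clinear_tlift[OF cb]] clinear_add[OF lin_mtensor(1)[OF clinear_id(2)]])
  next
    case (tensor u v)
    have "emb (T2 \<Delta> (u \<otimes> v)) * \<Delta> h = (emb u \<otimes>\<^sub>m 1) * \<Delta> (et v \<triangleright> h)"
      by (simp add: emb_T2 mult.assoc flip: coproduct_mult cointegral_et)
    also have "\<dots> = (emb (u \<triangleleft> et v) \<otimes>\<^sub>m 1) * \<Delta> h"
      by (simp add: A_tD[OF et_A_t(1)] mtensor_mult emb_simps flip: mult.assoc)
    finally show ?case by (simp add: et)
  qed
  have "(emb y \<otimes>\<^sub>m 1) * ((1 \<otimes>\<^sub>m emb a) * \<Delta> h) = emb (y \<otimes> a) * (E * \<Delta> h)"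
    by (simp add: E_coproduct emb_tensor mtensor_mult flip: mult.assoc)
  also have "\<dots> = emb (T2 \<Delta> (R2 y a)) * \<Delta> h"
    by (simp only: R2(1) emb_simps(3)[symmetric] mult.assoc)
  also have "\<dots> = (emb y \<otimes>\<^sub>m 1) * ((emb (s a) \<otimes>\<^sub>m 1) * \<Delta> h)"
    using T2[of "R2 y a"] unfolding R2(1) antipode_E'
    by (simp add: emb_simps(1) mtensor_mult flip: mult.assoc)
  finally show "(emb y \<otimes>\<^sub>m 1) * ((1 \<otimes>\<^sub>m emb a) * \<Delta> h) = (emb y \<otimes>\<^sub>m 1) * ((emb (s a) \<otimes>\<^sub>m 1) * \<Delta> h)" .
qed

lemma cointegral_T3: "tmap (\<lambda>x. x) ((*) a) (T3 (h * b) c) = tmap ((*) (s a)) (\<lambda>x. x) (T3 (h * b) c)"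
proof -
  have "emb (tmap (\<lambda>x. x) ((*) a) (T3 (h * b) c)) = emb (tmap ((*) (s a)) (\<lambda>x. x) (T3 (h * b) c))"
    unfolding emb_tmap emb_T3 coproduct_mult by (simp add: cointegral_coproduct flip: mult.assoc)
  then show ?thesis by (simp only: emb2_inject)
qed

lemma cointegral_T3': "tmap (\<lambda>x. x) ((*) a) (T3 h c) = tmap ((*) (s a)) (\<lambda>x. x) (T3 h c)"
proof -
  have "emb (tmap (\<lambda>x. x) ((*) a) (T3 h c)) = emb (tmap ((*) (s a)) (\<lambda>x. x) (T3 h c))"
    unfolding emb_tmap emb_T3 by (simp add: cointegral_coproduct flip: mult.assoc)
  then show ?thesis by (simp only: emb2_inject)
qed

text \<open>
  The functional has to map \<open>(\<omega> \<otimes> id)(\<Delta>(h)(c \<otimes> 1))\<close> to \<open>\<omega>(c)\<close>.  A linear relation between these elements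
  is turned by faithfulness into a relation \<open>\<Sum> r\<^sub>i\<omega>\<^sub>i(xc\<^sub>i) = 0\<close> for all \<open>x \<in> A\<close>.
\<close>

lemma normalized_functional_exists:
  "\<exists>\<phi>. clinear \<phi> \<and> (\<forall>c. sl_r \<phi> (T3 h c) = c)"
proof -
  \<comment> \<open>\<open>L\<close> makes every index \<open>\<omega>\<close> linear, so that the index type needs no side condition.\<close>
  define L :: "('a \<Rightarrow> complex) \<Rightarrow> 'a \<Rightarrow> complex" where "L \<omega> = (if clinear \<omega> then \<omega> else (\<lambda>_. 0))" for \<omega>
  have L: "clinear (L \<omega>)" for \<omega> by (simp add: L_def clinear_iff)
  define u where "u = (\<lambda>(\<omega>, c). sl_l (L \<omega>) (T3 h c))"
  define e where "e = (\<lambda>(\<omega>, c). L \<omega> c)"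
  have rel: "(\<Sum>(r, i)\<leftarrow>xs. r * e i) = 0" if xs: "(\<Sum>(r, i)\<leftarrow>xs. r *\<^sub>C u i) = 0" for xs
  proof -
    define g where "g i x = L (fst i) (x * snd i)" for i x
    have g: "clinear (g i)" for i
      using clinear_compose[OF lin_times(1)[OF clinear_id(2), of "snd i"] L[of "fst i"]]
      by (simp add: g_def[abs_def])
    have "sl_l (g i) (T1 \<Delta> (h \<otimes> d)) = u i * d" for i d
    proof -
      have "emb (tmap (\<lambda>x. x * snd i) (\<lambda>x. x) (T1 \<Delta> (h \<otimes> d))) = emb (tmap (\<lambda>x. x) (\<lambda>x. x * d) (T3 h (snd i)))"
        by (simp add: emb_tmap emb_T1 emb_T3 mult.assoc mtensor_mult)
      then have eq: "tmap (\<lambda>x. x * snd i) (\<lambda>x. x) (T1 \<Delta> (h \<otimes> d)) = tmap (\<lambda>x. x) (\<lambda>x. x * d) (T3 h (snd i))"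
        by (simp only: emb2_inject)
      have "sl_l (L (fst i)) (tmap (\<lambda>x. x * snd i) (\<lambda>x. x) (T1 \<Delta> (h \<otimes> d))) = sl_l (g i) (T1 \<Delta> (h \<otimes> d))"
        by (simp add: sl_tmap L g_def[abs_def])
      then show ?thesis unfolding eq by (simp add: sl_tmap L u_def case_prod_beta)
    qed
    moreover have "(\<Sum>(r, i)\<leftarrow>xs. r *\<^sub>C (u i * d)) = (\<Sum>(r, i)\<leftarrow>xs. r *\<^sub>C u i) * d" for d
      by (induction xs) (auto simp: distrib_right mult_scaleC_left)
    ultimately have "sl_l (\<lambda>x. \<Sum>(r, i)\<leftarrow>xs. r * g i x) (T1 \<Delta> (h \<otimes> d)) = 0" for d
      by (simp add: sl_l_combination(2)[OF g] xs)
    then have 0: "(\<Sum>(r, i)\<leftarrow>xs. r * g i x) = 0" for x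
      by (rule faithful_left[OF sl_l_combination(1)[OF g]])
    \<comment> \<open>a common local unit of the \<open>c\<^sub>i\<close> in the place of \<open>x\<close>\<close>
    obtain k where "\<forall>c\<in>set (map (snd \<circ> snd) xs). k * c = c" using local_units by blast
    then have "(\<Sum>(r, i)\<leftarrow>xs. r * g i k) = (\<Sum>(r, i)\<leftarrow>xs. r * e i)"
      by (intro arg_cong[where f = sum_list] map_cong) (auto simp: g_def e_def)
    then show ?thesis using 0[of k] by simp
  qed
  obtain \<phi> where \<phi>: "clinear \<phi>" "\<And>i. \<phi> (u i) = e i"
    using functional_interpolation[of u e] rel by blast
  have "sl_r \<phi> (T3 h c) = c" for c
  proof (rule ccontr)
    assume "sl_r \<phi> (T3 h c) \<noteq> c"
    then obtain \<omega> :: "'a \<Rightarrow> complex" where \<omega>: "clinear \<omega>" "\<omega> (sl_r \<phi> (T3 h c) - c) \<noteq> 0"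
      using clinear_separates[of "sl_r \<phi> (T3 h c) - c"] by auto
    have "\<omega> (sl_r \<phi> (T3 h c)) = \<omega> c"
      using \<phi>(2)[of "(\<omega>, c)"] slice_exchange[OF \<omega>(1) \<phi>(1)] by (simp add: u_def e_def L_def \<omega>(1))
    then show False using \<omega> by (simp add: clinear_diff)
  qed
  then show ?thesis using \<phi>(1) by blast
qed

definition \<phi> :: "'a \<Rightarrow> complex"
  where "\<phi> = (SOME \<phi>. clinear \<phi> \<and> (\<forall>c. sl_r \<phi> (T3 h c) = c))"

lemma \<phi>: "clinear \<phi>" "sl_r \<phi> (T3 h c) = c"
  using someI_ex[OF normalized_functional_exists] unfolding \<phi>_def by blast+

lemma lin_\<phi> [lin]: "clinear k \<Longrightarrow> clinear (\<lambda>x. \<phi> (k x))"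
  by (rule clinear_compose[OF _ \<phi>(1)])

text \<open>
  A functional vanishing on all \<open>(\<omega> \<otimes> id)(\<Delta>(h)(c \<otimes> 1))\<close> has zero slices of \<open>\<Delta>(h)\<close>, so it is zero.
\<close>

lemma right_leg_UNIV: "x \<in> cspan {sl_l \<omega> (T3 h c) |\<omega> c. clinear \<omega>}" (is "_ \<in> ?V")
proof (rule ccontr)
  assume x: "x \<notin> ?V"
  obtain p where p: "clinear p" "\<And>v. v \<in> ?V \<Longrightarrow> p v = v" "\<And>x. p x \<in> ?V"
    using subspace_projection[OF complex_vector.subspace_span] by blast
  have "x - p x \<noteq> 0" using x p(3)[of x] by auto
  then obtain g :: "'a \<Rightarrow> complex" where g: "clinear g" "g (x - p x) \<noteq> 0"
    using clinear_separates by blast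
  let ?f = "\<lambda>x. g (x - p x)"
  have f: "clinear ?f" by (rule clinear_compose[OF _ g(1)]) (intro lin p(1))
  have "sl_r ?f (T3 h c) = 0" for c
  proof (rule ccontr)
    assume "sl_r ?f (T3 h c) \<noteq> 0"
    then obtain \<omega> :: "'a \<Rightarrow> complex" where \<omega>: "clinear \<omega>" "\<omega> (sl_r ?f (T3 h c)) \<noteq> 0"
      using clinear_separates by blast
    have "sl_l \<omega> (T3 h c) \<in> ?V" using \<omega>(1) by (blast intro: complex_vector.span_base)
    then have "?f (sl_l \<omega> (T3 h c)) = 0" using p(2) by (simp add: clinear_zero[OF g(1)])
    then show False using \<omega> slice_exchange[OF \<omega>(1) f] by simp
  qed
  then show False using faithful_right[OF f, of x] g(2) by blast
qed

text \<open>
  \<open>(id \<otimes> id \<otimes> \<phi>)\<Delta>\<^sup>2(h) = \<Delta>((id \<otimes> \<phi>)\<Delta>(h)) = \<Delta>(1) = E\<close>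
\<close>

lemma slice_cointegral: "tmap (\<lambda>x. x) (\<lambda>q. sl_r \<phi> (T3 q d)) (T3 h c) = E \<triangleright> (c \<otimes> d)"
proof -
  have l: "clinear (sl_r \<phi>)" using lin_sl(1)[OF \<phi>(1) clinear_id(2)] by simp
  have cb: "cbilinear (\<lambda>p q. tassoc (tmap (\<lambda>u. T1 \<Delta> (u \<otimes> q)) (\<lambda>x. x) (T3 h p)))" by (intro lin)
  obtain w where w: "E \<triangleright> (c \<otimes> d) = T1 \<Delta> w" by (rule E_eq_T1)
  have "tmap (\<lambda>x. x) (\<lambda>q. sl_r \<phi> (T3 q d)) (T3 h c)
      = tmap (\<lambda>x. x) (sl_r \<phi>) (tmap (\<lambda>x. x) (\<lambda>q. T3 q d) (T3 h c))"
    by (rule tmap_tmap[symmetric]) (intro lin l)+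
  also have "\<dots> = tmap (\<lambda>x. x) (sl_r \<phi>)
      (tlift (\<lambda>p q. tassoc (tmap (\<lambda>u. T1 \<Delta> (u \<otimes> q)) (\<lambda>x. x) (T3 h p))) w)"
    unfolding coassociative_T3[OF w] ..
  also have "\<dots> = T1 \<Delta> w"
  proof (rule clinear_eqI_tensor[OF _ clinear_T(1)])
    show "clinear (\<lambda>w. tmap (\<lambda>x. x) (sl_r \<phi>)
        (tlift (\<lambda>p q. tassoc (tmap (\<lambda>u. T1 \<Delta> (u \<otimes> q)) (\<lambda>x. x) (T3 h p))) w))"
      by (intro lin l)
    show "tmap (\<lambda>x. x) (sl_r \<phi>) (tlift (\<lambda>p q. tassoc (tmap (\<lambda>u. T1 \<Delta> (u \<otimes> q)) (\<lambda>x. x) (T3 h p))) (p \<otimes> q))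
        = T1 \<Delta> (p \<otimes> q)" for p q
    proof -
      have "clinear (\<lambda>u. T1 \<Delta> (u \<otimes> q))" by (intro lin)
      from sl_r_tassoc_tmap[OF \<phi>(1) this] show ?thesis
        by (simp add: tlift_tensor[OF cb] \<phi>(2))
    qed
  qed
  finally show ?thesis using w by simp
qed

lemma slice_\<phi>_A_t: "slice_right \<phi> (\<Delta> a) \<in> A_t \<Delta> E"
proof -
  have l: "clinear (\<lambda>a. slice_right \<phi> (\<Delta> a))"
    unfolding clinear_iff
    by (intro conjI allI; rule multiplier_eqI_left[OF nd])
       (simp_all add: slice_right_act \<phi>(1) clinear_add[OF lin_sl(1)[OF \<phi>(1) lin_T34(1)[OF clinear_id(2)]]]
          clinear_scaleC[OF lin_sl(1)[OF \<phi>(1) lin_T34(1)[OF clinear_id(2)]]])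
  show ?thesis
    using right_leg_UNIV[of a]
  proof (induction rule: complex_vector.span_induct_alt)
    case base
    show ?case by (simp add: clinear_zero[OF l] complex_vector.subspace_0[OF A_t_subspace])
  next
    case (step r x z)
    then obtain \<omega> c where x: "x = sl_l \<omega> (T3 h c)" and \<omega>: "clinear \<omega>" by blast
    have k: "clinear (\<lambda>q. sl_r \<phi> (T3 q d))" for d by (intro lin \<phi>(1))
    have "slice_right \<phi> (\<Delta> x) \<triangleright> d = sl_l \<omega> (E \<triangleright> (c \<otimes> d))" for d
      unfolding slice_cointegral[symmetric] by (simp add: slice_right_act \<phi>(1) x sl_tmap(2) k \<omega>)
    then have "slice_right \<phi> (\<Delta> x) \<in> A_t \<Delta> E" by (rule slice_E(1)[OF \<omega>])
    then show ?case
      using step(2) by (simp add: clinear_add[OF l] clinear_scaleC[OF l]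
        complex_vector.subspace_add[OF A_t_subspace] complex_vector.subspace_scale[OF A_t_subspace])
  qed
qed

lemma \<phi>_integral: "\<phi> \<in> left_integrals \<Delta> E"
proof -
  have "\<phi> \<noteq> (\<lambda>_. 0)"
  proof
    assume "\<phi> = (\<lambda>_. 0)"
    then have "h = 0" using \<phi>(2)[of h] sl_r_zero by metis
    then show False using h_nonzero by blast
  qed
  then show ?thesis using \<phi>(1) slice_\<phi>_A_t unfolding left_integrals_def by blast
qed

text \<open>
  \<open>(id \<otimes> \<phi>(a\<cdot>))\<Delta>(h) = (id \<otimes> \<phi>)((S(a) \<otimes> 1)\<Delta>(h)) = S(a)\<close>
\<close>

lemma slice_\<phi>_times: "sl_r (\<lambda>q. \<phi> (a * q)) (T3 h c) = s a * c"
proof -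
  have "sl_r \<phi> (tmap (\<lambda>x. x) ((*) a) (T3 h c)) = sl_r \<phi> (tmap ((*) (s a)) (\<lambda>x. x) (T3 h c))"
    by (simp only: cointegral_T3')
  then show ?thesis by (simp add: sl_tmap \<phi>)
qed

lemma slice_times_\<phi>: "sl_r (\<lambda>q. \<phi> (q * a)) (T3 h c) = sl_r \<phi> (T1 \<Delta> (h \<otimes> a)) * c"
proof -
  have "emb (tmap (\<lambda>x. x) (\<lambda>x. x * a) (T3 h c)) = emb (tmap (\<lambda>x. x * c) (\<lambda>x. x) (T1 \<Delta> (h \<otimes> a)))"
    by (simp add: emb_tmap emb_T1 emb_T3 mult.assoc mtensor_mult)
  then have "sl_r \<phi> (tmap (\<lambda>x. x) (\<lambda>x. x * a) (T3 h c)) = sl_r \<phi> (tmap (\<lambda>x. x * c) (\<lambda>x. x) (T1 \<Delta> (h \<otimes> a)))"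
    by (simp only: emb2_inject)
  then show ?thesis by (simp add: sl_tmap \<phi>)
qed

lemma \<phi>_right_faithful:
  assumes "\<And>b. \<phi> (a * b) = 0"
  shows "a = 0"
proof -
  have "s a * c = 0" for c
    unfolding slice_\<phi>_times[symmetric] by (simp add: assms sl_r_zero)
  then have "s a = 0" by (rule nondegenerateD(1)[OF nd, of _ 0, simplified])
  then show ?thesis by (metis s_si(2) clinear_zero[OF si_linear])
qed

text \<open>
  A substitute for a modular automorphism of \<open>\<phi>\<close>: by the two preceding formulas, \<open>\<phi>(\<cdot>b)\<close> and \<open>\<phi>(b'\<cdot>)\<close> have the same
  slice of \<open>\<Delta>(h)\<close> if \<open>S(b') = (id \<otimes> \<phi>)(\<Delta>(h)(1 \<otimes> b))\<close>.
\<close>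

lemma \<phi>_modular: "\<phi> (x * b) = \<phi> (si (sl_r \<phi> (T1 \<Delta> (h \<otimes> b))) * x)"
proof -
  let ?b = "si (sl_r \<phi> (T1 \<Delta> (h \<otimes> b)))"
  have f: "clinear (\<lambda>x. \<phi> (x * b))" "clinear (\<lambda>x. \<phi> (?b * x))" by (intro lin)+
  have "sl_r (\<lambda>x. \<phi> (x * b) - \<phi> (?b * x)) t = sl_r (\<lambda>x. \<phi> (x * b)) t - sl_r (\<lambda>x. \<phi> (?b * x)) t" for t :: "'a tensor2"
    by (rule clinear_eqI_tensor[of "sl_r (\<lambda>x. \<phi> (x * b) - \<phi> (?b * x))"])
       (intro lin_sl(1)[OF _ clinear_id(2), simplified] lin_vector(6) f lin_sl(1) clinear_id(2)
        | simp add: f lin_vector(6)[OF f] complex_vector.scale_left_diff_distrib)+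
  then have "(\<lambda>x. \<phi> (x * b) - \<phi> (?b * x)) x = 0"
    by (intro faithful_right[OF lin_vector(6)[OF f]]) (simp add: slice_\<phi>_times slice_times_\<phi>)
  then show ?thesis by simp
qed

lemma \<phi>_left_faithful:
  assumes "\<And>b. \<phi> (b * a) = \<phi> (b * a')"
  shows "a = a'"
proof -
  have "\<phi> ((a - a') * b) = 0" for b
    using assms by (simp add: \<phi>_modular[of _ b] right_diff_distrib clinear_diff[OF \<phi>(1)])
  then have "a - a' = 0" by (rule \<phi>_right_faithful)
  then show ?thesis by simp
qed

lemma T3_inject:
  assumes "\<And>c. T3 a c = T3 b c"
  shows "a = b"
  by (rule coproduct_inject, rule strip(2)) (simp only: assms emb_T3[symmetric])

text \<open>
  Uniqueness of cointegrals up to \<open>A\<^sub>t\<close>.  Let \<open>y = (id \<otimes> \<phi>)\<Delta>(ha)\<close>.  Since \<open>ha\<close> satisfies the same relation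
  \<open>(1 \<otimes> b)\<Delta>(ha) = (S(b) \<otimes> 1)\<Delta>(ha)\<close> as \<open>h\<close> does, the slices of \<open>\<Delta>(ha)\<close> and \<open>\<Delta>(hy) = \<Delta>(h)(y \<otimes> 1)\<close> by \<open>\<phi>(b\<cdot>)\<close>
  are both \<open>S(b)y\<close>; left faithfulness of \<open>\<phi>\<close> gives equality.
\<close>

lemma cointegral_mult: "h * a = h \<triangleleft> slice_right \<phi> (\<Delta> (h * a))" (is "_ = h \<triangleleft> ?y")
proof (rule T3_inject, rule tensor_eqI_slices_left, rule \<phi>_left_faithful)
  fix c and \<omega> :: "'a \<Rightarrow> complex" and b
  assume \<omega>: "clinear \<omega>"
  have f: "clinear (\<lambda>q. \<phi> (b * q))" by (intro lin)
  have "sl_r \<phi> (tmap (\<lambda>x. x) ((*) b) (T3 (h * a) c)) = s b * (?y \<triangleright> c)"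
    unfolding cointegral_T3 by (simp add: sl_tmap \<phi> slice_right_act)
  then have "sl_r (\<lambda>q. \<phi> (b * q)) (T3 (h * a) c) = sl_r (\<lambda>q. \<phi> (b * q)) (T3 (h \<triangleleft> ?y) c)"
    by (simp add: sl_tmap \<phi> T3_A_t[OF slice_\<phi>_A_t] slice_\<phi>_times)
  then have "\<omega> (sl_r (\<lambda>q. \<phi> (b * q)) (T3 (h * a) c)) = \<omega> (sl_r (\<lambda>q. \<phi> (b * q)) (T3 (h \<triangleleft> ?y) c))"
    by simp
  then show "\<phi> (b * sl_l \<omega> (T3 (h * a) c)) = \<phi> (b * sl_l \<omega> (T3 (h \<triangleleft> ?y) c))"
    by (simp add: slice_exchange[OF \<omega> f])
qed

lemma gamma_t_eq: "gamma_t \<Delta> E h a = slice_right \<phi> (\<Delta> (h * a))"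
  unfolding gamma_t_def
proof (rule the_equality)
  show "slice_right \<phi> (\<Delta> (h * a)) \<in> A_t \<Delta> E \<and> emb (h * a) = emb h * slice_right \<phi> (\<Delta> (h * a))"
    using slice_\<phi>_A_t cointegral_mult by (simp add: emb_simps(3))
  fix x
  assume x: "x \<in> A_t \<Delta> E \<and> emb (h * a) = emb h * x"
  then have "h * a = h \<triangleleft> x" by (simp add: emb_simps(3) emb_inject)
  then show "x = slice_right \<phi> (\<Delta> (h * a))"
    using x by (intro multiplier_eqI_left[OF nd]) (simp add: slice_right_act \<phi> T3_A_t)
qed

text \<open>
  \<open>\<Sum> (id \<otimes> \<phi>)(\<Delta>(ha\<^sub>2)(S\<inverse>(a\<^sub>1) \<otimes> 1)) = (id \<otimes> \<phi>)(\<Delta>(h)E(1 \<otimes> a))\<close> by \<open>E(1 \<otimes> a) = \<Sum> a\<^sub>2S\<inverse>(a\<^sub>1) \<otimes> a\<^sub>3\<close>,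
  and \<open>\<Delta>(h)E = \<Delta>(h)\<close>.
\<close>

lemma S1'_eq: "S1' \<Delta> E S h a = emb (sl_r \<phi> (T1 \<Delta> (h \<otimes> a)))"
proof -
  have *: "tlift (\<lambda>p q. gamma_t \<Delta> E h q \<triangleright> si p) (T2 \<Delta> (c \<otimes> a)) = sl_r \<phi> (T1 \<Delta> (h \<otimes> a)) * si c" for c
  proof -
    have l: "clinear (\<lambda>t. sl_r \<phi> (\<Delta> h \<triangleright> t))" by (intro lin \<phi>(1))
    have T3: "T3 (h * q) x = \<Delta> h \<triangleright> T3 q x" for q x
    proof -
      have "emb (T3 (h * q) x) = emb (\<Delta> h \<triangleright> T3 q x)"
        by (simp add: emb_T3 coproduct_mult mult.assoc flip: emb_simps(2))
      then show ?thesis by (simp only: emb2_inject)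
    qed
    have "tlift (\<lambda>p q. gamma_t \<Delta> E h q \<triangleright> si p) (T2 \<Delta> (c \<otimes> a))
        = tlift (\<lambda>p q. sl_r \<phi> (\<Delta> h \<triangleright> T3 q (si p))) (T2 \<Delta> (c \<otimes> a))"
      by (simp add: gamma_t_eq slice_right_act \<phi>(1) T3)
    also have "\<dots> = sl_r \<phi> (\<Delta> h \<triangleright> (E \<triangleright> (si c \<otimes> a)))"
      unfolding E_right_T2 by (rule clinear_out_tlift[OF l cb_T3_si, symmetric])
    also have "\<Delta> h \<triangleright> (E \<triangleright> (si c \<otimes> a)) = tmap (\<lambda>x. x * si c) (\<lambda>x. x) (T1 \<Delta> (h \<otimes> a))"
    proof -
      have "emb (\<Delta> h \<triangleright> (E \<triangleright> (si c \<otimes> a))) = emb (tmap (\<lambda>x. x * si c) (\<lambda>x. x) (T1 \<Delta> (h \<otimes> a)))"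
        by (simp add: emb_tmap emb_T1 emb_tensor mtensor_mult E_coproduct mult.assoc[symmetric]
            flip: emb_simps(2)) (simp add: mult.assoc mtensor_mult)
      then show ?thesis by (simp only: emb2_inject)
    qed
    finally show ?thesis by (simp add: sl_tmap \<phi>(1))
  qed
  show ?thesis
    unfolding S1'_def *
  proof (rule the_equality)
    fix m
    assume "\<forall>c. m \<triangleright> si c = sl_r \<phi> (T1 \<Delta> (h \<otimes> a)) * si c"
    then have "m \<triangleright> x = sl_r \<phi> (T1 \<Delta> (h \<otimes> a)) * x" for x by (metis s_si(2))
    then show "m = emb (sl_r \<phi> (T1 \<Delta> (h \<otimes> a)))" by (intro multiplier_eqI_left[OF nd]) simp
  qed simp
qed

lemma inj_S1': "inj (S1' \<Delta> E S h)"
proof (rule injI, rule \<phi>_left_faithful)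
  fix a a' b
  assume "S1' \<Delta> E S h a = S1' \<Delta> E S h a'"
  then have "sl_r \<phi> (T1 \<Delta> (h \<otimes> a)) = sl_r \<phi> (T1 \<Delta> (h \<otimes> a'))"
    by (simp add: S1'_eq emb_inject)
  then show "\<phi> (b * a) = \<phi> (b * a')" by (subst (1 2) \<phi>_modular) simp
qed

end

theorem proposition4p10:
  fixes \<Delta> :: "'a::complex_algebra coprod"
    and \<epsilon> :: "'a \<Rightarrow> complex"
    and E :: "'a tensor2 multiplier"
    and G1 G2 :: "'a tensor2 \<Rightarrow> 'a tensor2"
    and S :: "'a \<Rightarrow> 'a multiplier"
    and h :: 'a
  assumes "regular_weak_multiplier_hopf_algebra \<Delta> \<epsilon> E G1 G2 S"
    and "left_cointegral \<Delta> S (emb h)"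
    and "faithful_cointegral \<Delta> h"
  shows "(\<forall>a. (\<forall>\<phi>\<in>left_integrals \<Delta> E. \<forall>b. \<phi> (a * b) = 0) \<longrightarrow> a = 0) \<and>
    ((\<forall>a. (\<forall>\<phi>\<in>left_integrals \<Delta> E. \<forall>b. \<phi> (b * a) = 0) \<longrightarrow> a = 0)
      \<longleftrightarrow> inj (S1' \<Delta> E S h))"
proof -
  interpret faithfully_cointegral \<Delta> \<epsilon> E G1 G2 S h
    using assms by (intro faithfully_cointegral.intro faithfully_cointegral_axioms.intro)
  have "a = 0" if "\<forall>\<phi>\<in>left_integrals \<Delta> E. \<forall>b. \<phi> (a * b) = 0" for a
    by (rule \<phi>_right_faithful, rule bspec[OF that \<phi>_integral, rule_format])
  moreover have "a = 0" if "\<forall>\<phi>\<in>left_integrals \<Delta> E. \<forall>b. \<phi> (b * a) = 0" for a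
  proof (rule \<phi>_left_faithful)
    show "\<phi> (b * a) = \<phi> (b * 0)" for b
      using bspec[OF that \<phi>_integral, rule_format, of b] by (simp add: clinear_zero[OF \<phi>(1)])
  qed
  ultimately show ?thesis using inj_S1' by blast
qed

end
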